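(* Let $X$ and $Y$ be connected complex manifolds, with $X$ non-compact, let $\mathbf{F}$ be a normed space of holomorphic functions (NSHF) over $X$ and let $\mathbf{E}$ be an NSHF over $Y$. (i) Suppose that $\mathbf{F}$ separates points of $X$. If $\Phi:Y\to X$ is continuous and $C_{\Phi}\mathbf{F}\subset\mathbf{E}$, then $\Phi$ is holomorphic. (ii) Suppose that $\mathbf{F}$ is $2$-independent. If $\Phi:Y\to X$ and $\omega:Y\to\mathbb{C}$ are continuous and $W_{\Phi,\omega}\mathbf{F}\subset\mathbf{E}$, then $W_{\Phi,\omega}$ is a holomorphically induced weighted composition operator from $\mathbf{F}$ into $\mathbf{E}$, i.e. there are holomorphic $\Phi':Y\to X$ and $\omega':Y\to\mathbb{C}$ such that $W_{\Phi,\omega}f=W_{\Phi',\omega'}f$ for every $f\in\mathbf{F}$.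
   Context: Manifolds are Hausdorff, connected and without boundary. Scalars are $\mathbb{C}$. A normed space of holomorphic functions (NSHF) over a complex manifold $X$ is a linear subspace $\mathbf{F}$ of the space $\mathcal{H}(X)$ of holomorphic functions on $X$, equipped with a norm such that the inclusion of $\mathbf{F}$ into the space $\mathcal{C}(X)$ of continuous functions with the compact-open topology is continuous. For maps $\Phi:Y\to X$, $\omega:Y\to\mathbb{C}$ and $f:X\to\mathbb{C}$: $[W_{\Phi,\omega}f](y)=\omega(y)f(\Phi(y))$, and $C_\Phi=W_{\Phi,1}$. $\mathbf{F}$ separates points of $X$ if for any distinct $x,y\in X$ there is $f\in\mathbf{F}$ with $f(x)\neq f(y)$. $\mathbf{F}$ is $2$-independent if for every distinct $x,y\in X$ the point evaluations $f\mapsto f(x)$ and $f\mapsto f(y)$ are linearly independent functionals on $\mathbf{F}$. *)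

theory Defs
  imports "HOL-Analysis.Analysis"
begin

text \<open>
  Several complex variables. The space of \<open>n\<close> complex variables is the subspace \<open>Cspace n\<close> of
  \<open>nat \<Rightarrow> complex\<close> (product topology), so that dimensions are natural numbers and dimension \<open>0\<close>
  is included; on \<open>Cspace n\<close> this is the usual Euclidean topology.
\<close>

definition Cspace :: "nat \<Rightarrow> (nat \<Rightarrow> complex) set" where
  "Cspace n = {z. \<forall>i\<ge>n. z i = 0}"

definition Cnorm :: "nat \<Rightarrow> (nat \<Rightarrow> complex) \<Rightarrow> real" where
  "Cnorm n z = L2_set (\<lambda>i. norm (z i)) {..<n}"

text \<open>
  Complex (Frechet) differentiability at every point; to be used for sets \<open>U\<close> that are open in
  \<open>Cspace n\<close>.
\<close>

definition holomorphic_Cn :: "nat \<Rightarrow> ((nat \<Rightarrow> complex) \<Rightarrow> complex) \<Rightarrow> (nat \<Rightarrow> complex) set \<Rightarrow> bool" where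
  "holomorphic_Cn n f U \<longleftrightarrow>
     (\<forall>z\<in>U. \<exists>a :: nat \<Rightarrow> complex.
        ((\<lambda>w. (f w - f z - (\<Sum>i<n. a i * (w i - z i)))
              / complex_of_real (Cnorm n (\<lambda>i. w i - z i))) \<longlongrightarrow> 0) (at z within U))"

text \<open>
  A chart is a pair \<open>(U, \<phi>)\<close>; the values of \<open>\<phi>\<close> outside \<open>U\<close> are irrelevant. An atlas is not
  required to be maximal: holomorphy of functions and maps with respect to an atlas is the same as
  with respect to the complex structure it generates. The underlying set of a manifold is a whole
  type, so that functions on the manifold are exactly the functions on that type. No countability
  axiom is imposed.
\<close>

type_synonym 'a chart = "'a set \<times> ('a \<Rightarrow> nat \<Rightarrow> complex)"

definition is_chart :: "nat \<Rightarrow> 'a::topological_space chart \<Rightarrow> bool" where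
  "is_chart n = (\<lambda>(U, \<phi>).
     open U \<and> openin (top_of_set (Cspace n)) (\<phi> ` U) \<and>
     homeomorphism U (\<phi> ` U) \<phi> (inv_into U \<phi>))"

definition complex_atlas :: "nat \<Rightarrow> 'a::topological_space chart set \<Rightarrow> bool" where
  "complex_atlas n A \<longleftrightarrow>
     (\<forall>c\<in>A. is_chart n c) \<and>
     (\<Union>(U, \<phi>)\<in>A. U) = UNIV \<and>
     (\<forall>(U, \<phi>)\<in>A. \<forall>(V, \<psi>)\<in>A. \<forall>i<n.
        holomorphic_Cn n (\<lambda>z. \<psi> (inv_into U \<phi> z) i) (\<phi> ` (U \<inter> V)))"

definition connected_complex_manifold :: "nat \<Rightarrow> 'a::t2_space chart set \<Rightarrow> bool" where
  "connected_complex_manifold n A \<longleftrightarrow> connected (UNIV :: 'a set) \<and> complex_atlas n A"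

definition holomorphic_fun :: "nat \<Rightarrow> 'a::topological_space chart set \<Rightarrow> ('a \<Rightarrow> complex) \<Rightarrow> bool" where
  "holomorphic_fun n A f \<longleftrightarrow>
     (\<forall>(U, \<phi>)\<in>A. holomorphic_Cn n (\<lambda>z. f (inv_into U \<phi> z)) (\<phi> ` U))"

definition holomorphic_map ::
  "nat \<Rightarrow> 'b::topological_space chart set \<Rightarrow> nat \<Rightarrow> 'a::topological_space chart set \<Rightarrow> ('b \<Rightarrow> 'a) \<Rightarrow> bool"
where
  "holomorphic_map m B n A \<Phi> \<longleftrightarrow>
     continuous_on UNIV \<Phi> \<and>
     (\<forall>(V, \<psi>)\<in>B. \<forall>(U, \<phi>)\<in>A. \<forall>i<n.
        holomorphic_Cn m (\<lambda>z. \<phi> (\<Phi> (inv_into V \<psi> z)) i) (\<psi> ` (V \<inter> \<Phi> -` U)))"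

definition compact_open_topology :: "('a::topological_space \<Rightarrow> complex) topology" where
  "compact_open_topology =
     topology_generated_by
       {{f. continuous_on UNIV f \<and> f ` K \<subseteq> U} | K U. compact K \<and> open U}"

lemma topspace_compact_open_topology:
  "topspace (compact_open_topology :: ('a::topological_space \<Rightarrow> complex) topology) =
     {f. continuous_on UNIV f}"
proof -
  have "{f :: 'a \<Rightarrow> complex. continuous_on UNIV f} \<in>
      {{f. continuous_on UNIV f \<and> f ` K \<subseteq> U} | K U. compact K \<and> open U}"
    by (rule CollectI, rule exI[of _ "{}"], rule exI[of _ UNIV]) auto
  then show ?thesis
    unfolding compact_open_topology_def topology_generated_by_topspace by blast
qed

definition function_subspace :: "('a \<Rightarrow> complex) set \<Rightarrow> bool" where
  "function_subspace F \<longleftrightarrow>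
     (\<lambda>x. 0) \<in> F \<and>
     (\<forall>f\<in>F. \<forall>g\<in>F. (\<lambda>x. f x + g x) \<in> F) \<and>
     (\<forall>c. \<forall>f\<in>F. (\<lambda>x. c * f x) \<in> F)"

definition is_norm_on :: "('a \<Rightarrow> complex) set \<Rightarrow> (('a \<Rightarrow> complex) \<Rightarrow> real) \<Rightarrow> bool" where
  "is_norm_on F N \<longleftrightarrow>
     (\<forall>f\<in>F. 0 \<le> N f \<and> (N f = 0 \<longleftrightarrow> f = (\<lambda>x. 0))) \<and>
     (\<forall>c. \<forall>f\<in>F. N (\<lambda>x. c * f x) = norm c * N f) \<and>
     (\<forall>f\<in>F. \<forall>g\<in>F. N (\<lambda>x. f x + g x) \<le> N f + N g)"

text \<open>
  The value \<open>0\<close> off \<open>F\<close> is only there because the locale \<open>Metric_space\<close> requires nonnegativity and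
  symmetry of the distance on the whole type.
\<close>

definition norm_dist ::
  "('a \<Rightarrow> complex) set \<Rightarrow> (('a \<Rightarrow> complex) \<Rightarrow> real) \<Rightarrow> ('a \<Rightarrow> complex) \<Rightarrow> ('a \<Rightarrow> complex) \<Rightarrow> real"
where
  "norm_dist F N f g = (if f \<in> F \<and> g \<in> F then N (\<lambda>x. f x - g x) else 0)"

lemma Metric_space_norm_dist:
  assumes F: "function_subspace F" and N: "is_norm_on F N"
  shows "Metric_space F (norm_dist F N)"
proof -
  have add: "(\<lambda>x. f x + g x) \<in> F" if "f \<in> F" "g \<in> F" for f g
    using F that unfolding function_subspace_def by blast
  have scale: "(\<lambda>x. c * f x) \<in> F" if "f \<in> F" for c f
    using F that unfolding function_subspace_def by blast
  have diff: "(\<lambda>x. f x - g x) \<in> F" if "f \<in> F" "g \<in> F" for f g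
    using add[OF that(1) scale[OF that(2), of "-1"]] by simp
  have hom: "N (\<lambda>x. c * f x) = norm c * N f" if "f \<in> F" for c f
    using N that unfolding is_norm_on_def by blast
  have tri: "N (\<lambda>x. f x + g x) \<le> N f + N g" if "f \<in> F" "g \<in> F" for f g
    using N that unfolding is_norm_on_def by blast
  show ?thesis
  proof
    show "0 \<le> norm_dist F N f g" for f g
      using N diff unfolding norm_dist_def is_norm_on_def by auto
  next
    fix f g
    have "N (\<lambda>x. f x - g x) = N (\<lambda>x. g x - f x)" if "f \<in> F" "g \<in> F"
      using hom[OF diff[OF that], of "-1"] by simp
    then show "norm_dist F N f g = norm_dist F N g f"
      by (simp add: norm_dist_def)
  next
    fix f g assume "f \<in> F" "g \<in> F"
    then have "norm_dist F N f g = 0 \<longleftrightarrow> (\<lambda>x. f x - g x) = (\<lambda>x. 0)"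
      using N diff unfolding norm_dist_def is_norm_on_def by simp
    then show "norm_dist F N f g = 0 \<longleftrightarrow> f = g"
      by (simp add: fun_eq_iff)
  next
    fix f g h assume fgh: "f \<in> F" "g \<in> F" "h \<in> F"
    have "N (\<lambda>x. f x - h x) \<le> N (\<lambda>x. f x - g x) + N (\<lambda>x. g x - h x)"
      using tri[OF diff[OF fgh(1,2)] diff[OF fgh(2,3)]] by simp
    then show "norm_dist F N f h \<le> norm_dist F N f g + norm_dist F N g h"
      using fgh by (simp add: norm_dist_def)
  qed
qed

definition NSHF ::
  "nat \<Rightarrow> 'a::topological_space chart set \<Rightarrow> ('a \<Rightarrow> complex) set \<Rightarrow> (('a \<Rightarrow> complex) \<Rightarrow> real) \<Rightarrow> bool"
where
  "NSHF n A F N \<longleftrightarrow>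
     F \<subseteq> {f. holomorphic_fun n A f} \<and> function_subspace F \<and> is_norm_on F N \<and>
     continuous_map (Metric_space.mtopology F (norm_dist F N)) compact_open_topology (\<lambda>f. f)"

definition weighted_comp :: "('b \<Rightarrow> 'a) \<Rightarrow> ('b \<Rightarrow> complex) \<Rightarrow> ('a \<Rightarrow> complex) \<Rightarrow> 'b \<Rightarrow> complex" where
  "weighted_comp \<Phi> \<omega> f = (\<lambda>y. \<omega> y * f (\<Phi> y))"

definition comp_op :: "('b \<Rightarrow> 'a) \<Rightarrow> ('a \<Rightarrow> complex) \<Rightarrow> 'b \<Rightarrow> complex" where
  "comp_op \<Phi> = weighted_comp \<Phi> (\<lambda>y. 1)"

definition separates_points :: "('a \<Rightarrow> complex) set \<Rightarrow> bool" where
  "separates_points F \<longleftrightarrow> (\<forall>x y. x \<noteq> y \<longrightarrow> (\<exists>f\<in>F. f x \<noteq> f y))"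

definition two_independent :: "('a \<Rightarrow> complex) set \<Rightarrow> bool" where
  "two_independent F \<longleftrightarrow>
     (\<forall>x y. x \<noteq> y \<longrightarrow>
        (\<forall>a b :: complex. (\<forall>f\<in>F. a * f x + b * f y = 0) \<longrightarrow> a = 0 \<and> b = 0))"

end

theory Submission
  imports Defs "HOL-Complex_Analysis.Complex_Analysis"
begin

text \<open>
  Restricting to coordinate discs of \<open>Y\<close> reduces (i) to a continuous curve \<open>c\<close> from a disc into a chart
  of \<open>X\<close>. Let \<open>\<A>\<close> be the set of holomorphic \<open>h\<close> on the chart with \<open>h \<circ> c\<close> holomorphic. Among all
  maps \<open>g\<close> into \<open>\<complex>\<^sup>n\<close> whose Jacobian determinant does not vanish identically along \<open>c\<close>, take one with
  as many components in \<open>\<A>\<close> as possible. If some \<open>g\<^sub>i\<close> is not in \<open>\<A>\<close>, maximality yields a vector field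
  \<open>V\<close>, dual to \<open>dg\<^sub>i\<close>, such that \<open>V h = 0\<close> along \<open>c\<close> for all \<open>h \<in> \<A>\<close>; then \<open>V h\<close> is again in \<open>\<A>\<close>,
  so all iterated derivatives vanish and \<open>h\<close> is constant on a nontrivial flow line of \<open>V\<close>, which
  contradicts the separation of points. Hence all \<open>g\<^sub>i\<close> lie in \<open>\<A>\<close>, so \<open>c\<close> is holomorphic where the
  determinant does not vanish, and a version of Rado's theorem extends this to the whole disc.

  For (ii), quotients \<open>f / f\<^sub>0\<close> separate points where \<open>f\<^sub>0\<close> does not vanish, and their pullbacks do not
  involve \<open>\<omega>\<close>. So \<open>\<Phi>\<close> and \<open>\<omega>\<close> are holomorphic off the zeros of \<open>\<omega>\<close>; by Rado's theorem \<open>\<omega>\<close> is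
  holomorphic, and unless it vanishes identically its zero set is thin and removable for \<open>\<Phi>\<close>.
\<close>

section \<open>Rado's theorem\<close>

text \<open>Separating functions may have degenerate differentials: \<open>z^2\<close> and
  \<open>z^3\<close> separate the points of the plane, but neither is a coordinate at
  \<open>0\<close>. So charts cannot be assembled from \<open>F\<close> itself. Moreover
  \<open>c\<close> is merely continuous, so all differentiation has to happen on the chart.
  \<open>F\<close> is not stable under vector fields, but \<A> is stable under \<open>V\<close>:
  maximality makes \<open>V h\<close> vanish along \<open>c\<close>, and a function that vanishes
  along \<open>c\<close> has a holomorphic pullback however irregular \<open>c\<close> is. The flow
  line is nontrivial because \<open>V g\<^sub>i\<close> is nonzero at a suitable point of the curve.

  The determinant along \<open>c\<close> is known to be holomorphic only off its own zeros, so these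
  zeros are not known to be discrete; hence Rado's theorem instead of removal of isolated
  singularities.

  Non-compactness of \<open>X\<close> supplies a second point in (ii). With it, 2-independence makes
  every point evaluation on \<open>F\<close> nonzero, which provides \<open>f\<^sub>0\<close>. If
  \<omega> is identically zero, \<Phi> can be any continuous map; this is why (ii) asks for some
  inducing pair and not for holomorphy of the given one.\<close>

lemma max_modulus_off_zeros:
  fixes f h :: "complex \<Rightarrow> complex"
  assumes S: "open S" "bounded S"
    and f: "continuous_on (closure S) f" "f holomorphic_on S"
    and h: "continuous_on (closure S) h" "h holomorphic_on S"
    and bd: "\<And>z. z \<in> frontier S \<Longrightarrow> f z = 0 \<or> norm (h z) \<le> M"
    and M: "0 < M" and z: "z \<in> S" "f z \<noteq> 0"
  shows "norm (h z) \<le> M"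
proof (rule ccontr)
  assume "\<not> norm (h z) \<le> M"
  then have gt: "norm (h z) / M > 1" using M by (simp add: field_simps)
  have "compact (closure S)" using S by simp
  then have "bounded (f ` closure S)" using f(1) compact_continuous_image compact_imp_bounded by blast
  then obtain C where C: "\<And>z. z \<in> closure S \<Longrightarrow> norm (f z) \<le> C" "C > 0"
    unfolding bounded_pos by blast
  \<comment> \<open>The factor \<open>f\<close> removes the boundary points where \<open>h\<close>
    is not bounded by \<open>M\<close>, at the price of the constant \<open>C / norm (f z)\<close>.
    A large power of \<open>h\<close> beats this constant.\<close>
  obtain k where k: "(norm (h z) / M) ^ k > C / norm (f z)"
    using gt real_arch_pow by blast
  have "norm ((h z)^k * f z) \<le> M ^ k * C"
  proof (rule maximum_modulus_frontier[of "\<lambda>z. (h z)^k * f z" S])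
    show "(\<lambda>z. h z ^ k * f z) holomorphic_on interior S"
      using S f h by (auto intro!: holomorphic_intros simp: interior_open)
    show "continuous_on (closure S) (\<lambda>z. h z ^ k * f z)"
      using f h by (auto intro!: continuous_intros)
    fix w assume w: "w \<in> frontier S"
    then have cl: "w \<in> closure S" by (simp add: frontier_def)
    show "norm (h w ^ k * f w) \<le> M ^ k * C"
    proof (cases "f w = 0")
      case True
      then show ?thesis using M C(2) by simp
    next
      case False
      then have "norm (h w) \<le> M" using bd w by blast
      then show ?thesis using C(1)[OF cl] M
        by (auto simp: norm_mult norm_power intro!: mult_mono power_mono)
    qed
  qed (use S z in auto)
  moreover have "M ^ k > 0" "norm (f z) > 0" using M z by auto
  ultimately have "(norm (h z) / M) ^ k \<le> C / norm (f z)"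
    by (simp add: norm_mult norm_power field_simps)
  then show False using k by simp
qed

lemma open_nonzero_set:
  fixes f :: "complex \<Rightarrow> complex"
  assumes "continuous_on (cball a r) f"
  shows "open {z \<in> ball a r. f z \<noteq> 0}"
proof -
  have "continuous_on (ball a r) f" using assms continuous_on_subset ball_subset_cball by blast
  then have "open (ball a r \<inter> f -` (- {0}))"
    by (rule continuous_open_preimage) auto
  moreover have "{z \<in> ball a r. f z \<noteq> 0} = ball a r \<inter> f -` (- {0})" by auto
  ultimately show ?thesis by simp
qed

text \<open>Otherwise some \<open>b\<close> outside \<open>closure S\<close> lies close to
  \<open>S\<close>, and \<open>1 / (z - b)\<close> is large at points of \<open>S\<close> near
  \<open>b\<close>. The maximum principle forbids this, because boundary points of \<open>S\<close>
  with \<open>f \<noteq> 0\<close> lie on the sphere, far away from \<open>b\<close>.\<close>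

lemma dense_nonzero_set:
  fixes f :: "complex \<Rightarrow> complex"
  assumes f: "continuous_on (cball a r) f"
    and S: "S = {z \<in> ball a r. f z \<noteq> 0}" and hol: "f holomorphic_on S"
    and ne: "S \<noteq> {}"
  shows "ball a r \<subseteq> closure S"
proof (rule ccontr)
  assume not: "\<not> ?thesis"
  have op: "open S" using open_nonzero_set[of a r f] f S by simp
  have clS: "closure S \<subseteq> cball a r"
    by (rule closure_minimal) (use S in auto)
  have fr: "w \<in> sphere a r \<or> f w = 0" if "w \<in> frontier S" for w
  proof -
    have "w \<notin> S" "w \<in> cball a r" using that op clS by (auto simp: frontier_def interior_open)
    then show ?thesis using S by auto
  qed
  have "\<exists>w\<in>ball a r. w \<in> frontier (closure S)"
  proof -
    have "S \<subseteq> ball a r" using S by auto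
    then have "ball a r \<inter> closure S \<noteq> {}" using ne closure_subset[of S] by blast
    moreover have "ball a r - closure S \<noteq> {}" using not by blast
    ultimately have "ball a r \<inter> frontier (closure S) \<noteq> {}"
      using connected_Int_frontier connected_ball by blast
    then show ?thesis by blast
  qed
  then obtain w where w: "w \<in> ball a r" "w \<in> frontier (closure S)" by blast
  \<comment> \<open>\<open>w\<close> has distance \<open>4 * \<epsilon>\<close> from the sphere.
    With \<open>b\<close> and \<open>z\<close> within \<open>\<epsilon>\<close> of \<open>w\<close>,
    the sphere is at least \<open>3 * \<epsilon>\<close> away from \<open>b\<close>, while
    \<open>z\<close> is closer to \<open>b\<close> than \<open>2 * \<epsilon>\<close>.\<close>
  define \<epsilon> where "\<epsilon> = (r - dist a w) / 4"
  have \<epsilon>: "\<epsilon> > 0" using w by (simp add: \<epsilon>_def)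
  have "w \<in> closure S" "w \<notin> interior (closure S)" using w by (auto simp: frontier_def)
  then obtain b where b: "dist b w < \<epsilon>" "b \<notin> closure S"
    using \<epsilon> by (metis mem_interior mem_ball dist_commute subsetI)
  obtain z where z: "z \<in> S" "dist z w < \<epsilon>"
    using \<open>w \<in> closure S\<close> \<epsilon> closure_approachable by blast
  have "norm (1 / (z - b)) \<le> 1 / (3 * \<epsilon>)"
  proof (rule max_modulus_off_zeros[of S f "\<lambda>z. 1 / (z - b)"])
    show "bounded S" by (rule bounded_subset[OF bounded_ball, of _ a r]) (use S in auto)
    show "continuous_on (closure S) f" using f clS continuous_on_subset by blast
    show "continuous_on (closure S) (\<lambda>z. 1 / (z - b))" using b
      by (intro continuous_intros) auto
    show "(\<lambda>z. 1 / (z - b)) holomorphic_on S" using b closure_subset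
      by (intro holomorphic_intros) auto
    show "f u = 0 \<or> norm (1 / (u - b)) \<le> 1 / (3 * \<epsilon>)" if "u \<in> frontier S" for u
    proof (cases "f u = 0")
      case False
      then have "dist a u = r" using fr[OF that] by auto
      moreover have "dist a u \<le> dist a w + dist b w + dist u b"
        using dist_triangle[of a u w] dist_triangle[of w u b] by (simp add: dist_commute)
      ultimately have "dist u b \<ge> 3 * \<epsilon>" using b(1) unfolding \<epsilon>_def by (simp add: field_simps)
      then show ?thesis using \<epsilon> by (auto simp: dist_norm norm_divide intro!: divide_left_mono mult_pos_pos)
    qed auto
    show "f z \<noteq> 0" using z S by auto
  qed (use op hol z \<epsilon> in auto)
  moreover have "dist z b < 2 * \<epsilon>" using z b dist_triangle3[of z b w] by (simp add: dist_commute)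
  moreover have "z \<noteq> b" using z b closure_subset by blast
  ultimately show False using \<epsilon>
    by (auto simp: norm_divide dist_norm field_simps)
qed

section \<open>Harmonic extension from the unit circle by polynomial approximation\<close>

inductive_set trig_ring :: "(complex \<Rightarrow> real) set" where
  mono: "(\<lambda>z. Re (c * z ^ k)) \<in> trig_ring"
| add: "u \<in> trig_ring \<Longrightarrow> v \<in> trig_ring \<Longrightarrow> (\<lambda>z. u z + v z) \<in> trig_ring"

text \<open>An approximation by \<open>trig_ring\<close> on the circle thus comes with its harmonic
  extension to the disc and with a harmonic conjugate.\<close>

lemma trig_ring_Re: "u \<in> trig_ring \<Longrightarrow> \<exists>P. P holomorphic_on UNIV \<and> (\<forall>z. u z = Re (P z))"
proof (induction rule: trig_ring.induct)
  case (mono c k)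
  then show ?case by (intro exI[of _ "\<lambda>z. c * z ^ k"]) (auto intro!: holomorphic_intros)
next
  case (add u v)
  then obtain P Q where "P holomorphic_on UNIV" "\<forall>z. u z = Re (P z)" "Q holomorphic_on UNIV" "\<forall>z. v z = Re (Q z)"
    by blast
  then show ?case by (intro exI[of _ "\<lambda>z. P z + Q z"]) (auto intro!: holomorphic_intros)
qed

text \<open>On the unit circle the conjugate of \<open>z ^ k\<close> is \<open>z ^ (-k)\<close>, so the real parts of polynomials
  form a ring there.\<close>

lemma trig_ring_mult_mono:
  assumes "k \<le> j"
  shows "\<exists>w\<in>trig_ring. \<forall>z\<in>sphere 0 1. w z = Re (c * z ^ j) * Re (d * z ^ k)"
proof -
  let ?w = "\<lambda>z. Re ((c * d / 2) * z ^ (j + k)) + Re ((c * cnj d / 2) * z ^ (j - k))"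
  have *: "?w z = Re (c * z ^ j) * Re (d * z ^ k)" if "z \<in> sphere 0 1" for z
  proof -
    have "z * cnj z = 1" using that by (simp add: complex_norm_square[symmetric])
    then have zz: "z ^ k * cnj (z ^ k) = 1" by (metis power_mult_distrib power_one complex_cnj_power)
    have j: "z ^ j = z ^ (j - k) * z ^ k" using assms by (metis power_add le_add_diff_inverse2)
    have "(c * cnj d / 2) * z ^ (j - k) = (c * z ^ j) * cnj (d * z ^ k) / 2"
      using zz unfolding j by (simp add: field_simps)
    moreover have "(c * d / 2) * z ^ (j + k) = (c * z ^ j) * (d * z ^ k) / 2"
      by (simp add: power_add)
    moreover have "Re (A * B / 2) + Re (A * cnj B / 2) = Re A * Re B" for A B by (simp add: field_simps)
    ultimately show ?thesis by (simp only:)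
  qed
  show ?thesis
    by (rule bexI[of _ ?w], rule ballI, erule *) (intro trig_ring.intros)
qed

lemma trig_ring_mult:
  assumes "u \<in> trig_ring" "v \<in> trig_ring"
  shows "\<exists>w\<in>trig_ring. \<forall>z\<in>sphere 0 1. w z = u z * v z"
  using assms
proof (induction rule: trig_ring.induct)
  case (mono c j)
  show ?case using mono
  proof (induction rule: trig_ring.induct)
    case (mono d k)
    show ?case
      using trig_ring_mult_mono[of k j c d] trig_ring_mult_mono[of j k d c]
      by (cases "k \<le> j") (auto simp: mult.commute)
  next
    case (add u v)
    then obtain w1 w2 where "w1 \<in> trig_ring" "w2 \<in> trig_ring"
      "\<forall>z\<in>sphere 0 1. w1 z = Re (c * z ^ j) * u z" "\<forall>z\<in>sphere 0 1. w2 z = Re (c * z ^ j) * v z" by blast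
    then have "\<forall>z\<in>sphere 0 1. w1 z + w2 z = Re (c * z ^ j) * (u z + v z)" unfolding distrib_left by metis
    then show ?case using trig_ring.add[OF \<open>w1 \<in> trig_ring\<close> \<open>w2 \<in> trig_ring\<close>] by (rule bexI)
  qed
next
  case (add u1 u2)
  then obtain w1 w2 where "w1 \<in> trig_ring" "w2 \<in> trig_ring"
    "\<forall>z\<in>sphere 0 1. w1 z = u1 z * v z" "\<forall>z\<in>sphere 0 1. w2 z = u2 z * v z" by blast
  then show ?case
    by (intro bexI[of _ "\<lambda>z. w1 z + w2 z"] trig_ring.add) (auto simp: algebra_simps)
qed

lemma trig_approximation:
  fixes u :: "complex \<Rightarrow> real"
  assumes u: "continuous_on (sphere 0 1) u" and e: "e > 0"
  shows "\<exists>P. P holomorphic_on UNIV \<and> (\<forall>z\<in>sphere 0 1. \<bar>u z - Re (P z)\<bar> < e)"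
proof -
  \<comment> \<open>\<open>trig_ring\<close> is closed under products only after restriction to the
    circle, so Stone-Weierstrass is applied to all functions that agree there with a member.\<close>
  define R where "R = {v. \<exists>w\<in>trig_ring. \<forall>z\<in>sphere 0 1. v z = w z}"
  have mono: "(\<lambda>z. Re (c * z ^ k)) \<in> R" for c k
    unfolding R_def by (intro CollectI bexI[of _ "\<lambda>z. Re (c * z ^ k)"] ballI refl trig_ring.mono)
  interpret function_ring_on R "sphere (0::complex) 1"
  proof
    show "compact (sphere (0::complex) 1)" by simp
    show "continuous_on (sphere 0 1) f" if fR: "f \<in> R" for f
    proof -
      obtain w where w: "w \<in> trig_ring" "\<forall>z\<in>sphere 0 1. f z = w z" using fR unfolding R_def by blast
      then obtain P where "P holomorphic_on UNIV" "\<forall>z. w z = Re (P z)" using trig_ring_Re by blast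
      then have "continuous_on (sphere 0 1) (\<lambda>z. Re (P z))"
        by (intro continuous_intros holomorphic_on_imp_continuous_on) (auto intro: holomorphic_on_subset)
      then show ?thesis using w \<open>\<forall>z. w z = Re (P z)\<close> by (metis (mono_tags, lifting) continuous_on_cong)
    qed
    show "(\<lambda>x. f x + g x) \<in> R" if fg: "f \<in> R" "g \<in> R" for f g
    proof -
      obtain w1 w2 where "w1 \<in> trig_ring" "w2 \<in> trig_ring"
        "\<forall>z\<in>sphere 0 1. f z = w1 z" "\<forall>z\<in>sphere 0 1. g z = w2 z" using fg unfolding R_def by blast
      then show ?thesis unfolding R_def
        by (auto intro!: bexI[of _ "\<lambda>z. w1 z + w2 z"] trig_ring.add)
    qed
    show "(\<lambda>x. f x * g x) \<in> R" if fg: "f \<in> R" "g \<in> R" for f g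
    proof -
      obtain w1 w2 where w: "w1 \<in> trig_ring" "w2 \<in> trig_ring"
        "\<forall>z\<in>sphere 0 1. f z = w1 z" "\<forall>z\<in>sphere 0 1. g z = w2 z" using fg unfolding R_def by blast
      then show ?thesis unfolding R_def mem_Collect_eq using trig_ring_mult[OF w(1,2)] by metis
    qed
    show "(\<lambda>_. c) \<in> R" for c using mono[of "of_real c" 0] by simp
    show "\<exists>f\<in>R. f x \<noteq> f y" if "x \<noteq> y" for x y
    proof (cases "Re x = Re y")
      case True
      then have "Im x \<noteq> Im y" using that complex_eqI by blast
      then show ?thesis using mono[of "-\<i>" 1] by (intro bexI[of _ "\<lambda>z. Re (-\<i> * z ^ 1)"]) auto
    next
      case False
      then show ?thesis using mono[of 1 1] by (intro bexI[of _ "\<lambda>z. Re (1 * z ^ 1)"]) auto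
    qed
  qed
  obtain g where "g \<in> R" "\<forall>x\<in>sphere 0 1. \<bar>u x - g x\<bar> < e"
    using Stone_Weierstrass_basic[OF u e] by blast
  then show ?thesis unfolding R_def using trig_ring_Re by fastforce
qed

text \<open>The map \<open>w / (2 * e' - w)\<close> takes the half-plane \<open>Re w < e'\<close>
  into the unit disc and fixes \<open>0\<close>, so the Schwarz lemma applies to its composition
  with \<open>g\<close>. The half-plane needs a strict inequality, hence \<open>e' > e\<close>; the
  bound for \<open>e\<close> follows by letting \<open>e'\<close> decrease to
  \<open>e\<close>.\<close>

lemma Borel_Caratheodory:
  fixes g :: "complex \<Rightarrow> complex"
  assumes hol: "g holomorphic_on ball 0 1" and g0: "g 0 = 0"
    and re: "\<And>z. norm z < 1 \<Longrightarrow> Re (g z) \<le> e" and e: "e > 0" and z: "norm z < 1"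
  shows "norm (g z) \<le> 2 * e * norm z / (1 - norm z)"
proof -
  have le: "norm (g w) < norm (2 * e' - g w)" if "norm w < 1" "e' > e" for w and e' :: real
  proof -
    have "Re (g w) < e'" using re[OF that(1)] that by simp
    moreover have "e' * Re (g w) < e' * e'" using calculation that e by simp
    ultimately have "(norm (g w))\<^sup>2 < (norm (2 * e' - g w))\<^sup>2"
      unfolding cmod_power2 using e by (simp add: power2_eq_square algebra_simps)
    then show ?thesis by (rule power_less_imp_less_base) simp
  qed
  have "norm (g z) * (1 - norm z) \<le> 2 * e' * norm z" if e': "e' > e" for e' :: real
  proof -
    let ?f = "\<lambda>w. g w / (2 * e' - g w)"
    have nz: "2 * e' - g w \<noteq> 0" if "norm w < 1" for w using le[OF that e'] by auto
    have "norm (?f z) \<le> norm z"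
    proof (rule Schwarz_Lemma(1))
      show "?f holomorphic_on ball 0 1" using hol nz by (intro holomorphic_intros) auto
      show "norm (?f w) < 1" if "norm w < 1" for w
        using le[OF that e'] by (simp add: norm_divide divide_less_eq_1 del: norm_mult norm_of_real)
    qed (use g0 z in auto)
    then have "norm (g z) \<le> norm z * norm (2 * e' - g z)"
      using nz[OF z] by (simp add: norm_divide field_simps)
    also have "\<dots> \<le> norm z * (2 * e' + norm (g z))"
      using norm_triangle_ineq4[of "2 * complex_of_real e'" "g z"] e' e by (intro mult_left_mono) (auto simp: norm_mult)
    finally show ?thesis by (simp add: algebra_simps)
  qed
  then have "((\<lambda>e'. norm (g z) * (1 - norm z)) \<longlongrightarrow> norm (g z) * (1 - norm z)) (at_right e)" 
    and ev: "eventually (\<lambda>e'. norm (g z) * (1 - norm z) \<le> 2 * e' * norm z) (at_right e)"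
    by (auto simp: eventually_at_right_field intro: exI[of _ "e+1"])
  moreover have "((\<lambda>e'. 2 * e' * norm z) \<longlongrightarrow> 2 * e * norm z) (at_right e)"
    by (intro tendsto_intros)
  ultimately have "norm (g z) * (1 - norm z) \<le> 2 * e * norm z"
    by (intro tendsto_le[of "at_right e"]) auto
  then show ?thesis using z by (simp add: field_simps)
qed

text \<open>\<open>exp\<close> turns the real part into a modulus, to which the maximum principle
  off the zeros applies. As \<open>S\<close> is dense, continuity carries the bound from
  \<open>S\<close> to the closed disc.\<close>

lemma Re_bound_off_zeros:
  fixes f h :: "complex \<Rightarrow> complex"
  assumes f: "continuous_on (cball a r) f" "f holomorphic_on S"
    and S: "S = {z \<in> ball a r. f z \<noteq> 0}" "S \<noteq> {}"
    and h: "continuous_on (cball a r) h" "h holomorphic_on S"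
    and bd: "\<And>z. z \<in> sphere a r \<Longrightarrow> Re (h z) \<le> e" and z: "z \<in> cball a r"
  shows "Re (h z) \<le> e"
proof -
  have r: "r > 0" using S by (auto intro: le_less_trans[OF zero_le_dist])
  have op: "open S" using open_nonzero_set[of a r f] f S by simp
  have clS: "closure S \<subseteq> cball a r"
    by (rule closure_minimal) (use S in auto)
  have "norm (exp (h w)) \<le> exp e" if "w \<in> S" for w
  proof (rule max_modulus_off_zeros[of S f "\<lambda>w. exp (h w)"])
    show "bounded S" by (rule bounded_subset[OF bounded_ball, of _ a r]) (use S in auto)
    show "continuous_on (closure S) f" using f clS continuous_on_subset by blast
    show "continuous_on (closure S) (\<lambda>w. exp (h w))"
      using h clS continuous_on_subset by (blast intro: continuous_intros)
    show "(\<lambda>w. exp (h w)) holomorphic_on S" using h by (intro holomorphic_intros)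
    show "f w \<noteq> 0" using that S by auto
    show "f u = 0 \<or> norm (exp (h u)) \<le> exp e" if "u \<in> frontier S" for u
    proof -
      have "u \<notin> S" "u \<in> cball a r" using that op clS by (auto simp: frontier_def interior_open)
      then have "u \<in> sphere a r \<or> f u = 0" using S by auto
      then show ?thesis using bd by auto
    qed
  qed (use op f that in auto)
  then have *: "Re (h w) \<le> e" if "w \<in> S" for w using that by simp
  have "cball a r = closure (ball a r)" using r by simp
  also have "\<dots> \<subseteq> closure S" using dense_nonzero_set[OF f(1) S(1) f(2) S(2)] closure_minimal by blast
  finally have eq: "closure S = cball a r" using clS by blast
  show ?thesis
    by (rule continuous_le_on_closure[of S "\<lambda>w. Re (h w)"]) (use z h * in \<open>auto simp: eq intro!: continuous_intros\<close>)
qed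

text \<open>This takes the place of the Poisson integral. Entire functions \<open>P n\<close>
  approximate \<open>Re h\<close> in real part on the circle. Since \<open>h - P n\<close> is
  holomorphic on \<open>S\<close>, the maximum principle off the zeros keeps the approximation
  uniform on the whole disc, zeros of \<open>f\<close> included, and the Borel-Caratheodory
  inequality upgrades convergence of the real parts to convergence of the functions.\<close>

lemma harmonic_conjugate_off_zeros:
  fixes f h :: "complex \<Rightarrow> complex"
  assumes f: "continuous_on (cball 0 1) f" "f holomorphic_on S"
    and S: "S = {z \<in> ball 0 1. f z \<noteq> 0}" "S \<noteq> {}"
    and h: "continuous_on (cball 0 1) h" "h holomorphic_on S"
  shows "\<exists>H. H holomorphic_on ball 0 1 \<and> (\<forall>z\<in>ball 0 1. Re (H z) = Re (h z) - Re (h 0))"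
proof -
  have "\<exists>P. P holomorphic_on UNIV \<and> (\<forall>z\<in>sphere 0 1. \<bar>Re (h z) - Re (P z)\<bar> < inverse (Suc n))" for n
    using h by (intro trig_approximation continuous_intros continuous_on_subset[OF h(1)]) auto
  then obtain P where P: "\<And>n. P n holomorphic_on UNIV"
    "\<And>n z. z \<in> sphere 0 1 \<Longrightarrow> \<bar>Re (h z) - Re (P n z)\<bar> < inverse (Suc n)" by metis
  have Pc: "continuous_on X (P n)" "P n holomorphic_on X" for X n
    using P(1) holomorphic_on_imp_continuous_on holomorphic_on_subset subset_UNIV by metis+
  have near: "\<bar>Re (h z) - Re (P n z)\<bar> \<le> inverse (Suc n)" if z: "z \<in> cball 0 1" for z n
  proof -
    have "Re (h z - P n z) \<le> inverse (Suc n)"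
      by (rule Re_bound_off_zeros[OF f S _ _ _ z]) (use h Pc P(2)[of _ n] in \<open>force intro!: continuous_intros holomorphic_intros\<close>)+
    moreover have "Re (P n z - h z) \<le> inverse (Suc n)"
      by (rule Re_bound_off_zeros[OF f S _ _ _ z]) (use h Pc P(2)[of _ n] in \<open>force intro!: continuous_intros holomorphic_intros\<close>)+
    ultimately show ?thesis by (simp add: abs_le_iff)
  qed
  \<comment> \<open>Convergence of real parts leaves imaginary constants undetermined; subtracting
    the value at \<open>0\<close> fixes them.\<close>
  define G where "G n z = P n z - P n 0" for n z
  have G: "G n holomorphic_on X" for n X unfolding G_def by (intro holomorphic_intros Pc)
  have ReG: "\<bar>Re (G n z) - (Re (h z) - Re (h 0))\<bar> \<le> 2 * inverse (Suc n)" if z: "z \<in> cball 0 1" for z n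
    using near[OF z, of n] near[of 0 n] by (simp add: G_def)
  have conv: "uniformly_convergent_on (cball 0 s) G" if s: "0 < s" "s < 1" for s :: real
  proof (rule Cauchy_uniformly_convergent, unfold uniformly_Cauchy_on_def, intro allI impI)
    fix e :: real assume e: "e > 0"
    \<comment> \<open>A bound \<open>d\<close> on the real part becomes
      \<open>2 * d / (1 - s) = e / 2\<close> on \<open>cball 0 s\<close>. The two approximation
      errors, each below \<open>d / 2\<close>, add up to at most \<open>d\<close>.\<close>
    define d where "d = e * (1 - s) / 4"
    have d: "d > 0" using e s by (simp add: d_def)
    obtain N where N: "inverse (Suc N) < d / 4" using reals_Archimedean[of "d/4"] d by auto
    show "\<exists>M. \<forall>x\<in>cball 0 s. \<forall>m\<ge>M. \<forall>n\<ge>M. dist (G m x) (G n x) < e"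
    proof (intro exI[of _ N] ballI allI impI)
      fix x m n assume x: "x \<in> cball (0::complex) s" and mn: "N \<le> m" "N \<le> n"
      have x1: "norm x < 1" using x s by simp
      have inv: "inverse (Suc m) < d / 4" "inverse (Suc n) < d / 4"
        using N mn by (smt (verit) le_imp_inverse_le of_nat_0_less_iff of_nat_mono Suc_le_mono zero_less_Suc)+
      have "norm (G m x - G n x) \<le> 2 * d * norm x / (1 - norm x)"
      proof (rule Borel_Caratheodory[OF _ _ _ d x1])
        show "(\<lambda>x. G m x - G n x) holomorphic_on ball 0 1" by (intro holomorphic_intros G)
        show "G m 0 - G n 0 = 0" by (simp add: G_def)
        fix z :: complex assume "norm z < 1"
        then show "Re (G m z - G n z) \<le> d" using ReG[of z m] ReG[of z n] inv by simp
      qed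
      also have "\<dots> \<le> 2 * d * 1 / (1 - s)"
        using x s d by (intro frac_le mult_left_mono) auto
      also have "\<dots> = e / 2" using s by (simp add: d_def field_simps)
      finally show "dist (G m x) (G n x) < e" using e by (simp add: dist_norm)
    qed
  qed
  define H where "H z = lim (\<lambda>n. G n z)" for z
  have lim: "uniform_limit (cball 0 s) G H sequentially" if "0 < s" "s < 1" for s :: real
    using conv[OF that] unfolding H_def[abs_def] by (simp add: uniformly_convergent_uniform_limit_iff)
  have "H holomorphic_on ball 0 1"
  proof (rule holomorphic_uniform_sequence[of _ G])
    fix x :: complex assume x: "x \<in> ball 0 1"
    define d where "d = (1 - norm x) / 2"
    have "d > 0" using x by (simp add: d_def)
    moreover have "cball x d \<subseteq> ball 0 1"
      using x by (auto simp: d_def dist_norm) (smt (verit) field_sum_of_halves norm_triangle_sub norm_minus_commute)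
    moreover have "cball x d \<subseteq> cball 0 (norm x + d)"
      by (auto simp: dist_norm) (smt (verit) norm_triangle_sub norm_minus_commute)
    moreover have "norm x + d < 1" "0 < norm x + d"
      using x \<open>d > 0\<close> norm_ge_zero[of x] unfolding d_def by (auto simp: field_simps simp del: norm_ge_zero)
    ultimately show "\<exists>d>0. cball x d \<subseteq> ball 0 1 \<and> uniform_limit (cball x d) G H sequentially"
      using uniform_limit_on_subset[OF lim] by blast
  qed (use G in auto)
  moreover have "Re (H z) = Re (h z) - Re (h 0)" if z: "z \<in> ball 0 1" for z
  proof -
    have "norm z < (norm z + 1) / 2" "(norm z + 1) / 2 < 1" using z by auto
    then have "(\<lambda>n. G n z) \<longlonglongrightarrow> H z"
      by (intro tendsto_uniform_limitI[OF lim[of "(norm z + 1) / 2"]]) (auto intro: add_nonneg_pos)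
    then have "(\<lambda>n. Re (G n z)) \<longlonglongrightarrow> Re (H z)" by (intro tendsto_intros)
    moreover have "(\<lambda>n. Re (G n z)) \<longlonglongrightarrow> Re (h z) - Re (h 0)"
    proof (rule LIM_zero_cancel, rule Lim_null_comparison)
      show "\<forall>\<^sub>F n in sequentially. norm (Re (G n z) - (Re (h z) - Re (h 0))) \<le> 2 * inverse (Suc n)"
        using ReG z by (intro always_eventually) auto
      show "(\<lambda>n. 2 * inverse (Suc n)) \<longlonglongrightarrow> (0::real)"
        using tendsto_mult_right_zero[OF LIMSEQ_inverse_real_of_nat, of 2] by (simp add: mult.commute)
    qed
    ultimately show ?thesis by (rule LIMSEQ_unique)
  qed
  ultimately show ?thesis by blast
qed

text \<open>The differential of the conjugate of \<open>K\<close> is conjugate linear; where it is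
  complex linear as well, it is zero. So \<open>deriv K\<close> vanishes on \<open>T\<close> and, by
  the identity theorem, on the disc.\<close>

lemma holomorphic_cnj_imp_constant:
  assumes K: "K holomorphic_on ball 0 1" and T: "open T" "T \<subseteq> ball 0 1" "T \<noteq> {}"
    and cK: "(\<lambda>z. cnj (K z)) holomorphic_on T"
  shows "K constant_on ball 0 1"
proof -
  have "deriv K z = 0" if z: "z \<in> T" for z
  proof -
    have "(K has_field_derivative deriv K z) (at z)" using K T z holomorphic_derivI by blast
    then have "((\<lambda>z. cnj (K z)) has_derivative (\<lambda>x. cnj (deriv K z * x))) (at z)"
      unfolding has_field_derivative_def by (rule bounded_linear.has_derivative[OF bounded_linear_cnj])
    moreover have "((\<lambda>z. cnj (K z)) has_derivative (\<lambda>x. deriv (\<lambda>z. cnj (K z)) z * x)) (at z)"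
      using holomorphic_derivI[OF cK T(1) z] unfolding has_field_derivative_def .
    ultimately have "(\<lambda>x. cnj (deriv K z * x)) = (\<lambda>x. deriv (\<lambda>z. cnj (K z)) z * x)"
      by (rule has_derivative_unique)
    from fun_cong[OF this, of 1] fun_cong[OF this, of "\<i>"] show ?thesis
      by (auto simp: complex_eq_iff)
  qed
  moreover have "deriv K holomorphic_on ball 0 1" using K by (rule holomorphic_deriv) simp
  ultimately have "deriv K z = 0" if "z \<in> ball 0 1" for z
    using analytic_continuation_open[of T "ball 0 1" "deriv K" "\<lambda>_. 0"] T that by auto
  then have "(K has_field_derivative 0) (at z within ball 0 1)" if "z \<in> ball 0 1" for z
    using holomorphic_derivI[OF K open_ball that] has_field_derivative_at_within that by metis
  then show ?thesis
    using has_field_derivative_zero_constant[of "ball 0 1" K] by (auto simp: constant_on_def)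
qed

text \<open>With \<open>Re H1\<close> and \<open>Re H2\<close> equal to the real and imaginary part
  of \<open>h - h 0\<close>, the function \<open>2 * (h - h 0)\<close> splits into the holomorphic
  \<open>H1 + \<i> * H2\<close> and the conjugate of the holomorphic \<open>K\<close>. On
  \<open>S\<close> this conjugate is holomorphic too, so \<open>K\<close> is constant.\<close>

lemma Rado_unit:
  fixes f h :: "complex \<Rightarrow> complex"
  assumes f: "continuous_on (cball 0 1) f" "f holomorphic_on S"
    and S: "S = {z \<in> ball 0 1. f z \<noteq> 0}" "S \<noteq> {}"
    and h: "continuous_on (cball 0 1) h" "h holomorphic_on S"
  shows "h holomorphic_on ball 0 1"
proof -
  obtain H1 where H1: "H1 holomorphic_on ball 0 1" "\<And>z. z \<in> ball 0 1 \<Longrightarrow> Re (H1 z) = Re (h z) - Re (h 0)"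
    using harmonic_conjugate_off_zeros[OF f S h] by blast
  have "continuous_on (cball 0 1) (\<lambda>z. - \<i> * h z)" "(\<lambda>z. - \<i> * h z) holomorphic_on S"
    using h by (auto intro!: continuous_intros holomorphic_intros)
  from harmonic_conjugate_off_zeros[OF f S this]
  obtain H2 where H2: "H2 holomorphic_on ball 0 1" "\<And>z. z \<in> ball 0 1 \<Longrightarrow> Re (H2 z) = Im (h z) - Im (h 0)"
    by auto
  define K where "K z = H1 z - \<i> * H2 z" for z
  have K: "K holomorphic_on ball 0 1" unfolding K_def using H1 H2 by (intro holomorphic_intros)
  have h_eq: "2 * (h z - h 0) = (H1 z + \<i> * H2 z) + cnj (K z)" if "z \<in> ball 0 1" for z
    using H1(2)[OF that] H2(2)[OF that] by (simp add: K_def complex_eq_iff)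
  have SS: "S \<subseteq> ball 0 1" using S by auto
  have op: "open S" using open_nonzero_set[of 0 1 f] f S by simp
  have "(\<lambda>z. 2 * (h z - h 0) - (H1 z + \<i> * H2 z)) holomorphic_on S"
    using h H1 H2 SS by (auto intro!: holomorphic_intros intro: holomorphic_on_subset)
  moreover have "2 * (h z - h 0) - (H1 z + \<i> * H2 z) = cnj (K z)" if "z \<in> S" for z
    using h_eq[of z] that SS by (metis add_diff_cancel_left' subsetD)
  ultimately have "(\<lambda>z. cnj (K z)) holomorphic_on S" by (rule holomorphic_transform)
  then obtain C where C: "\<And>z. z \<in> ball 0 1 \<Longrightarrow> K z = C"
    using holomorphic_cnj_imp_constant[OF K op SS S(2)] unfolding constant_on_def by blast
  have "(\<lambda>z. h 0 + ((H1 z + \<i> * H2 z) + cnj C) / 2) holomorphic_on ball 0 1"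
    using H1 H2 by (auto intro!: holomorphic_intros)
  moreover have "h z = h 0 + ((H1 z + \<i> * H2 z) + cnj C) / 2" if "z \<in> ball 0 1" for z
    using h_eq[OF that] C[OF that] by (simp add: field_simps)
  ultimately show ?thesis using holomorphic_transform by (metis (no_types, lifting))
qed

text \<open>The classical theorem is the case \<open>h = f\<close>. The second function makes the
  zero set of \<open>f\<close> removable for continuous functions, with no knowledge of its size
  beyond \<open>ne\<close>.\<close>

theorem Rado:
  fixes f h :: "complex \<Rightarrow> complex"
  assumes f: "continuous_on (cball a r) f" "\<And>z. z \<in> ball a r \<Longrightarrow> f z \<noteq> 0 \<Longrightarrow> f field_differentiable at z"
    and h: "continuous_on (cball a r) h" "\<And>z. z \<in> ball a r \<Longrightarrow> f z \<noteq> 0 \<Longrightarrow> h field_differentiable at z"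
    and ne: "\<exists>z\<in>ball a r. f z \<noteq> 0"
  shows "h holomorphic_on ball a r"
proof -
  have r: "r > 0" using ne by (auto intro: le_less_trans[OF zero_le_dist])
  define \<tau> where "\<tau> z = a + of_real r * z" for z
  define \<sigma> where "\<sigma> z = (z - a) / of_real r" for z
  have \<tau>: "\<tau> z \<in> ball a r \<longleftrightarrow> z \<in> ball 0 1" "\<tau> z \<in> cball a r \<longleftrightarrow> z \<in> cball 0 1" for z
    using r by (auto simp: \<tau>_def dist_norm norm_mult)
  have \<tau>\<sigma>: "\<tau> (\<sigma> z) = z" for z using r by (simp add: \<tau>_def \<sigma>_def)
  have cont: "continuous_on (cball 0 1) (\<lambda>z. g (\<tau> z))" if "continuous_on (cball a r) g" for g :: "complex \<Rightarrow> complex"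
    by (rule continuous_on_compose2[OF that]) (use \<tau> in \<open>auto simp: \<tau>_def intro!: continuous_intros\<close>)
  have hol: "(\<lambda>z. g (\<tau> z)) holomorphic_on {z \<in> ball 0 1. f (\<tau> z) \<noteq> 0}"
    if "\<And>z. z \<in> ball a r \<Longrightarrow> f z \<noteq> 0 \<Longrightarrow> g field_differentiable at z" for g
  proof -
    have "(\<lambda>z. g (\<tau> z)) field_differentiable at z" if z: "z \<in> ball 0 1" "f (\<tau> z) \<noteq> 0" for z
    proof -
      have "\<tau> field_differentiable at z" unfolding \<tau>_def[abs_def] by (intro derivative_intros)
      moreover have "g field_differentiable at (\<tau> z)" using that \<open>\<And>z. _ \<Longrightarrow> _ \<Longrightarrow> g field_differentiable at z\<close> \<tau> by blast
      ultimately show ?thesis using field_differentiable_compose[of \<tau> z g] by (simp add: o_def)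
    qed
    then show ?thesis unfolding holomorphic_on_def using field_differentiable_at_within by blast
  qed
  have "(\<lambda>z. h (\<tau> z)) holomorphic_on ball 0 1"
  proof (rule Rado_unit[OF cont[OF f(1)] hol[OF f(2)] refl _ cont[OF h(1)] hol[OF h(2)]])
    obtain z where "z \<in> ball a r" "f z \<noteq> 0" using ne by blast
    then have "\<sigma> z \<in> {z \<in> ball 0 1. f (\<tau> z) \<noteq> 0}" using \<tau>[of "\<sigma> z"] \<tau>\<sigma> by simp
    then show "{z \<in> ball 0 1. f (\<tau> z) \<noteq> 0} \<noteq> {}" by blast
  qed
  moreover have "\<sigma> holomorphic_on ball a r" unfolding \<sigma>_def[abs_def] using r by (intro holomorphic_intros) auto
  moreover have "\<sigma> ` ball a r \<subseteq> ball 0 1" using \<tau> \<tau>\<sigma> by (metis image_subsetI)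
  ultimately have "((\<lambda>z. h (\<tau> z)) \<circ> \<sigma>) holomorphic_on ball a r"
    using holomorphic_on_compose_gen by blast
  then show ?thesis by (simp add: o_def \<tau>\<sigma>)
qed

section \<open>Functions of several complex variables\<close>

definition polydisc :: "nat \<Rightarrow> (nat \<Rightarrow> complex) \<Rightarrow> real \<Rightarrow> (nat \<Rightarrow> complex) set" where
  "polydisc n z r = {w \<in> Cspace n. \<forall>i<n. dist (w i) (z i) < r}"

abbreviation Cn_open :: "nat \<Rightarrow> (nat \<Rightarrow> complex) set \<Rightarrow> bool" where
  "Cn_open n \<equiv> openin (top_of_set (Cspace n))"

lemma Cspace_upd: "z \<in> Cspace n \<Longrightarrow> i < n \<Longrightarrow> z(i := t) \<in> Cspace n"
  by (auto simp: Cspace_def)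

lemma polydisc_upd:
  "w \<in> polydisc n z r \<Longrightarrow> i < n \<Longrightarrow> dist t (z i) < r \<Longrightarrow> w(i := t) \<in> polydisc n z r"
  by (auto simp: polydisc_def Cspace_upd)

lemma polydisc_center: "z \<in> Cspace n \<Longrightarrow> 0 < r \<Longrightarrow> z \<in> polydisc n z r"
  by (auto simp: polydisc_def)

lemma polydisc_mono: "r \<le> s \<Longrightarrow> polydisc n z r \<subseteq> polydisc n z s"
  by (force simp: polydisc_def)

lemma open_coordinate_box: "open {w :: nat \<Rightarrow> complex. \<forall>i<n. dist (w i) (z i) < r}"
proof -
  have "open {f :: nat \<Rightarrow> complex. \<forall>i\<in>{..<n}. f (id i) \<in> ball (z i) r}"
    by (rule product_topology_basis') auto
  moreover have "{f :: nat \<Rightarrow> complex. \<forall>i\<in>{..<n}. f (id i) \<in> ball (z i) r} = {w. \<forall>i<n. dist (w i) (z i) < r}"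
    by (auto simp: dist_commute)
  ultimately show ?thesis by simp
qed

lemma Cn_open_polydisc: "Cn_open n (polydisc n z r)"
proof -
  have "polydisc n z r = Cspace n \<inter> {w. \<forall>i<n. dist (w i) (z i) < r}" by (auto simp: polydisc_def)
  then show ?thesis using open_coordinate_box openin_open by blast
qed

lemma Cn_open_subset: "Cn_open n P \<Longrightarrow> z \<in> P \<Longrightarrow> z \<in> Cspace n"
  using openin_imp_subset by blast

text \<open>A basic open set of the product topology constrains each coordinate separately. From
  index \<open>n\<close> on, all coordinates in \<open>Cspace n\<close> are zero, so the first
  \<open>n\<close> radii are the ones to respect.\<close>

lemma polydisc_base:
  assumes "Cn_open n P" "z \<in> P"
  obtains r where "r > 0" "polydisc n z r \<subseteq> P"
proof -
  obtain U where U: "open U" "P = Cspace n \<inter> U" using assms(1) by (auto simp: openin_open)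
  have zC: "z \<in> Cspace n" using assms Cn_open_subset by blast
  have "openin (product_topology (\<lambda>i::nat. euclidean :: complex topology) UNIV) U"
    using U(1) by (simp add: euclidean_product_topology)
  then obtain X where X: "z \<in> Pi\<^sub>E UNIV X" "\<And>i. open (X i)" "Pi\<^sub>E UNIV X \<subseteq> U"
    using product_topology_open_contains_basis[of "\<lambda>i::nat. euclidean :: complex topology" UNIV U z] assms(2) U(2)
    unfolding open_openin[symmetric] by blast
  have "\<exists>r>0. ball (z i) r \<subseteq> X i" for i
    using X(1,2) by (auto simp: PiE_iff intro: openE)
  then obtain \<rho> where \<rho>: "\<And>i. \<rho> i > 0" "\<And>i. ball (z i) (\<rho> i) \<subseteq> X i" by metis
  \<comment> \<open>\<open>insert 1\<close> gives the minimum a meaning when \<open>n = 0\<close>;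
    the same device recurs below with other default values.\<close>
  define r where "r = Min (insert 1 (\<rho> ` {..<n}))"
  have r: "r > 0" unfolding r_def using \<rho>(1) by (subst Min_gr_iff) auto
  have rle: "r \<le> \<rho> i" if "i < n" for i unfolding r_def using that by (intro Min_le) auto
  have "polydisc n z r \<subseteq> P"
  proof
    fix w assume w: "w \<in> polydisc n z r"
    have "w i \<in> X i" for i
    proof (cases "i < n")
      case True
      then have "dist (w i) (z i) < \<rho> i" using w rle[OF True] by (force simp: polydisc_def)
      then show ?thesis using \<rho>(2)[of i] by (auto simp: dist_commute)
    next
      case False
      then have "w i = z i" using w zC by (auto simp: polydisc_def Cspace_def)
      then show ?thesis using X(1) by (auto simp: PiE_iff)
    qed
    then show "w \<in> P" using X(3) U(2) w by (auto simp: polydisc_def PiE_iff)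
  qed
  then show ?thesis using that r by blast
qed

lemma continuous_on_polydiscD:
  fixes f :: "(nat \<Rightarrow> complex) \<Rightarrow> 'b::metric_space"
  assumes P: "Cn_open n P" and f: "continuous_on P f" and z: "z \<in> P" and e: "e > 0"
  obtains d where "d > 0" "polydisc n z d \<subseteq> P" "\<And>w. w \<in> polydisc n z d \<Longrightarrow> dist (f w) (f z) < e"
proof -
  have "openin (top_of_set P) (P \<inter> f -` ball (f z) e)"
    using f continuous_openin_preimage_gen open_ball by blast
  then have "Cn_open n (P \<inter> f -` ball (f z) e)" using P openin_trans by blast
  moreover have "z \<in> P \<inter> f -` ball (f z) e" using z e by simp
  ultimately obtain d where "d > 0" "polydisc n z d \<subseteq> P \<inter> f -` ball (f z) e" by (rule polydisc_base)
  then show ?thesis using that[of d] by (force simp: dist_commute)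
qed

lemma continuous_on_polydiscI:
  fixes f :: "(nat \<Rightarrow> complex) \<Rightarrow> 'b::metric_space"
  assumes P: "P \<subseteq> Cspace n"
    and *: "\<And>z e. z \<in> P \<Longrightarrow> e > 0 \<Longrightarrow> \<exists>d>0. \<forall>w\<in>polydisc n z d \<inter> P. dist (f w) (f z) < e"
  shows "continuous_on P f"
  unfolding continuous_on_topological
proof (intro ballI allI impI)
  fix z B assume z: "z \<in> P" and B: "open B" "f z \<in> B"
  obtain e where e: "e > 0" "ball (f z) e \<subseteq> B" using B openE by blast
  obtain d where d: "d > 0" "\<forall>w\<in>polydisc n z d \<inter> P. dist (f w) (f z) < e" using *[OF z e(1)] by blast
  show "\<exists>A. open A \<and> z \<in> A \<and> (\<forall>y\<in>P. y \<in> A \<longrightarrow> f y \<in> B)"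
  proof (intro exI[of _ "{w. \<forall>i<n. dist (w i) (z i) < d}"] conjI open_coordinate_box ballI impI)
    show "z \<in> {w. \<forall>i<n. dist (w i) (z i) < d}" using d by simp
    fix y assume y: "y \<in> P" "y \<in> {w. \<forall>i<n. dist (w i) (z i) < d}"
    then have "y \<in> polydisc n z d" using P by (auto simp: polydisc_def)
    then show "f y \<in> B" using d(2) y(1) e(2) by (force simp: dist_commute)
  qed
qed

text \<open>By Osgood's lemma this is the same as \<open>holomorphic_Cn\<close> on open subsets of \<open>Cspace n\<close>.\<close>

definition holo :: "nat \<Rightarrow> ((nat \<Rightarrow> complex) \<Rightarrow> complex) \<Rightarrow> (nat \<Rightarrow> complex) set \<Rightarrow> bool" where
  "holo n f P \<longleftrightarrow> continuous_on P f \<and>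
     (\<forall>z\<in>P. \<forall>i<n. (\<lambda>t. f (z(i := t))) field_differentiable at (z i))"

definition pd :: "nat \<Rightarrow> ((nat \<Rightarrow> complex) \<Rightarrow> complex) \<Rightarrow> (nat \<Rightarrow> complex) \<Rightarrow> complex" where
  "pd i f z = deriv (\<lambda>t. f (z(i := t))) (z i)"

section \<open>Closure properties of holomorphic functions\<close>

lemma holo_continuous: "holo n f P \<Longrightarrow> continuous_on P f"
  by (simp add: holo_def)

lemma holo_subset: "holo n f P \<Longrightarrow> Q \<subseteq> P \<Longrightarrow> holo n f Q"
  unfolding holo_def using continuous_on_subset by blast

lemma holo_const: "holo n (\<lambda>_. c) P"
  by (simp add: holo_def)

lemma holo_add: "holo n f P \<Longrightarrow> holo n g P \<Longrightarrow> holo n (\<lambda>z. f z + g z) P"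
  unfolding holo_def by (auto intro!: continuous_intros derivative_intros)

lemma holo_diff: "holo n f P \<Longrightarrow> holo n g P \<Longrightarrow> holo n (\<lambda>z. f z - g z) P"
  unfolding holo_def by (auto intro!: continuous_intros derivative_intros)

lemma holo_mult: "holo n f P \<Longrightarrow> holo n g P \<Longrightarrow> holo n (\<lambda>z. f z * g z) P"
  unfolding holo_def by (auto intro!: continuous_intros derivative_intros)

lemma holo_divide:
  "holo n f P \<Longrightarrow> holo n g P \<Longrightarrow> (\<And>z. z \<in> P \<Longrightarrow> g z \<noteq> 0) \<Longrightarrow> holo n (\<lambda>z. f z / g z) P"
  unfolding holo_def by (auto intro!: continuous_intros derivative_intros)

lemma holo_sum: "(\<And>k. k \<in> A \<Longrightarrow> holo n (f k) P) \<Longrightarrow> holo n (\<lambda>z. \<Sum>k\<in>A. f k z) P"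
  by (induction A rule: infinite_finite_induct) (auto intro: holo_const holo_add)

lemma holo_coordinate: "holo n (\<lambda>z. z k) P"
  unfolding holo_def
proof (intro conjI ballI allI impI)
  show "continuous_on P (\<lambda>z. z k)"
    by (rule continuous_on_subset[OF continuous_on_product_coordinates]) simp
  show "(\<lambda>t. (z(i := t)) k) field_differentiable at (z i)" for z i
    by (cases "i = k") auto
qed

lemma pd_coordinate: "pd i (\<lambda>z. z k) z = (if i = k then 1 else 0)"
  by (simp add: pd_def)

lemma holo_DERIV:
  assumes "holo n f P" "i < n" "z(i := t) \<in> P"
  shows "((\<lambda>t. f (z(i := t))) has_field_derivative pd i f (z(i := t))) (at t)"
proof -
  have "(\<lambda>s. f ((z(i := t))(i := s))) field_differentiable at ((z(i := t)) i)"
    using assms unfolding holo_def by blast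
  then show ?thesis by (simp add: pd_def field_differentiable_derivI)
qed

lemma holo_slice:
  assumes "holo n f P" "i < n" "\<And>t. t \<in> S \<Longrightarrow> z(i := t) \<in> P"
  shows "(\<lambda>t. f (z(i := t))) holomorphic_on S"
  unfolding holomorphic_on_def
proof
  fix t assume "t \<in> S"
  then show "(\<lambda>t. f (z(i := t))) field_differentiable at t within S"
    using holo_DERIV[OF assms(1,2) assms(3)] field_differentiable_def field_differentiable_at_within by blast
qed

lemma slice_in_polydisc:
  assumes "w \<in> polydisc n z r" "i < n"
  obtains s where "s > 0" "\<And>t. t \<in> cball (w i) s \<Longrightarrow> w(i := t) \<in> polydisc n z r"
proof -
  define s where "s = (r - dist (w i) (z i)) / 2"
  have "s > 0" using assms by (auto simp: polydisc_def s_def)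
  moreover have "w(i := t) \<in> polydisc n z r" if "t \<in> cball (w i) s" for t
  proof (rule polydisc_upd[OF assms])
    have "dist t (z i) \<le> dist (w i) t + dist (w i) (z i)" by (metis dist_commute dist_triangle)
    then show "dist t (z i) < r" using that \<open>s > 0\<close> by (auto simp: s_def field_simps)
  qed
  ultimately show ?thesis using that by blast
qed

lemma slice_in_Cn_open:
  assumes "Cn_open n P" "w \<in> P" "i < n"
  obtains s where "s > 0" "\<And>t. t \<in> cball (w i) s \<Longrightarrow> w(i := t) \<in> P"
proof -
  obtain r where r: "r > 0" "polydisc n w r \<subseteq> P" using assms polydisc_base by blast
  have "w \<in> polydisc n w r" using r assms Cn_open_subset polydisc_center by blast
  then show ?thesis using slice_in_polydisc[of w n w r i] assms r that by (metis subsetD)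
qed

lemma holo_local:
  assumes P: "Cn_open n P"
    and *: "\<And>z. z \<in> P \<Longrightarrow> \<exists>Q. Cn_open n Q \<and> z \<in> Q \<and> holo n f Q"
  shows "holo n f P"
  unfolding holo_def
proof (intro conjI ballI allI impI)
  show "continuous_on P f"
  proof (rule continuous_on_polydiscI)
    show "P \<subseteq> Cspace n" using P openin_imp_subset by blast
    fix z and e :: real assume z: "z \<in> P" and e: "e > 0"
    obtain Q where Q: "Cn_open n Q" "z \<in> Q" "holo n f Q" using *[OF z] by blast
    show "\<exists>d>0. \<forall>w\<in>polydisc n z d \<inter> P. dist (f w) (f z) < e"
      using continuous_on_polydiscD[OF Q(1) holo_continuous[OF Q(3)] Q(2) e] by (metis IntD1)
  qed
  fix z i assume "z \<in> P" "i < n"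
  then show "(\<lambda>t. f (z(i := t))) field_differentiable at (z i)"
    using *[of z] unfolding holo_def by blast
qed

text \<open>Openness of \<open>P\<close> turns equality on \<open>P\<close> into equality on whole
  coordinate discs around each point, which is what a slice derivative sees.\<close>

lemma holo_cong:
  assumes P: "Cn_open n P" and f: "holo n f P" and eq: "\<And>z. z \<in> P \<Longrightarrow> f z = g z"
  shows "holo n g P"
  unfolding holo_def
proof (intro conjI ballI allI impI)
  show "continuous_on P g" using f eq continuous_on_cong unfolding holo_def by (metis (no_types, lifting))
  fix z i assume z: "z \<in> P" and i: "i < n"
  obtain s where s: "s > 0" "\<And>t. t \<in> cball (z i) s \<Longrightarrow> z(i := t) \<in> P"
    using slice_in_Cn_open[OF P z i] by blast
  have "(\<lambda>t. f (z(i := t))) field_differentiable at (z i)" using f z i unfolding holo_def by blast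
  then show "(\<lambda>t. g (z(i := t))) field_differentiable at (z i)"
    by (rule field_differentiable_transform_within[OF s(1), rotated 2]) (use s eq in \<open>auto simp: dist_commute\<close>)
qed

section \<open>Uniform limits, partial derivatives and total differentials\<close>

lemma holo_uniform_limit:
  assumes Q: "Cn_open n Q" and q: "\<And>k. holo n (q k) Q" and lim: "uniform_limit Q q g sequentially"
  shows "holo n g Q"
  unfolding holo_def
proof (intro conjI ballI allI impI)
  show "continuous_on Q g"
    by (rule uniform_limit_theorem[OF _ lim]) (use q holo_continuous in \<open>auto intro!: always_eventually\<close>)
  fix z i assume z: "z \<in> Q" and i: "i < n"
  obtain s where s: "s > 0" "\<And>t. t \<in> cball (z i) s \<Longrightarrow> z(i := t) \<in> Q"
    using slice_in_Cn_open[OF Q z i] by blast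
  have hol: "(\<lambda>t. q k (z(i := t))) holomorphic_on cball (z i) s" for k
    using holo_slice[OF q i] s by blast
  have "uniform_limit (cball (z i) s) (\<lambda>k t. q k (z(i := t))) (\<lambda>t. g (z(i := t))) sequentially"
  proof (rule uniform_limitI)
    fix e :: real assume "e > 0"
    from uniform_limitD[OF lim this]
    show "\<forall>\<^sub>F k in sequentially. \<forall>t\<in>cball (z i) s. dist (q k (z(i := t))) (g (z(i := t))) < e"
      by eventually_elim (use s(2) in blast)
  qed
  moreover have "\<forall>\<^sub>F k in sequentially. continuous_on (cball (z i) s) (\<lambda>t. q k (z(i := t))) \<and>
      (\<lambda>t. q k (z(i := t))) holomorphic_on ball (z i) s"
    using hol ball_subset_cball holomorphic_on_subset holomorphic_on_imp_continuous_on
    by (intro always_eventually allI conjI) blast+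
  ultimately have "(\<lambda>t. g (z(i := t))) holomorphic_on ball (z i) s"
    using holomorphic_uniform_limit[of "z i" s "\<lambda>k t. q k (z(i := t))" sequentially] by auto
  then show "(\<lambda>t. g (z(i := t))) field_differentiable at (z i)"
    using s(1) by (intro holomorphic_on_imp_differentiable_at) auto
qed

text \<open>Cauchy's inequality on circles of radius \<open>r\<close> about the points of
  \<open>ball a r\<close> bounds the second derivative there by \<open>2 * B / r^2\<close>, the
  \<open>2\<close> being \<open>fact 2\<close>. Two applications of the mean value inequality give
  the estimate. Its constant depends on \<open>g\<close> only through \<open>B\<close>, as uniform
  convergence requires.\<close>

lemma diff_quotient_bound:
  assumes g: "g holomorphic_on ball a (3 * r)" and B: "\<And>u. u \<in> ball a (3 * r) \<Longrightarrow> norm (g u) \<le> B"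
    and h: "h \<noteq> 0" "norm h < r"
  shows "norm ((g (a + h) - g a) / h - deriv g a) \<le> 2 * B / r^2 * norm h"
proof -
  have r: "r > 0" using h by (meson norm_ge_zero le_less_trans)
  have sub: "cball u r \<subseteq> ball a (3 * r)" if "u \<in> ball a r" for u
  proof
    fix x assume "x \<in> cball u r"
    then show "x \<in> ball a (3 * r)" using that dist_triangle[of a x u] r by simp
  qed
  have d2: "norm (deriv (deriv g) u) \<le> 2 * B / r^2" if "u \<in> ball a r" for u
  proof -
    have "norm ((deriv ^^ 2) g u) \<le> fact 2 * B / r^2"
    proof (rule Cauchy_inequality)
      show "g holomorphic_on ball u r" using sub[OF that] g ball_subset_cball holomorphic_on_subset by (metis subset_trans)
      show "continuous_on (cball u r) g" using sub[OF that] g holomorphic_on_imp_continuous_on continuous_on_subset by blast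
      show "norm (g x) \<le> B" if "norm (u - x) = r" for x
        using B sub[OF \<open>u \<in> ball a r\<close>] that by (auto simp: dist_norm)
    qed (use r in auto)
    then show ?thesis by (simp add: numeral_2_eq_2)
  qed
  let ?M = "2 * B / r^2"
  have g': "deriv g holomorphic_on ball a (3 * r)" using g by (rule holomorphic_deriv) simp
  have sub1: "ball a r \<subseteq> ball a (3 * r)" using r by auto
  have lip: "norm (deriv g u - deriv g a) \<le> ?M * norm (u - a)" if "u \<in> ball a r" for u
    by (rule field_differentiable_bound[of "ball a r" _ "deriv (deriv g)"])
      (use that r d2 sub1 holomorphic_derivI[OF g' open_ball] in \<open>auto intro: has_field_derivative_at_within\<close>)
  have "norm ((g (a + h) - deriv g a * (a + h)) - (g a - deriv g a * a)) \<le> (?M * norm h) * norm (a + h - a)"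
  proof (rule field_differentiable_bound[of "cball a (norm h)" _ "\<lambda>u. deriv g u - deriv g a"])
    fix u assume u: "u \<in> cball a (norm h)"
    then have ur: "u \<in> ball a r" using h by simp
    show "((\<lambda>u. g u - deriv g a * u) has_field_derivative deriv g u - deriv g a) (at u within cball a (norm h))"
      using holomorphic_derivI[OF g open_ball, of u] ur sub1
      by (auto intro!: derivative_eq_intros intro: has_field_derivative_at_within)
    have "?M \<ge> 0" using d2[of a] r by (smt (verit) centre_in_ball norm_ge_zero)
    then have "?M * norm (u - a) \<le> ?M * norm h" using u by (intro mult_left_mono) (auto simp: dist_norm norm_minus_commute)
    then show "norm (deriv g u - deriv g a) \<le> ?M * norm h" using lip[OF ur] by simp
  qed (use h in \<open>auto simp: dist_norm\<close>)
  then have "norm (g (a + h) - g a - deriv g a * h) \<le> ?M * norm h * norm h" by (simp add: algebra_simps)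
  moreover have "(g (a + h) - g a) / h - deriv g a = (g (a + h) - g a - deriv g a * h) / h"
    using h by (simp add: field_simps)
  ultimately show ?thesis using h by (simp add: norm_divide divide_le_eq)
qed

lemma holo_shift:
  assumes P: "Cn_open n P" and f: "holo n f P" and i: "i < n" and Q: "\<And>z. z \<in> Q \<Longrightarrow> z(i := z i + h) \<in> P"
  shows "holo n (\<lambda>z. f (z(i := z i + h))) Q"
  unfolding holo_def
proof (intro conjI ballI allI impI)
  have "continuous_on Q (\<lambda>z. (z(i := z i + h)) k)" for k
    using holo_continuous[OF holo_coordinate[of n i Q]] holo_continuous[OF holo_coordinate[of n k Q]]
    by (cases "k = i") (auto intro!: continuous_intros)
  then have "continuous_on Q (\<lambda>z. z(i := z i + h))" by (rule continuous_on_coordinatewise_then_product)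
  then show "continuous_on Q (\<lambda>z. f (z(i := z i + h)))"
    by (rule continuous_on_compose2[OF holo_continuous[OF f]]) (use Q in auto)
  fix z j assume z: "z \<in> Q" and j: "j < n"
  show "(\<lambda>t. f ((z(j := t))(i := (z(j := t)) i + h))) field_differentiable at (z j)"
  proof (cases "j = i")
    case True
    have "(\<lambda>t. f (z(i := t))) field_differentiable at (z i + h)"
      using holo_DERIV[OF f i Q[OF z]] field_differentiable_def by blast
    moreover have "(\<lambda>t. t + h) field_differentiable at (z i)" by (intro derivative_intros)
    ultimately show ?thesis using field_differentiable_compose[of "\<lambda>t. t + h" "z i" "\<lambda>t. f (z(i := t))"] True
      by (simp add: o_def)
  next
    case False
    have "(\<lambda>t. f ((z(i := z i + h))(j := t))) field_differentiable at ((z(i := z i + h)) j)"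
      using f Q[OF z] j unfolding holo_def by blast
    then show ?thesis using False by (simp add: fun_upd_twist)
  qed
qed

text \<open>Locally the difference quotients in direction \<open>i\<close> converge uniformly to
  \<open>pd i f\<close>, because the constants of the error bound do not depend on the base point.
  This avoids Cauchy integrals with parameters.\<close>

lemma holo_pd:
  assumes P: "Cn_open n P" and f: "holo n f P" and i: "i < n"
  shows "holo n (pd i f) P"
proof (rule holo_local[OF P])
  fix z assume z: "z \<in> P"
  obtain d where d: "d > 0" "polydisc n z d \<subseteq> P" "\<And>w. w \<in> polydisc n z d \<Longrightarrow> dist (f w) (f z) < 1"
    using continuous_on_polydiscD[OF P holo_continuous[OF f] z, of 1] by auto
  \<comment> \<open>Base points within \<open>r\<close> of \<open>z\<close> and slices of radius
    \<open>3 * r\<close> around them stay within \<open>4 * r = d\<close>.\<close>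
  define r where "r = d / 4"
  have r: "r > 0" using d by (simp add: r_def)
  define B where "B = norm (f z) + 1"
  have sub: "w(i := t) \<in> polydisc n z d" if "w \<in> polydisc n z r" "t \<in> ball (w i) (3 * r)" for w t
  proof (rule polydisc_upd[OF _ i])
    show "w \<in> polydisc n z d" using that(1) polydisc_mono[of r d n z] r by (auto simp: r_def)
    have "dist (w i) (z i) < r" using that i by (simp add: polydisc_def)
    then show "dist t (z i) < d" using that(2) dist_triangle[of t "z i" "w i"] by (simp add: r_def dist_commute)
  qed
  \<comment> \<open>The offset \<open>2\<close> makes \<open>norm (h k) < r\<close> strict from
    \<open>k = 0\<close> on.\<close>
  define h where "h k = complex_of_real (r / (real k + 2))" for k :: nat
  have norm_h: "norm (h k) = r / (real k + 2)" for k
    unfolding h_def norm_of_real using r by simp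
  have h: "h k \<noteq> 0" "norm (h k) < r" for k
  proof -
    have "r / (real k + 2) < r / 1" using r by (intro divide_strict_left_mono) auto
    then show "norm (h k) < r" by (simp add: norm_h)
    have "norm (h k) > 0" unfolding norm_h using r by simp
    then show "h k \<noteq> 0" by simp
  qed
  define q where "q k w = (f (w(i := w i + h k)) - f w) / h k" for k w
  have "holo n (q k) (polydisc n z r)" for k
    unfolding q_def[abs_def]
  proof (intro holo_divide holo_diff holo_const holo_shift[OF P f i] holo_subset[OF f] h(1))
    show "polydisc n z r \<subseteq> P" using polydisc_mono[of r d n z] d r by (auto simp: r_def)
    show "w(i := w i + h k) \<in> P" if "w \<in> polydisc n z r" for w
      using sub[OF that, of "w i + h k"] h(2)[of k] d r by (auto simp: dist_norm)
  qed
  moreover have "uniform_limit (polydisc n z r) q (pd i f) sequentially"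
  proof (rule uniform_limitI)
    fix e :: real assume e: "e > 0"
    have "(\<lambda>k. 2 * B / r^2 * norm (h k)) \<longlonglongrightarrow> 0"
    proof -
      have "(\<lambda>k. r / (real k + 2)) \<longlonglongrightarrow> 0" by real_asymp
      then show ?thesis unfolding norm_h by (rule tendsto_mult_right_zero)
    qed
    then have "\<forall>\<^sub>F k in sequentially. 2 * B / r^2 * norm (h k) < e" using e order_tendstoD(2) by blast
    then show "\<forall>\<^sub>F k in sequentially. \<forall>w\<in>polydisc n z r. dist (q k w) (pd i f w) < e"
    proof eventually_elim
      case (elim k)
      show ?case
      proof
        fix w assume w: "w \<in> polydisc n z r"
        have "norm ((f (w(i := w i + h k)) - f (w(i := w i))) / h k - deriv (\<lambda>t. f (w(i := t))) (w i))
            \<le> 2 * B / r^2 * norm (h k)"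
        proof (rule diff_quotient_bound)
          show "(\<lambda>t. f (w(i := t))) holomorphic_on ball (w i) (3 * r)"
            using sub[OF w] d(2) by (intro holo_slice[OF f i]) auto
          show "norm (f (w(i := u))) \<le> B" if "u \<in> ball (w i) (3 * r)" for u
            using d(3)[OF sub[OF w that]] norm_triangle_ineq2[of "f (w(i := u))" "f z"] unfolding B_def dist_norm by linarith
        qed (use h in auto)
        then show "dist (q k w) (pd i f w) < e" using elim by (simp add: q_def pd_def dist_norm)
      qed
    qed
  qed
  ultimately have "holo n (pd i f) (polydisc n z r)" by (rule holo_uniform_limit[OF Cn_open_polydisc])
  then show "\<exists>Q. Cn_open n Q \<and> z \<in> Q \<and> holo n (pd i f) Q"
    using Cn_open_polydisc polydisc_center[OF Cn_open_subset[OF P z] r] by blast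
qed

text \<open>The partial derivatives are continuous, so moving from \<open>v\<close> to
  \<open>w\<close> one coordinate at a time costs an error of at most \<open>e\<close> times each
  coordinate change. Both end points vary, which later yields Lipschitz bounds for vector
  fields.\<close>

lemma holo_strict_derivative:
  assumes P: "Cn_open n P" and f: "holo n f P" and z: "z \<in> P" and e: "e > 0"
  obtains d where "d > 0" "polydisc n z d \<subseteq> P"
    "\<And>v w. v \<in> polydisc n z d \<Longrightarrow> w \<in> polydisc n z d \<Longrightarrow>
       norm (f w - f v - (\<Sum>i<n. pd i f z * (w i - v i))) \<le> e * (\<Sum>i<n. norm (w i - v i))"
proof -
  have "\<exists>d>0. polydisc n z d \<subseteq> P \<and> (\<forall>w\<in>polydisc n z d. dist (pd i f w) (pd i f z) < e)" if "i < n" for i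
    using continuous_on_polydiscD[OF P holo_continuous[OF holo_pd[OF P f that]] z e] by metis
  then obtain \<rho> where \<rho>: "\<And>i. i < n \<Longrightarrow> \<rho> i > 0"
    "\<And>i w. i < n \<Longrightarrow> w \<in> polydisc n z (\<rho> i) \<Longrightarrow> dist (pd i f w) (pd i f z) < e" by metis
  obtain s where s: "s > 0" "polydisc n z s \<subseteq> P" using polydisc_base[OF P z] by blast
  define d where "d = Min (insert s (\<rho> ` {..<n}))"
  have d: "d > 0" unfolding d_def using \<rho>(1) s(1) by (subst Min_gr_iff) auto
  have ds: "d \<le> s" unfolding d_def by (intro Min_le) auto
  have d\<rho>: "d \<le> \<rho> i" if "i < n" for i unfolding d_def using that by (intro Min_le) auto
  have sub: "polydisc n z d \<subseteq> P" using s polydisc_mono[OF ds] by blast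
  have pd: "norm (pd i f w - pd i f z) \<le> e" if "i < n" "w \<in> polydisc n z d" for i w
    using \<rho>(2)[OF that(1), of w] that(2) polydisc_mono[OF d\<rho>[OF that(1)], of n z] by (auto simp: dist_norm)
  have "norm (f w - f v - (\<Sum>i<n. pd i f z * (w i - v i))) \<le> e * (\<Sum>i<n. norm (w i - v i))"
    if v: "v \<in> polydisc n z d" and w: "w \<in> polydisc n z d" for v w
  proof -
    \<comment> \<open>\<open>x k\<close> has exchanged the first \<open>k\<close> coordinates of
      \<open>v\<close> for those of \<open>w\<close>. A polydisc is a box, so all these points stay
      inside.\<close>
    define x where "x k = (\<lambda>i. if i < k then w i else v i)" for k :: nat
    have x: "x k \<in> polydisc n z d" for k
      using v w by (auto simp: polydisc_def x_def Cspace_def)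
    have "norm (f (x k) - f v - (\<Sum>i<k. pd i f z * (w i - v i))) \<le> e * (\<Sum>i<k. norm (w i - v i))" if "k \<le> n" for k
      using that
    proof (induction k)
      case 0
      then show ?case by (simp add: x_def)
    next
      case (Suc k)
      then have k: "k < n" by simp
      have xk: "(x k)(k := w k) = x (Suc k)" "(x k)(k := v k) = x k" by (auto simp: x_def fun_eq_iff)
      have in_disc: "(x k)(k := t) \<in> polydisc n z d" if "t \<in> ball (z k) d" for t
        using polydisc_upd[OF x k, of t] that by (simp add: dist_commute)
      have "norm ((f ((x k)(k := w k)) - pd k f z * w k) - (f ((x k)(k := v k)) - pd k f z * v k)) \<le> e * norm (w k - v k)"
      proof (rule field_differentiable_bound[of "ball (z k) d" _ "\<lambda>t. pd k f ((x k)(k := t)) - pd k f z"])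
        fix t assume t: "t \<in> ball (z k) d"
        show "((\<lambda>t. f ((x k)(k := t)) - pd k f z * t) has_field_derivative pd k f ((x k)(k := t)) - pd k f z)
            (at t within ball (z k) d)"
          using holo_DERIV[OF f k, of "x k" t] in_disc[OF t] sub
          by (auto intro!: derivative_eq_intros intro: has_field_derivative_at_within)
        show "norm (pd k f ((x k)(k := t)) - pd k f z) \<le> e" using pd k in_disc t by blast
      qed (use v w k in \<open>auto simp: polydisc_def dist_commute\<close>)
      then have "norm (f (x (Suc k)) - f (x k) - pd k f z * (w k - v k)) \<le> e * norm (w k - v k)"
        unfolding xk by (simp add: algebra_simps)
      moreover have "f (x (Suc k)) - f v - (\<Sum>i<Suc k. pd i f z * (w i - v i))
          = (f (x k) - f v - (\<Sum>i<k. pd i f z * (w i - v i))) + (f (x (Suc k)) - f (x k) - pd k f z * (w k - v k))"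
        by simp
      ultimately have "norm (f (x (Suc k)) - f v - (\<Sum>i<Suc k. pd i f z * (w i - v i)))
          \<le> e * (\<Sum>i<k. norm (w i - v i)) + e * norm (w k - v k)"
        using Suc k by (metis (no_types, lifting) norm_triangle_mono less_imp_le)
      then show ?case by (simp add: distrib_left)
    qed
    moreover have "x n = w" using v w by (auto simp: x_def polydisc_def Cspace_def fun_eq_iff)
    ultimately show ?thesis by force
  qed
  then show ?thesis using that d sub by blast
qed

section \<open>Equivalence with Frechet differentiability\<close>

lemma eventually_at_polydisc:
  assumes P: "Cn_open n P" and z: "z \<in> P"
  shows "eventually Q (at z within P) \<longleftrightarrow>
    (\<exists>d>0. polydisc n z d \<subseteq> P \<and> (\<forall>w\<in>polydisc n z d. w \<noteq> z \<longrightarrow> Q w))"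
proof
  assume "eventually Q (at z within P)"
  then obtain U where U: "open U" "z \<in> U" "\<And>w. w \<in> U \<Longrightarrow> w \<noteq> z \<Longrightarrow> w \<in> P \<Longrightarrow> Q w"
    unfolding eventually_at_topological by blast
  have "Cn_open n (P \<inter> U)" using P U(1) by (metis inf_commute openin_Int_open)
  then obtain d where "d > 0" "polydisc n z d \<subseteq> P \<inter> U" using polydisc_base[of n "P \<inter> U" z] z U by blast
  then show "\<exists>d>0. polydisc n z d \<subseteq> P \<and> (\<forall>w\<in>polydisc n z d. w \<noteq> z \<longrightarrow> Q w)" using U(3) by blast
next
  assume "\<exists>d>0. polydisc n z d \<subseteq> P \<and> (\<forall>w\<in>polydisc n z d. w \<noteq> z \<longrightarrow> Q w)"
  then obtain d where d: "d > 0" "\<And>w. w \<in> polydisc n z d \<Longrightarrow> w \<noteq> z \<Longrightarrow> Q w" by blast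
  show "eventually Q (at z within P)"
    unfolding eventually_at_topological
  proof (intro exI[of _ "{w. \<forall>i<n. dist (w i) (z i) < d}"] conjI open_coordinate_box ballI impI)
    show "z \<in> {w. \<forall>i<n. dist (w i) (z i) < d}" using d by simp
    fix w assume w: "w \<in> {w. \<forall>i<n. dist (w i) (z i) < d}" "w \<noteq> z" "w \<in> P"
    then have "w \<in> polydisc n z d" using Cn_open_subset[OF P] by (auto simp: polydisc_def)
    then show "Q w" using d(2) w(2) by blast
  qed
qed

lemma holo_imp_holomorphic_Cn:
  assumes P: "Cn_open n P" and f: "holo n f P"
  shows "holomorphic_Cn n f P"
  unfolding holomorphic_Cn_def
proof (intro ballI exI)
  fix z assume z: "z \<in> P"
  show "((\<lambda>w. (f w - f z - (\<Sum>i<n. pd i f z * (w i - z i))) / complex_of_real (Cnorm n (\<lambda>i. w i - z i)))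
      \<longlongrightarrow> 0) (at z within P)"
  proof (rule tendstoI)
    fix e :: real assume e: "e > 0"
    \<comment> \<open>Each of the \<open>n\<close> coordinate differences is at most
      \<open>Cnorm\<close>, which accounts for a factor \<open>n\<close>; the additional
      \<open>1\<close> covers \<open>n = 0\<close> and makes the final inequality strict.\<close>
    define e' where "e' = e / (real n + 1)"
    have e': "e' > 0" using e by (simp add: e'_def)
    obtain d where d: "d > 0" "polydisc n z d \<subseteq> P" "\<And>v w. v \<in> polydisc n z d \<Longrightarrow> w \<in> polydisc n z d \<Longrightarrow>
       norm (f w - f v - (\<Sum>i<n. pd i f z * (w i - v i))) \<le> e' * (\<Sum>i<n. norm (w i - v i))"
      using holo_strict_derivative[OF P f z e'] by blast
    have zd: "z \<in> polydisc n z d" using polydisc_center Cn_open_subset[OF P z] d(1) by blast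
    have "norm ((f w - f z - (\<Sum>i<n. pd i f z * (w i - z i))) / complex_of_real (Cnorm n (\<lambda>i. w i - z i))) < e"
      if w: "w \<in> polydisc n z d" for w
    proof -
      define C where "C = Cnorm n (\<lambda>i. w i - z i)"
      have C0: "C \<ge> 0" by (simp add: C_def Cnorm_def L2_set_nonneg)
      have "(\<Sum>i<n. norm (w i - z i)) \<le> (\<Sum>i<n. C)"
        unfolding C_def Cnorm_def by (rule sum_mono, rule member_le_L2_set) auto
      then have "e' * (\<Sum>i<n. norm (w i - z i)) \<le> e' * (real n * C)"
        using e' by (intro mult_left_mono) auto
      then have "norm (f w - f z - (\<Sum>i<n. pd i f z * (w i - z i))) \<le> e' * (real n * C)"
        using d(3)[OF zd w] by linarith
      then have "norm (f w - f z - (\<Sum>i<n. pd i f z * (w i - z i))) / C \<le> e' * real n"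
        using C0 e' by (cases "C = 0") (auto simp: divide_le_eq mult.assoc)
      also have "\<dots> < e" using e by (simp add: e'_def field_simps)
      finally show ?thesis using C0 by (simp add: norm_divide C_def[symmetric])
    qed
    then show "\<forall>\<^sub>F w in at z within P. dist ((f w - f z - (\<Sum>i<n. pd i f z * (w i - z i)))
        / complex_of_real (Cnorm n (\<lambda>i. w i - z i))) 0 < e"
      unfolding eventually_at_polydisc[OF P z] using d by (auto intro!: exI[of _ d])
  qed
qed

lemma holomorphic_Cn_imp_holo:
  assumes P: "Cn_open n P" and f: "holomorphic_Cn n f P"
  shows "holo n f P"
proof -
  have *: "\<exists>a. \<forall>e>0. \<exists>d>0. polydisc n z d \<subseteq> P \<and> (\<forall>w\<in>polydisc n z d.
      norm (f w - f z - (\<Sum>i<n. a i * (w i - z i))) \<le> e * (\<Sum>i<n. norm (w i - z i)))" if z: "z \<in> P" for z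
  proof -
    obtain a where a: "((\<lambda>w. (f w - f z - (\<Sum>i<n. a i * (w i - z i)))
              / complex_of_real (Cnorm n (\<lambda>i. w i - z i))) \<longlongrightarrow> 0) (at z within P)"
      using f z unfolding holomorphic_Cn_def by blast
    show ?thesis
    proof (intro exI[of _ a] allI impI)
      fix e :: real assume e: "e > 0"
      obtain d where d: "d > 0" "polydisc n z d \<subseteq> P" "\<And>w. w \<in> polydisc n z d \<Longrightarrow> w \<noteq> z \<Longrightarrow>
        dist ((f w - f z - (\<Sum>i<n. a i * (w i - z i))) / complex_of_real (Cnorm n (\<lambda>i. w i - z i))) 0 < e"
        using tendstoD[OF a e] unfolding eventually_at_polydisc[OF P z] by blast
      have "norm (f w - f z - (\<Sum>i<n. a i * (w i - z i))) \<le> e * (\<Sum>i<n. norm (w i - z i))"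
        if w: "w \<in> polydisc n z d" for w
      proof (cases "w = z")
        case False
        define C where "C = Cnorm n (\<lambda>i. w i - z i)"
        obtain i where i: "w i \<noteq> z i" using False by auto
        \<comment> \<open>Points of \<open>Cspace n\<close> agree from index \<open>n\<close> on, so
          distinct ones differ in a coordinate that \<open>Cnorm\<close> sees, and \<open>C\<close>
          is positive.\<close>
        have "i < n"
        proof (rule ccontr)
          assume "\<not> i < n"
          then have "w i = 0" "z i = 0" using w Cn_open_subset[OF P z] by (auto simp: polydisc_def Cspace_def)
          then show False using i by simp
        qed
        then have "norm (w i - z i) \<le> C" unfolding C_def Cnorm_def by (intro member_le_L2_set) auto
        then have C: "C > 0" using i by (smt (verit) zero_less_norm_iff right_minus_eq)
        have "norm (f w - f z - (\<Sum>i<n. a i * (w i - z i))) / C < e"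
          using d(3)[OF w False] C by (simp add: norm_divide C_def[symmetric])
        then have "norm (f w - f z - (\<Sum>i<n. a i * (w i - z i))) \<le> e * C"
          using C by (simp add: divide_less_eq)
        moreover have "C \<le> (\<Sum>i<n. norm (w i - z i))" unfolding C_def Cnorm_def
          using L2_set_le_sum[of "{..<n}" "\<lambda>i. norm (w i - z i)"] by simp
        ultimately show ?thesis using e by (smt (verit) mult_left_mono)
      qed auto
      then show "\<exists>d>0. polydisc n z d \<subseteq> P \<and> (\<forall>w\<in>polydisc n z d.
        norm (f w - f z - (\<Sum>i<n. a i * (w i - z i))) \<le> e * (\<Sum>i<n. norm (w i - z i)))" using d by blast
    qed
  qed
  show ?thesis
    unfolding holo_def
  proof (intro conjI ballI allI impI)
    show "continuous_on P f"
    proof (rule continuous_on_polydiscI)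
      show "P \<subseteq> Cspace n" using P openin_imp_subset by blast
      fix z and e :: real assume z: "z \<in> P" and e: "e > 0"
      obtain a where a: "\<forall>e>0. \<exists>d>0. polydisc n z d \<subseteq> P \<and> (\<forall>w\<in>polydisc n z d.
          norm (f w - f z - (\<Sum>i<n. a i * (w i - z i))) \<le> e * (\<Sum>i<n. norm (w i - z i)))"
        using *[OF z] by blast
      obtain d where d: "d > 0" "polydisc n z d \<subseteq> P" "\<And>w. w \<in> polydisc n z d \<Longrightarrow>
          norm (f w - f z - (\<Sum>i<n. a i * (w i - z i))) \<le> 1 * (\<Sum>i<n. norm (w i - z i))"
        using a[rule_format, OF zero_less_one] by blast
      define M where "M = (\<Sum>i<n. norm (a i) + 1)"
      have M: "M \<ge> 0" by (auto simp: M_def intro!: sum_nonneg)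
      define d' where "d' = min d (e / (M + 1))"
      have d': "d' > 0" using d e M by (simp add: d'_def)
      have "dist (f w) (f z) < e" if w: "w \<in> polydisc n z d'" for w
      proof -
        have "w \<in> polydisc n z d" using w polydisc_mono[of d' d n z] by (auto simp: d'_def)
        note d(3)[OF this]
        moreover have "norm (f w - f z) \<le> norm (f w - f z - (\<Sum>i<n. a i * (w i - z i))) + norm (\<Sum>i<n. a i * (w i - z i))"
          by (metis norm_triangle_sub add.commute)
        moreover have "norm (\<Sum>i<n. a i * (w i - z i)) \<le> (\<Sum>i<n. norm (a i) * norm (w i - z i))"
          by (rule order_trans[OF norm_sum]) (simp add: norm_mult)
        ultimately have "norm (f w - f z) \<le> (\<Sum>i<n. norm (a i) * norm (w i - z i)) + (\<Sum>i<n. norm (w i - z i))"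
          by linarith
        also have "\<dots> = (\<Sum>i<n. (norm (a i) + 1) * norm (w i - z i))" by (simp add: sum.distrib algebra_simps)
        also have "\<dots> \<le> (\<Sum>i<n. (norm (a i) + 1) * d')"
          using w by (intro sum_mono mult_left_mono) (auto simp: polydisc_def dist_norm less_imp_le)
        also have "\<dots> = M * d'" by (simp add: M_def sum_distrib_right)
        also have "\<dots> \<le> M * (e / (M + 1))" using M by (intro mult_left_mono) (auto simp: d'_def)
        also have "\<dots> < e" using M e by (simp add: field_simps)
        finally show ?thesis by (simp add: dist_norm)
      qed
      then show "\<exists>d>0. \<forall>w\<in>polydisc n z d \<inter> P. dist (f w) (f z) < e" using d' by blast
    qed
    fix z i assume z: "z \<in> P" and i: "i < n"
    obtain a where a: "\<And>e. e > 0 \<Longrightarrow> \<exists>d>0. polydisc n z d \<subseteq> P \<and> (\<forall>w\<in>polydisc n z d.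
      norm (f w - f z - (\<Sum>i<n. a i * (w i - z i))) \<le> e * (\<Sum>i<n. norm (w i - z i)))" using *[OF z] by blast
    have "((\<lambda>t. f (z(i := t))) has_derivative (*) (a i)) (at (z i))"
      unfolding has_derivative_at_alt
    proof (intro conjI allI impI bounded_linear_mult_right)
      fix e :: real assume "e > 0"
      then obtain d where d: "d > 0" "\<And>w. w \<in> polydisc n z d \<Longrightarrow>
        norm (f w - f z - (\<Sum>i<n. a i * (w i - z i))) \<le> e * (\<Sum>i<n. norm (w i - z i))" using a[OF \<open>e > 0\<close>] by blast
      show "\<exists>d>0. \<forall>y. norm (y - z i) < d \<longrightarrow> norm (f (z(i := y)) - f (z(i := z i)) - a i * (y - z i)) \<le> e * norm (y - z i)"
      proof (intro exI[of _ d] conjI allI impI)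
        fix y assume "norm (y - z i) < d"
        then have "z(i := y) \<in> polydisc n z d"
          using polydisc_upd[OF polydisc_center[OF Cn_open_subset[OF P z] d(1)] i] by (simp add: dist_norm)
        from d(2)[OF this]
        have "norm (f (z(i := y)) - f z - (\<Sum>j<n. a j * ((z(i := y)) j - z j))) \<le> e * (\<Sum>j<n. norm ((z(i := y)) j - z j))" .
        moreover have "(\<Sum>j<n. a j * ((z(i := y)) j - z j)) = (\<Sum>j<n. if j = i then a i * (y - z i) else 0)"
          "(\<Sum>j<n. norm ((z(i := y)) j - z j)) = (\<Sum>j<n. if j = i then norm (y - z i) else 0)"
          by (rule sum.cong; simp)+
        ultimately show "norm (f (z(i := y)) - f (z(i := z i)) - a i * (y - z i)) \<le> e * norm (y - z i)"
          using i by simp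
      qed (use d in auto)
    qed
    then show "(\<lambda>t. f (z(i := t))) field_differentiable at (z i)"
      unfolding field_differentiable_def has_field_derivative_def by blast
  qed
qed

section \<open>Composition with curves\<close>

lemma curve_remainder:
  assumes P: "Cn_open n P" and f: "holo n f P" and s: "\<gamma> s \<in> P"
    and cont: "\<And>i. i < n \<Longrightarrow> isCont (\<lambda>t. \<gamma> t i) s" and C: "\<forall>\<^sub>F t in at s. \<gamma> t \<in> Cspace n" and e: "e > 0"
  shows "\<forall>\<^sub>F t in at (s::complex). norm (f (\<gamma> t) - f (\<gamma> s) - (\<Sum>i<n. pd i f (\<gamma> s) * (\<gamma> t i - \<gamma> s i)))
           \<le> e * (\<Sum>i<n. norm (\<gamma> t i - \<gamma> s i))"
proof -
  obtain d where d: "d > 0" "polydisc n (\<gamma> s) d \<subseteq> P" "\<And>v w. v \<in> polydisc n (\<gamma> s) d \<Longrightarrow> w \<in> polydisc n (\<gamma> s) d \<Longrightarrow>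
       norm (f w - f v - (\<Sum>i<n. pd i f (\<gamma> s) * (w i - v i))) \<le> e * (\<Sum>i<n. norm (w i - v i))"
    using holo_strict_derivative[OF P f s e] by blast
  have sd: "\<gamma> s \<in> polydisc n (\<gamma> s) d" using polydisc_center Cn_open_subset[OF P s] d(1) by blast
  have "\<forall>\<^sub>F t in at s. \<forall>i\<in>{..<n}. dist (\<gamma> t i) (\<gamma> s i) < d"
    using cont d(1) by (intro eventually_ball_finite) (auto simp: isCont_def intro!: tendstoD)
  with C show ?thesis
  proof eventually_elim
    case (elim t)
    then have "\<gamma> t \<in> polydisc n (\<gamma> s) d" by (auto simp: polydisc_def)
    then show ?case using d(3) sd by blast
  qed
qed

text \<open>A Lipschitz bound at \<open>s\<close> takes the place of a derivative of the curve,
  because the lemma is also applied to curves whose differentiability is still to be proved.\<close>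

lemma curve_remainder_quotient:
  assumes P: "Cn_open n P" and f: "holo n f P" and s: "\<gamma> s \<in> P"
    and cont: "\<And>i. i < n \<Longrightarrow> isCont (\<lambda>t. \<gamma> t i) s" and C: "\<forall>\<^sub>F t in at s. \<gamma> t \<in> Cspace n"
    and bd: "\<forall>\<^sub>F t in at (s::complex). (\<Sum>i<n. norm (\<gamma> t i - \<gamma> s i)) \<le> M * norm (t - s)"
  shows "((\<lambda>t. (f (\<gamma> t) - f (\<gamma> s) - (\<Sum>i<n. pd i f (\<gamma> s) * (\<gamma> t i - \<gamma> s i))) / (t - s)) \<longlongrightarrow> 0) (at s)"
proof (rule tendstoI)
  fix e :: real assume e: "e > 0"
  define e' where "e' = e / (\<bar>M\<bar> + 1)"
  have e': "e' > 0" using e by (simp add: e'_def)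
  have ne: "\<forall>\<^sub>F t in at s. t \<noteq> s" by (simp add: eventually_at_filter)
  have rem: "\<forall>\<^sub>F t in at s. norm (f (\<gamma> t) - f (\<gamma> s) - (\<Sum>i<n. pd i f (\<gamma> s) * (\<gamma> t i - \<gamma> s i)))
      \<le> e' * (\<Sum>i<n. norm (\<gamma> t i - \<gamma> s i))"
    by (rule curve_remainder[OF P f s cont C e'])
  show "\<forall>\<^sub>F t in at s. dist ((f (\<gamma> t) - f (\<gamma> s) - (\<Sum>i<n. pd i f (\<gamma> s) * (\<gamma> t i - \<gamma> s i))) / (t - s)) 0 < e"
    using rem bd ne
  proof eventually_elim
    case (elim t)
    have "e' * (\<Sum>i<n. norm (\<gamma> t i - \<gamma> s i)) \<le> e' * (M * norm (t - s))"
      using elim(2) e' by (intro mult_left_mono) auto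
    then have "norm (f (\<gamma> t) - f (\<gamma> s) - (\<Sum>i<n. pd i f (\<gamma> s) * (\<gamma> t i - \<gamma> s i))) \<le> e' * (M * norm (t - s))"
      using elim(1) by linarith
    also have "\<dots> \<le> e' * (\<bar>M\<bar> * norm (t - s))" using e' by (intro mult_left_mono mult_right_mono) auto
    also have "\<dots> < e * norm (t - s)" using elim(3) e by (simp add: e'_def field_simps)
    finally show ?case using elim(3) by (simp add: norm_divide divide_less_eq)
  qed
qed

lemma holo_chain_curve:
  assumes P: "Cn_open n P" and f: "holo n f P" and s: "\<gamma> s \<in> P"
    and der: "\<And>i. i < n \<Longrightarrow> ((\<lambda>t. \<gamma> t i) has_field_derivative \<gamma>' i) (at s)"
    and C: "\<forall>\<^sub>F t in at s. \<gamma> t \<in> Cspace n"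
  shows "((\<lambda>t. f (\<gamma> t)) has_field_derivative (\<Sum>i<n. pd i f (\<gamma> s) * \<gamma>' i)) (at (s::complex))"
proof -
  have q: "((\<lambda>t. (\<gamma> t i - \<gamma> s i) / (t - s)) \<longlongrightarrow> \<gamma>' i) (at s)" if "i < n" for i
    using der[OF that] by (simp add: has_field_derivative_iff)
  have cont: "isCont (\<lambda>t. \<gamma> t i) s" if "i < n" for i using der[OF that] DERIV_isCont by blast
  define S where "S = (\<Sum>i<n. norm (\<gamma>' i))"
  have "((\<lambda>t. \<Sum>i<n. norm ((\<gamma> t i - \<gamma> s i) / (t - s))) \<longlongrightarrow> S) (at s)"
    unfolding S_def using q by (intro tendsto_intros) auto
  then have "\<forall>\<^sub>F t in at s. (\<Sum>i<n. norm ((\<gamma> t i - \<gamma> s i) / (t - s))) < S + 1"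
    by (rule order_tendstoD) simp
  moreover have ne: "\<forall>\<^sub>F t in at s. t \<noteq> s" by (simp add: eventually_at_filter)
  ultimately have bd: "\<forall>\<^sub>F t in at s. (\<Sum>i<n. norm (\<gamma> t i - \<gamma> s i)) \<le> (S + 1) * norm (t - s)"
  proof eventually_elim
    case (elim t)
    then have "(\<Sum>i<n. norm (\<gamma> t i - \<gamma> s i)) / norm (t - s) < S + 1"
      by (simp add: norm_divide sum_divide_distrib)
    then show ?case using elim(2) by (simp add: divide_less_eq)
  qed
  have "((\<lambda>t. (f (\<gamma> t) - f (\<gamma> s) - (\<Sum>i<n. pd i f (\<gamma> s) * (\<gamma> t i - \<gamma> s i))) / (t - s)
      + (\<Sum>i<n. pd i f (\<gamma> s) * ((\<gamma> t i - \<gamma> s i) / (t - s)))) \<longlongrightarrow> 0 + (\<Sum>i<n. pd i f (\<gamma> s) * \<gamma>' i)) (at s)"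
    using q by (intro tendsto_add curve_remainder_quotient[OF P f s cont C bd] tendsto_intros) auto
  moreover have "(f (\<gamma> t) - f (\<gamma> s) - (\<Sum>i<n. pd i f (\<gamma> s) * (\<gamma> t i - \<gamma> s i))) / (t - s)
      + (\<Sum>i<n. pd i f (\<gamma> s) * ((\<gamma> t i - \<gamma> s i) / (t - s))) = (f (\<gamma> t) - f (\<gamma> s)) / (t - s)" for t
  proof -
    have "(\<Sum>i<n. pd i f (\<gamma> s) * ((\<gamma> t i - \<gamma> s i) / (t - s))) = (\<Sum>i<n. pd i f (\<gamma> s) * (\<gamma> t i - \<gamma> s i)) / (t - s)"
      by (simp add: sum_divide_distrib)
    then show ?thesis by (simp add: add_divide_distrib[symmetric])
  qed
  ultimately show ?thesis by (simp add: has_field_derivative_iff)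
qed

text \<open>A pointwise inverse function theorem: \<open>X / J\<close> inverts the Jacobian matrix
  of the \<open>g l\<close> at \<open>\<gamma> s\<close>. This expresses the increment of
  \<open>\<gamma>\<close> through the increments of \<open>g l \<circ> \<gamma>\<close> and
  remainders that are small against it. Absorbing the remainders gives a Lipschitz bound at
  \<open>s\<close>, and with this bound they disappear from the difference quotient in the
  limit.\<close>

lemma curve_differentiable_of_frame:
  fixes \<gamma> :: "complex \<Rightarrow> nat \<Rightarrow> complex"
  assumes P: "Cn_open n P" and g: "\<And>l. l < n \<Longrightarrow> holo n (g l) P" and s: "\<gamma> s \<in> P"
    and cont: "\<And>i. i < n \<Longrightarrow> isCont (\<lambda>t. \<gamma> t i) s" and C: "\<forall>\<^sub>F t in at s. \<gamma> t \<in> Cspace n"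
    and der: "\<And>l. l < n \<Longrightarrow> (\<lambda>t. g l (\<gamma> t)) field_differentiable (at s)"
    and X: "\<And>j k. j < n \<Longrightarrow> k < n \<Longrightarrow> (\<Sum>l<n. X l k * pd j (g l) (\<gamma> s)) = (if k = j then J else 0)"
    and J: "J \<noteq> 0" and k: "k < n"
  shows "(\<lambda>t. \<gamma> t k) field_differentiable (at s)"
proof -
  obtain G where G: "\<And>l. l < n \<Longrightarrow> ((\<lambda>t. (g l (\<gamma> t) - g l (\<gamma> s)) / (t - s)) \<longlongrightarrow> G l) (at s)"
    using der unfolding field_differentiable_def has_field_derivative_iff by metis
  define R where "R l t = g l (\<gamma> t) - g l (\<gamma> s) - (\<Sum>i<n. pd i (g l) (\<gamma> s) * (\<gamma> t i - \<gamma> s i))" for l t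
  define S where "S t = (\<Sum>i<n. norm (\<gamma> t i - \<gamma> s i))" for t
  have inv: "J * (\<gamma> t k - \<gamma> s k) = (\<Sum>l<n. X l k * ((g l (\<gamma> t) - g l (\<gamma> s)) - R l t))" if k: "k < n" for k t
  proof -
    have "(\<Sum>l<n. X l k * ((g l (\<gamma> t) - g l (\<gamma> s)) - R l t))
        = (\<Sum>l<n. \<Sum>i<n. X l k * (pd i (g l) (\<gamma> s) * (\<gamma> t i - \<gamma> s i)))"
      by (simp add: R_def sum_distrib_left)
    also have "\<dots> = (\<Sum>i<n. (\<Sum>l<n. X l k * pd i (g l) (\<gamma> s)) * (\<gamma> t i - \<gamma> s i))"
      by (subst sum.swap) (simp add: sum_distrib_right mult.assoc)
    also have "\<dots> = (\<Sum>i<n. if i = k then J * (\<gamma> t k - \<gamma> s k) else 0)"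
      using X k by (intro sum.cong) auto
    also have "\<dots> = J * (\<gamma> t k - \<gamma> s k)" using k by simp
    finally show ?thesis by simp
  qed
  define A where "A = (\<Sum>l<n. \<Sum>k<n. norm (X l k))"
  have A: "A \<ge> 0" by (auto simp: A_def intro!: sum_nonneg)
  have S_le: "norm J * S t \<le> A * (\<Sum>l<n. norm (g l (\<gamma> t) - g l (\<gamma> s)) + norm (R l t))" for t
  proof -
    have "norm J * S t = (\<Sum>k<n. norm (J * (\<gamma> t k - \<gamma> s k)))"
      by (simp add: S_def sum_distrib_left norm_mult)
    also have "\<dots> \<le> (\<Sum>k<n. \<Sum>l<n. norm (X l k) * (norm (g l (\<gamma> t) - g l (\<gamma> s)) + norm (R l t)))"
    proof (rule sum_mono)
      fix k assume "k \<in> {..<n}"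
      then have k: "k < n" by simp
      show "norm (J * (\<gamma> t k - \<gamma> s k)) \<le> (\<Sum>l<n. norm (X l k) * (norm (g l (\<gamma> t) - g l (\<gamma> s)) + norm (R l t)))"
        unfolding inv[OF k]
        by (rule order_trans[OF norm_sum], rule sum_mono) (auto simp: norm_mult intro!: mult_left_mono norm_triangle_ineq4)
    qed
    also have "\<dots> = (\<Sum>l<n. (\<Sum>k<n. norm (X l k)) * (norm (g l (\<gamma> t) - g l (\<gamma> s)) + norm (R l t)))"
      by (subst sum.swap) (simp add: sum_distrib_right)
    also have "\<dots> \<le> (\<Sum>l<n. A * (norm (g l (\<gamma> t) - g l (\<gamma> s)) + norm (R l t)))"
    proof (intro sum_mono mult_right_mono)
      fix l assume "l \<in> {..<n}"
      then show "(\<Sum>k<n. norm (X l k)) \<le> A" unfolding A_def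
        by (intro member_le_sum[of l "{..<n}" "\<lambda>l. \<Sum>k<n. norm (X l k)"]) (auto intro: sum_nonneg)
    qed auto
    finally show ?thesis by (simp add: sum_distrib_left)
  qed
  \<comment> \<open>Chosen so that \<open>A * real n * e \<le> norm J / 2\<close>: the remainders
    then account for at most half of \<open>norm J * S t\<close> and can be moved to the left-hand
    side.\<close>
  define e where "e = norm J / (2 * (A + 1) * (real n + 1))"
  have e: "e > 0" using J A by (simp add: e_def)
  have "\<forall>\<^sub>F t in at s. \<forall>l\<in>{..<n}. norm (R l t) \<le> e * S t"
    unfolding R_def S_def using curve_remainder[OF P g s cont C e] by (intro eventually_ball_finite) auto
  moreover have "\<forall>\<^sub>F t in at s. \<forall>l\<in>{..<n}. norm ((g l (\<gamma> t) - g l (\<gamma> s)) / (t - s)) < norm (G l) + 1"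
  proof (intro eventually_ball_finite ballI)
    fix l assume "l \<in> {..<n}"
    then have "((\<lambda>t. norm ((g l (\<gamma> t) - g l (\<gamma> s)) / (t - s))) \<longlongrightarrow> norm (G l)) (at s)"
      using G tendsto_norm by blast
    then show "\<forall>\<^sub>F t in at s. norm ((g l (\<gamma> t) - g l (\<gamma> s)) / (t - s)) < norm (G l) + 1"
      by (rule order_tendstoD) simp
  qed simp
  moreover have "\<forall>\<^sub>F t in at s. t \<noteq> s" by (simp add: eventually_at_filter)
  ultimately have bd: "\<forall>\<^sub>F t in at s. (\<Sum>i<n. norm (\<gamma> t i - \<gamma> s i)) \<le> (2 * A * (\<Sum>l<n. norm (G l) + 1) / norm J) * norm (t - s)"
  proof eventually_elim
    case (elim t)
    have "(\<Sum>l<n. norm (g l (\<gamma> t) - g l (\<gamma> s))) \<le> (\<Sum>l<n. (norm (G l) + 1) * norm (t - s))"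
      using elim(2,3) by (intro sum_mono) (simp add: norm_divide divide_less_eq less_imp_le)
    then have g_le: "(\<Sum>l<n. norm (g l (\<gamma> t) - g l (\<gamma> s))) \<le> (\<Sum>l<n. norm (G l) + 1) * norm (t - s)"
      by (simp add: sum_distrib_right)
    have "(\<Sum>l<n. norm (R l t)) \<le> (\<Sum>l<n. e * S t)" using elim(1) by (intro sum_mono) auto
    then have R_le: "(\<Sum>l<n. norm (R l t)) \<le> real n * (e * S t)" by simp
    have "norm J * S t \<le> A * ((\<Sum>l<n. norm (G l) + 1) * norm (t - s) + real n * (e * S t))"
      using S_le[of t] g_le R_le A unfolding sum.distrib[of "\<lambda>l. norm (g l (\<gamma> t) - g l (\<gamma> s))"]
      by (smt (verit) mult_left_mono)
    moreover have "A * (real n * (e * S t)) \<le> norm J / 2 * S t"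
    proof -
      have "S t \<ge> 0" by (simp add: S_def sum_nonneg)
      moreover have "A * real n \<le> (A + 1) * (real n + 1)" using A by (intro mult_mono) auto
      then have "A * real n * norm J \<le> (A + 1) * (real n + 1) * norm J" by (rule mult_right_mono) simp
      then have "A * real n * e \<le> norm J / 2"
        using A J by (simp add: e_def divide_le_eq add_nonneg_pos mult.assoc) (simp add: algebra_simps)
      ultimately show ?thesis using mult_right_mono[of "A * real n * e" "norm J / 2" "S t"] by (simp add: mult.assoc)
    qed
    ultimately have "norm J / 2 * S t \<le> A * ((\<Sum>l<n. norm (G l) + 1) * norm (t - s))"
      unfolding distrib_left by linarith
    then show ?case using J unfolding S_def by (simp add: field_simps)
  qed
  have "((\<lambda>t. (\<Sum>l<n. X l k * ((g l (\<gamma> t) - g l (\<gamma> s)) / (t - s) - R l t / (t - s))) / J)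
      \<longlongrightarrow> (\<Sum>l<n. X l k * (G l - 0)) / J) (at s)"
    unfolding R_def using J by (intro tendsto_intros G curve_remainder_quotient[OF P g s cont C bd]) auto
  moreover have "(\<Sum>l<n. X l k * ((g l (\<gamma> t) - g l (\<gamma> s)) / (t - s) - R l t / (t - s))) / J = (\<gamma> t k - \<gamma> s k) / (t - s)" for t
  proof -
    have "(\<Sum>l<n. X l k * ((g l (\<gamma> t) - g l (\<gamma> s)) / (t - s) - R l t / (t - s)))
        = (\<Sum>l<n. X l k * ((g l (\<gamma> t) - g l (\<gamma> s)) - R l t)) / (t - s)"
      by (simp add: sum_divide_distrib diff_divide_distrib right_diff_distrib)
    also have "\<dots> = J * (\<gamma> t k - \<gamma> s k) / (t - s)" using inv[OF k, of t] by simp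
    finally show ?thesis using J by simp
  qed
  ultimately have "((\<lambda>t. (\<gamma> t k - \<gamma> s k) / (t - s)) \<longlongrightarrow> (\<Sum>l<n. X l k * (G l - 0)) / J) (at s)" by simp
  then show ?thesis unfolding field_differentiable_def has_field_derivative_iff by blast
qed

text \<open>Restriction to the complex line through \<open>w\<close> and \<open>x\<close> reduces
  this to one variable. The line meets the polydisc in a convex, hence connected, parameter set
  \<open>T\<close>.\<close>

lemma holo_identity_polydisc:
  assumes u: "holo n u (polydisc n z r)" and V: "Cn_open n V" "V \<subseteq> polydisc n z r" "V \<noteq> {}"
    and zero: "\<And>w. w \<in> V \<Longrightarrow> u w = 0" and x: "x \<in> polydisc n z r"
  shows "u x = 0"
proof -
  obtain w where w: "w \<in> V" using V by blast
  then have wP: "w \<in> polydisc n z r" using V by blast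
  obtain \<rho> where \<rho>: "\<rho> > 0" "polydisc n w \<rho> \<subseteq> V" using polydisc_base[OF V(1) w] by blast
  define \<gamma> :: "complex \<Rightarrow> nat \<Rightarrow> complex" where "\<gamma> t = (\<lambda>i. w i + t * (x i - w i))" for t
  have C: "\<gamma> t \<in> Cspace n" for t using wP x by (auto simp: \<gamma>_def polydisc_def Cspace_def)
  define T where "T = (\<Inter>i\<in>{..<n}. (\<lambda>t. \<gamma> t i) -` ball (z i) r)"
  define T0 where "T0 = T \<inter> (\<Inter>i\<in>{..<n}. (\<lambda>t. \<gamma> t i) -` ball (w i) \<rho>)"
  have op: "open ((\<lambda>t. \<gamma> t i) -` ball a b)" for i a b
    by (intro continuous_open_vimage open_ball) (auto simp: \<gamma>_def intro!: continuous_intros)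
  have T_iff: "t \<in> T \<longleftrightarrow> \<gamma> t \<in> polydisc n z r" for t :: complex
    using C[of t] by (auto simp: T_def polydisc_def dist_commute)
  have "convex ((\<lambda>t. \<gamma> t i) -` ball (z i) r)" for i
  proof (rule convexI)
    fix s t :: complex and a b :: real assume st: "s \<in> (\<lambda>t. \<gamma> t i) -` ball (z i) r" "t \<in> (\<lambda>t. \<gamma> t i) -` ball (z i) r"
      and ab: "0 \<le> a" "0 \<le> b" "a + b = 1"
    have "\<gamma> (a *\<^sub>R s + b *\<^sub>R t) i = a *\<^sub>R \<gamma> s i + b *\<^sub>R \<gamma> t i + (1 - (a + b)) *\<^sub>R w i"
      by (simp add: \<gamma>_def algebra_simps scaleR_conv_of_real)
    then have "\<gamma> (a *\<^sub>R s + b *\<^sub>R t) i = a *\<^sub>R \<gamma> s i + b *\<^sub>R \<gamma> t i" using ab by simp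
    then show "a *\<^sub>R s + b *\<^sub>R t \<in> (\<lambda>t. \<gamma> t i) -` ball (z i) r"
      using convexD[OF convex_ball[of "z i" r]] st ab by (metis vimageD vimageI)
  qed
  then have convex: "convex T" unfolding T_def by (intro convex_INT) auto
  have openT: "open T" unfolding T_def using op by (intro open_INT) auto
  have "u (\<gamma> 1) = 0"
  proof (rule analytic_continuation_open[of T0 T "\<lambda>t. u (\<gamma> t)" "\<lambda>_. 0"])
    show "open T0" unfolding T0_def using openT op by (intro open_Int open_INT) auto
    have "\<gamma> 0 = w" by (simp add: \<gamma>_def)
    then have "0 \<in> T0" using wP \<rho> T_iff[of 0] by (auto simp: T0_def \<gamma>_def)
    then show "T0 \<noteq> {}" by blast
    have "\<gamma> 1 = x" by (simp add: \<gamma>_def)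
    then show "1 \<in> T" using T_iff x by simp
    show "(\<lambda>t. u (\<gamma> t)) holomorphic_on T"
      unfolding holomorphic_on_def
    proof
      fix t assume t: "t \<in> T"
      have "((\<lambda>t. \<gamma> t i) has_field_derivative (x i - w i)) (at t)" for i
        unfolding \<gamma>_def by (auto intro!: derivative_eq_intros)
      then have "((\<lambda>t. u (\<gamma> t)) has_field_derivative (\<Sum>i<n. pd i u (\<gamma> t) * (x i - w i))) (at t)"
        by (intro holo_chain_curve[OF Cn_open_polydisc u]) (use t T_iff C in auto)
      then show "(\<lambda>t. u (\<gamma> t)) field_differentiable at t within T"
        using field_differentiable_def field_differentiable_at_within by blast
    qed
    show "u (\<gamma> t) = 0" if "t \<in> T0" for t
    proof -
      have "\<gamma> t \<in> polydisc n w \<rho>" using that C[of t] by (auto simp: T0_def polydisc_def dist_commute)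
      then show ?thesis using \<rho>(2) zero by blast
    qed
  qed (use openT convex convex_connected T0_def in auto)
  then show ?thesis by (simp add: \<gamma>_def)
qed

section \<open>Flows of holomorphic vector fields\<close>

text \<open>Strict differentiability with tolerance \<open>1\<close> gives the Lipschitz constant
  \<open>A + 1\<close>, and continuity the bound \<open>norm (V k p) + 1\<close>. One
  \<open>L\<close> above both, and one radius for the finitely many components, is what the Picard
  iteration needs.\<close>

lemma holo_local_bounds:
  assumes P: "Cn_open n P" and V: "\<And>k. k < n \<Longrightarrow> holo n (V k) P" and p: "p \<in> P"
  obtains d L where "d > 0" "L > 0" "polydisc n p d \<subseteq> P"
    "\<And>k w. k < n \<Longrightarrow> w \<in> polydisc n p d \<Longrightarrow> norm (V k w) \<le> L"
    "\<And>k v w. k < n \<Longrightarrow> v \<in> polydisc n p d \<Longrightarrow> w \<in> polydisc n p d \<Longrightarrow>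
       norm (V k w - V k v) \<le> L * (\<Sum>i<n. norm (w i - v i))"
proof -
  define B where "B k d L \<longleftrightarrow> d > 0 \<and> L > 0 \<and> polydisc n p d \<subseteq> P \<and> (\<forall>w\<in>polydisc n p d. norm (V k w) \<le> L) \<and>
      (\<forall>v\<in>polydisc n p d. \<forall>w\<in>polydisc n p d. norm (V k w - V k v) \<le> L * (\<Sum>i<n. norm (w i - v i)))"
    for k and d L :: real
  have "\<exists>d L. B k d L" if k: "k < n" for k
  proof -
    obtain d1 where d1: "d1 > 0" "polydisc n p d1 \<subseteq> P" "\<And>v w. v \<in> polydisc n p d1 \<Longrightarrow> w \<in> polydisc n p d1 \<Longrightarrow>
       norm (V k w - V k v - (\<Sum>i<n. pd i (V k) p * (w i - v i))) \<le> 1 * (\<Sum>i<n. norm (w i - v i))"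
      using holo_strict_derivative[OF P V[OF k] p zero_less_one] by blast
    obtain d2 where d2: "d2 > 0" "polydisc n p d2 \<subseteq> P" "\<And>w. w \<in> polydisc n p d2 \<Longrightarrow> dist (V k w) (V k p) < 1"
      by (rule continuous_on_polydiscD[OF P holo_continuous[OF V[OF k]] p zero_less_one], rule that)
    define A where "A = (\<Sum>i<n. norm (pd i (V k) p))"
    have A: "A \<ge> 0" by (simp add: A_def sum_nonneg)
    define L where "L = A + 1 + norm (V k p)"
    have sub: "polydisc n p (min d1 d2) \<subseteq> polydisc n p d1" "polydisc n p (min d1 d2) \<subseteq> polydisc n p d2"
      by (auto intro!: polydisc_mono)
    show ?thesis unfolding B_def
    proof (rule exI[of _ "min d1 d2"], rule exI[of _ L], intro conjI ballI)
      show "min d1 d2 > 0" using d1 d2 by simp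
      show "L > 0" using A by (simp add: L_def add_nonneg_pos add_pos_nonneg)
      show "polydisc n p (min d1 d2) \<subseteq> P" using sub d1 by blast
      show "norm (V k w) \<le> L" if "w \<in> polydisc n p (min d1 d2)" for w
      proof -
        have "norm (V k w - V k p) < 1" using d2(3)[of w] that sub by (auto simp: dist_norm)
        then show ?thesis using norm_triangle_ineq2[of "V k w" "V k p"] A unfolding L_def by linarith
      qed
      fix v w assume vw: "v \<in> polydisc n p (min d1 d2)" "w \<in> polydisc n p (min d1 d2)"
      let ?S = "\<Sum>i<n. norm (w i - v i)"
      have 1: "norm (V k w - V k v - (\<Sum>i<n. pd i (V k) p * (w i - v i))) \<le> ?S" using d1(3)[of v w] vw sub by auto
      have "norm (\<Sum>i<n. pd i (V k) p * (w i - v i)) \<le> (\<Sum>i<n. A * norm (w i - v i))"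
      proof (rule order_trans[OF norm_sum], rule sum_mono)
        fix i assume "i \<in> {..<n}"
        then have "norm (pd i (V k) p) \<le> A" unfolding A_def by (intro member_le_sum) auto
        then show "norm (pd i (V k) p * (w i - v i)) \<le> A * norm (w i - v i)"
          unfolding norm_mult by (intro mult_right_mono) auto
      qed
      then have 2: "norm (\<Sum>i<n. pd i (V k) p * (w i - v i)) \<le> A * ?S" by (simp add: sum_distrib_left)
      have "norm (V k w - V k v) \<le> norm (V k w - V k v - (\<Sum>i<n. pd i (V k) p * (w i - v i))) + norm (\<Sum>i<n. pd i (V k) p * (w i - v i))"
        using norm_triangle_sub[of "V k w - V k v" "\<Sum>i<n. pd i (V k) p * (w i - v i)"] by linarith
      then have "norm (V k w - V k v) \<le> A * ?S + ?S" using 1 2 by linarith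
      also have "\<dots> \<le> A * ?S + ?S + norm (V k p) * ?S" by (simp add: sum_nonneg)
      finally show "norm (V k w - V k v) \<le> L * ?S" by (simp add: L_def algebra_simps)
    qed
  qed
  then obtain d L where "\<And>k. k < n \<Longrightarrow> B k (d k) (L k)" by metis
  then have dL: "\<And>k. k < n \<Longrightarrow> d k > 0" "\<And>k. k < n \<Longrightarrow> L k > 0"
    "\<And>k. k < n \<Longrightarrow> polydisc n p (d k) \<subseteq> P"
    "\<And>k w. k < n \<Longrightarrow> w \<in> polydisc n p (d k) \<Longrightarrow> norm (V k w) \<le> L k"
    "\<And>k v w. k < n \<Longrightarrow> v \<in> polydisc n p (d k) \<Longrightarrow> w \<in> polydisc n p (d k) \<Longrightarrow>
       norm (V k w - V k v) \<le> L k * (\<Sum>i<n. norm (w i - v i))" unfolding B_def by blast+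
  obtain s where s: "s > 0" "polydisc n p s \<subseteq> P" using polydisc_base[OF P p] by blast
  define d' where "d' = Min (insert s (d ` {..<n}))"
  define L' where "L' = Max (insert 1 (L ` {..<n}))"
  have d': "d' > 0" unfolding d'_def using dL(1) s(1) by (subst Min_gr_iff) auto
  have "1 \<le> L'" unfolding L'_def by (intro Max_ge) auto
  then have L': "L' > 0" by simp
  have "d' \<le> s" unfolding d'_def by (intro Min_le) auto
  then have sub: "polydisc n p d' \<subseteq> P" using s polydisc_mono[of d' s n p] by blast
  have subk: "polydisc n p d' \<subseteq> polydisc n p (d k)" if "k < n" for k
    unfolding d'_def using that by (intro polydisc_mono Min_le) auto
  have Lk: "L k \<le> L'" if "k < n" for k unfolding L'_def using that by (intro Max_ge) auto
  show ?thesis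
  proof (rule that[OF d' L' sub])
    show "norm (V k w) \<le> L'" if "k < n" "w \<in> polydisc n p d'" for k w
      using dL(4)[of k w] Lk subk that by force
    show "norm (V k w - V k v) \<le> L' * (\<Sum>i<n. norm (w i - v i))"
      if "k < n" "v \<in> polydisc n p d'" "w \<in> polydisc n p d'" for k v w
    proof (rule order_trans)
      show "norm (V k w - V k v) \<le> L k * (\<Sum>i<n. norm (w i - v i))" using dL(5) subk that by blast
      show "L k * (\<Sum>i<n. norm (w i - v i)) \<le> L' * (\<Sum>i<n. norm (w i - v i))"
        using Lk that by (intro mult_right_mono) (auto intro: sum_nonneg)
    qed
  qed
qed

lemma primitive_ball:
  assumes "u holomorphic_on ball 0 \<delta>"
  shows "\<exists>G. G 0 = 0 \<and> (\<forall>x\<in>ball 0 \<delta>. (G has_field_derivative u x) (at (x::complex)))"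
proof -
  obtain g where g: "\<And>x. x \<in> ball 0 \<delta> \<Longrightarrow> (g has_field_derivative u x) (at x within ball 0 \<delta>)"
    using holomorphic_convex_primitive'[OF convex_ball open_ball assms] by blast
  have "((\<lambda>x. g x - g 0) has_field_derivative u x) (at x)" if "x \<in> ball 0 \<delta>" for x
    using g[OF that] at_within_open[OF that open_ball] by (auto intro!: derivative_eq_intros)
  then show ?thesis by (intro exI[of _ "\<lambda>x. g x - g 0"]) simp
qed

text \<open>Picard iteration in complex time. Primitives on the disc that vanish at \<open>0\<close>
  replace the integrals, and the mean value inequality replaces their estimates.\<close>

lemma holomorphic_flow:
  assumes P: "Cn_open n P" and V: "\<And>k. k < n \<Longrightarrow> holo n (V k) P" and p: "p \<in> P"
  obtains \<delta> \<gamma> where "\<delta> > 0" "\<gamma> 0 = p" "\<And>s. s \<in> ball 0 \<delta> \<Longrightarrow> \<gamma> s \<in> P"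
    "\<And>s k. s \<in> ball 0 \<delta> \<Longrightarrow> k < n \<Longrightarrow> ((\<lambda>t. \<gamma> t k) has_field_derivative V k (\<gamma> s)) (at (s::complex))"
proof -
  obtain d L where d: "d > 0" and L: "L > 0" and sub: "polydisc n p d \<subseteq> P" and
    bound: "\<And>k w. k < n \<Longrightarrow> w \<in> polydisc n p d \<Longrightarrow> norm (V k w) \<le> L" and
    lip: "\<And>k v w. k < n \<Longrightarrow> v \<in> polydisc n p d \<Longrightarrow> w \<in> polydisc n p d \<Longrightarrow>
       norm (V k w - V k v) \<le> L * (\<Sum>i<n. norm (w i - v i))"
    using holo_local_bounds[where V = V and P = P, OF P V p] by blast
  \<comment> \<open>The first bound yields \<open>L * \<delta> \<le> d / 2\<close>, which keeps the
    iterates in the polydisc. The second yields \<open>L * real n * \<delta> \<le> 1 / 2\<close>,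
    which halves successive differences; its factor \<open>n\<close> comes from the sum in the
    Lipschitz estimate.\<close>
  define \<delta> where "\<delta> = min (d / (2 * L)) (1 / (2 * L * (real n + 1)))"
  have \<delta>: "\<delta> > 0" using d L by (simp add: \<delta>_def)
  have \<delta>1: "L * \<delta> \<le> d / 2"
  proof -
    have "L * \<delta> \<le> L * (d / (2 * L))" using L by (intro mult_left_mono) (auto simp: \<delta>_def)
    then show ?thesis using L by simp
  qed
  have \<delta>2: "L * real n * \<delta> \<le> 1 / 2"
  proof -
    have "L * real n * \<delta> \<le> L * real n * (1 / (2 * L * (real n + 1)))" using L by (intro mult_left_mono) (auto simp: \<delta>_def)
    also have "\<dots> = real n / (2 * (real n + 1))" using L by simp
    also have "\<dots> \<le> 1 / 2" by (simp add: field_simps)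
    finally show ?thesis .
  qed
  have pC: "p \<in> Cspace n" using Cn_open_subset[OF P p] .
  define G where "G u = (SOME G. G 0 = 0 \<and> (\<forall>x\<in>ball 0 \<delta>. (G has_field_derivative u x) (at (x::complex))))" for u
  have G: "G u 0 = 0" "\<And>x. x \<in> ball 0 \<delta> \<Longrightarrow> (G u has_field_derivative u x) (at x)"
    if "u holomorphic_on ball 0 \<delta>" for u
    using someI_ex[OF primitive_ball[OF that]] unfolding G_def by blast+
  define it where "it = rec_nat (\<lambda>s. p) (\<lambda>N \<gamma> s k. if k < n then p k + G (\<lambda>t. V k (\<gamma> t)) s else 0)"
  have it0: "it 0 = (\<lambda>s. p)" and itS: "it (Suc N) = (\<lambda>s k. if k < n then p k + G (\<lambda>t. V k (it N t)) s else 0)" for N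
    unfolding it_def by simp_all
  \<comment> \<open>The claims depend on each other: the next iterate is a primitive, which requires
    \<open>V k (it N t)\<close> to be holomorphic in \<open>t\<close>, and this requires the iterate
    to be holomorphic and to stay in the polydisc.\<close>
  have *: "(\<forall>k<n. (\<lambda>s. it N s k) holomorphic_on ball 0 \<delta>) \<and>
      (\<forall>s\<in>ball 0 \<delta>. it N s \<in> Cspace n \<and> (\<forall>k<n. dist (it N s k) (p k) \<le> d / 2)) \<and>
      (\<forall>k<n. (\<lambda>t. V k (it N t)) holomorphic_on ball 0 \<delta>)" for N
  proof (induction N)
    case 0
    then show ?case using pC d by (auto simp: it0)
  next
    case (Suc N)
    then have hol: "\<And>k. k < n \<Longrightarrow> (\<lambda>t. V k (it N t)) holomorphic_on ball 0 \<delta>" by blast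
    have der: "((\<lambda>s. it (Suc N) s k) has_field_derivative V k (it N s)) (at s)" if "s \<in> ball 0 \<delta>" "k < n" for s k
      using that by (auto simp: itS intro!: derivative_eq_intros G(2)[OF hol])
    have inC: "it (Suc N) s \<in> Cspace n" for s by (auto simp: itS Cspace_def)
    have in_N: "it N s \<in> polydisc n p d" if "s \<in> ball 0 \<delta>" for s
    proof -
      have "it N s \<in> Cspace n" "\<And>k. k < n \<Longrightarrow> dist (it N s k) (p k) \<le> d / 2" using Suc that by blast+
      then show ?thesis using d unfolding polydisc_def by force
    qed
    have near: "dist (it (Suc N) s k) (p k) \<le> d / 2" if s: "s \<in> ball 0 \<delta>" and k: "k < n" for s k
    proof -
      have "norm (it (Suc N) s k - it (Suc N) 0 k) \<le> L * norm (s - 0)"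
        by (rule field_differentiable_bound[of "ball 0 \<delta>" _ "\<lambda>s. V k (it N s)"])
          (use s k \<delta> der bound[OF k in_N] in \<open>auto intro: has_field_derivative_at_within\<close>)
      also have "\<dots> \<le> L * \<delta>" using s L by (intro mult_left_mono) auto
      finally show ?thesis using \<delta>1 G(1)[OF hol[OF k]] k by (simp add: itS dist_norm)
    qed
    have in_S: "it (Suc N) s \<in> polydisc n p d" if "s \<in> ball 0 \<delta>" for s
      using inC[of s] near[OF that] d unfolding polydisc_def by force
    have "(\<lambda>t. V k (it (Suc N) t)) field_differentiable (at s)" if s: "s \<in> ball 0 \<delta>" and k: "k < n" for s k
    proof -
      have "((\<lambda>t. V k (it (Suc N) t)) has_field_derivative (\<Sum>i<n. pd i (V k) (it (Suc N) s) * V i (it N s))) (at s)"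
        by (rule holo_chain_curve[OF P V[OF k]]) (use in_S[OF s] sub der[OF s] inC in auto)
      then show ?thesis using field_differentiable_def by blast
    qed
    then have "(\<lambda>t. V k (it (Suc N) t)) holomorphic_on ball 0 \<delta>" if "k < n" for k
      unfolding holomorphic_on_def using that field_differentiable_at_within by blast
    moreover have "(\<lambda>s. it (Suc N) s k) holomorphic_on ball 0 \<delta>" if "k < n" for k
      unfolding holomorphic_on_def using that field_differentiable_at_within field_differentiable_def der by blast
    ultimately show ?case using inC near by blast
  qed
  have in_it: "it N s \<in> polydisc n p d" if "s \<in> ball 0 \<delta>" for N s
  proof -
    have "it N s \<in> Cspace n" "\<And>k. k < n \<Longrightarrow> dist (it N s k) (p k) \<le> d / 2" using * that by blast+
    then show ?thesis using d unfolding polydisc_def by force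
  qed
  have holV: "\<And>k N. k < n \<Longrightarrow> (\<lambda>t. V k (it N t)) holomorphic_on ball 0 \<delta>" using * by blast
  have der: "((\<lambda>s. it (Suc N) s k) has_field_derivative V k (it N s)) (at s)" if "s \<in> ball 0 \<delta>" "k < n" for s k N
    using that by (auto simp: itS intro!: derivative_eq_intros G(2)[OF holV])
  have it_0: "it N 0 k = p k" if "k < n" for N k
    using that by (cases N) (auto simp: it0 itS G(1)[OF holV])
  have diff: "norm (it (Suc N) s k - it N s k) \<le> d * (1/2) ^ N" if "s \<in> ball 0 \<delta>" "k < n" for s k N
    using that
  proof (induction N arbitrary: s k)
    case 0
    then have "dist (it 1 s k) (p k) \<le> d / 2" using * by blast
    then show ?case using d by (simp add: it0 dist_norm)
  next
    case (Suc N)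
    have "norm ((it (Suc (Suc N)) s k - it (Suc N) s k) - (it (Suc (Suc N)) 0 k - it (Suc N) 0 k))
        \<le> (L * (real n * (d * (1/2) ^ N))) * norm (s - 0)"
    proof (rule field_differentiable_bound[of "ball 0 \<delta>" _ "\<lambda>s. V k (it (Suc N) s) - V k (it N s)"])
      fix t :: complex assume t: "t \<in> ball 0 \<delta>"
      show "((\<lambda>s. it (Suc (Suc N)) s k - it (Suc N) s k) has_field_derivative V k (it (Suc N) t) - V k (it N t)) (at t within ball 0 \<delta>)"
        using der[OF t Suc.prems(2)] by (intro derivative_intros) (auto intro: has_field_derivative_at_within)
      have "(\<Sum>i<n. norm (it (Suc N) t i - it N t i)) \<le> (\<Sum>i<n. d * (1/2) ^ N)"
        using Suc.IH[OF t] by (intro sum_mono) auto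
      then have "L * (\<Sum>i<n. norm (it (Suc N) t i - it N t i)) \<le> L * (real n * (d * (1/2) ^ N))"
        using L by (intro mult_left_mono) auto
      then show "norm (V k (it (Suc N) t) - V k (it N t)) \<le> L * (real n * (d * (1/2) ^ N))"
        using lip[OF Suc.prems(2) in_it[OF t, of N] in_it[OF t, of "Suc N"]] by linarith
    qed (use Suc.prems \<delta> in auto)
    also have "\<dots> \<le> (L * (real n * (d * (1/2) ^ N))) * \<delta>"
      using Suc.prems L d by (intro mult_left_mono) auto
    also have "\<dots> = (L * real n * \<delta>) * (d * (1/2) ^ N)" by simp
    also have "\<dots> \<le> (1/2) * (d * (1/2) ^ N)" using d by (intro mult_right_mono[OF \<delta>2]) auto
    finally show ?case using Suc.prems(2) by (simp add: it_0)
  qed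
  \<comment> \<open>The limit is written as a telescoping series so that the geometric bound
    \<open>diff\<close> gives uniform convergence by the Weierstrass test. The value
    \<open>0\<close> from index \<open>n\<close> on keeps \<open>\<gamma> s\<close> in
    \<open>Cspace n\<close>.\<close>
  define \<gamma> where "\<gamma> s k = (if k < n then p k + (\<Sum>j. it (Suc j) s k - it j s k) else 0)" for s k
  have lim: "uniform_limit (ball 0 \<delta>) (\<lambda>N s. it N s k) (\<lambda>s. \<gamma> s k) sequentially" if k: "k < n" for k
  proof -
    have "uniform_limit (ball 0 \<delta>) (\<lambda>N s. \<Sum>j<N. it (Suc j) s k - it j s k) (\<lambda>s. \<Sum>j. it (Suc j) s k - it j s k) sequentially"
      by (rule Weierstrass_m_test[where M = "\<lambda>j. d * (1/2) ^ j"])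
        (use diff k in \<open>auto intro!: summable_mult summable_geometric\<close>)
    then have "uniform_limit (ball 0 \<delta>) (\<lambda>N s. p k + (\<Sum>j<N. it (Suc j) s k - it j s k))
        (\<lambda>s. p k + (\<Sum>j. it (Suc j) s k - it j s k)) sequentially"
      by (intro uniform_limit_add uniform_limit_const)
    moreover have "p k + (\<Sum>j<N. it (Suc j) s k - it j s k) = it N s k" for N s
      using sum_lessThan_telescope[of "\<lambda>j. it j s k" N] by (simp add: it0)
    ultimately show ?thesis using k by (simp add: \<gamma>_def)
  qed
  have tends: "(\<lambda>N. it N s k) \<longlonglongrightarrow> \<gamma> s k" if "s \<in> ball 0 \<delta>" "k < n" for s k
    using tendsto_uniform_limitI[OF lim] that by blast
  have in_\<gamma>: "\<gamma> s \<in> polydisc n p d" if s: "s \<in> ball 0 \<delta>" for s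
  proof -
    have "dist (\<gamma> s k) (p k) < d" if k: "k < n" for k
    proof -
      have "(\<lambda>N. dist (it N s k) (p k)) \<longlonglongrightarrow> dist (\<gamma> s k) (p k)"
        using tends[OF s k] by (intro tendsto_intros)
      then have "dist (\<gamma> s k) (p k) \<le> d / 2" by (rule Lim_bounded) (use * s k in blast)
      then show ?thesis using d by simp
    qed
    then show ?thesis by (auto simp: polydisc_def \<gamma>_def Cspace_def)
  qed
  show ?thesis
  proof (rule that[OF \<delta>])
    show "\<gamma> 0 = p"
    proof
      fix k show "\<gamma> 0 k = p k"
      proof (cases "k < n")
        case True
        then have "(\<lambda>N. it N 0 k) \<longlonglongrightarrow> p k" by (simp add: it_0)
        then show ?thesis using tends[of 0 k] True \<delta> LIMSEQ_unique by auto
      next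
        case False
        then show ?thesis using pC by (simp add: \<gamma>_def Cspace_def)
      qed
    qed
    show "\<gamma> s \<in> P" if "s \<in> ball 0 \<delta>" for s using in_\<gamma>[OF that] sub by blast
    fix s :: complex and k assume s: "s \<in> ball 0 \<delta>" and k: "k < n"
    \<comment> \<open>The derivatives of a locally uniform limit converge as well. The sequence is
      shifted by one because \<open>der\<close> expresses the derivative of an iterate through its
      predecessor.\<close>
    have "\<exists>g'. \<forall>x\<in>ball 0 \<delta>. ((\<lambda>s. \<gamma> s k) has_field_derivative g' x) (at x) \<and> (\<lambda>N. V k (it N x)) \<longlonglongrightarrow> g' x"
    proof (rule has_complex_derivative_uniform_sequence[where f = "\<lambda>N s. it (Suc N) s k"])
      show "\<exists>d>0. cball x d \<subseteq> ball 0 \<delta> \<and> uniform_limit (cball x d) (\<lambda>N s. it (Suc N) s k) (\<lambda>s. \<gamma> s k) sequentially"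
        if x: "x \<in> ball 0 \<delta>" for x
      proof -
        obtain e where e: "e > 0" "cball x e \<subseteq> ball 0 \<delta>" using x open_contains_cball open_ball by blast
        have "uniform_limit (ball 0 \<delta>) (\<lambda>N s. it (Suc N) s k) (\<lambda>s. \<gamma> s k) sequentially"
          using lim[OF k] filterlim_compose filterlim_Suc by fast
        then show ?thesis using uniform_limit_on_subset e by blast
      qed
    qed (use der k in auto)
    then obtain g' where g': "((\<lambda>s. \<gamma> s k) has_field_derivative g') (at s)" "(\<lambda>N. V k (it N s)) \<longlonglongrightarrow> g'"
      using s by blast
    have "(\<lambda>N. V k (it N s)) \<longlonglongrightarrow> V k (\<gamma> s)"
    proof (rule LIM_zero_cancel, rule Lim_null_comparison)
      show "\<forall>\<^sub>F N in sequentially. norm (V k (it N s) - V k (\<gamma> s)) \<le> L * (\<Sum>i<n. norm (it N s i - \<gamma> s i))"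
        using lip[OF k in_\<gamma>[OF s] in_it[OF s]] by (intro always_eventually allI) blast
      have "(\<lambda>N. L * (\<Sum>i<n. norm (it N s i - \<gamma> s i))) \<longlonglongrightarrow> L * (\<Sum>i<n. norm (\<gamma> s i - \<gamma> s i))"
        using tends[OF s] by (intro tendsto_intros) auto
      then show "(\<lambda>N. L * (\<Sum>i<n. norm (it N s i - \<gamma> s i))) \<longlonglongrightarrow> 0" by simp
    qed
    then show "((\<lambda>t. \<gamma> t k) has_field_derivative V k (\<gamma> s)) (at s)" using g' LIMSEQ_unique by blast
  qed
qed

section \<open>Curves along which a separating family is holomorphic\<close>

definition lie :: "nat \<Rightarrow> (nat \<Rightarrow> (nat \<Rightarrow> complex) \<Rightarrow> complex) \<Rightarrow> ((nat \<Rightarrow> complex) \<Rightarrow> complex) \<Rightarrow> (nat \<Rightarrow> complex) \<Rightarrow> complex" where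
  "lie n V h x = (\<Sum>k<n. V k x * pd k h x)"

lemma holo_lie:
  "Cn_open n P \<Longrightarrow> (\<And>k. k < n \<Longrightarrow> holo n (V k) P) \<Longrightarrow> holo n h P \<Longrightarrow> holo n (lie n V h) P"
  unfolding lie_def[abs_def] by (intro holo_sum holo_mult holo_pd) auto

text \<open>A frame is a map \<open>g\<close> together with the inverse \<open>X / J\<close> of its Jacobian matrix; clearing the
  denominator \<open>J\<close> keeps everything holomorphic on all of \<open>P\<close>.\<close>

definition frame :: "nat \<Rightarrow> (nat \<Rightarrow> complex) set \<Rightarrow> (nat \<Rightarrow> (nat \<Rightarrow> complex) \<Rightarrow> complex) \<Rightarrow>
    (nat \<Rightarrow> nat \<Rightarrow> (nat \<Rightarrow> complex) \<Rightarrow> complex) \<Rightarrow> ((nat \<Rightarrow> complex) \<Rightarrow> complex) \<Rightarrow> bool" where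
  "frame n P g X J \<longleftrightarrow> holo n J P \<and> (\<forall>l<n. holo n (g l) P) \<and> (\<forall>l<n. \<forall>k<n. holo n (X l k) P) \<and>
     (\<forall>x\<in>P. \<forall>l<n. \<forall>m<n. lie n (X l) (g m) x = (if l = m then J x else 0)) \<and>
     (\<forall>x\<in>P. \<forall>j<n. \<forall>k<n. (\<Sum>l<n. X l k x * pd j (g l) x) = (if k = j then J x else 0))"

lemma frame_coordinates: "frame n P (\<lambda>l z. z l) (\<lambda>l k _. if l = k then 1 else 0) (\<lambda>_. 1)"
  unfolding frame_def lie_def
  by (auto simp: pd_coordinate holo_const holo_coordinate if_distrib[of "\<lambda>x. x * _"] cong: if_cong)

text \<open>Where \<open>J \<noteq> 0\<close>, exchanging \<open>g i\<close> for \<open>h\<close>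
  multiplies the Jacobian determinant by \<open>lie n (X i) h / J\<close>, as in Cramer's rule. The
  new dual fields are again written without denominators, which explains the factor \<open>J\<close>
  in the new denominator.\<close>

lemma frame_replace:
  fixes X :: "nat \<Rightarrow> nat \<Rightarrow> (nat \<Rightarrow> complex) \<Rightarrow> complex"
  assumes P: "Cn_open n P" and fr: "frame n P g X J" and h: "holo n h P" and i: "i < n"
  shows "\<exists>Y. frame n P (g(i := h)) Y (\<lambda>x. lie n (X i) h x * J x)"
proof -
  define a where "a l x = lie n (X l) h x" for l x
  \<comment> \<open>For \<open>l \<noteq> i\<close>, the combination
    \<open>a i * X l - a l * X i\<close> annihilates \<open>h\<close>, sends \<open>g l\<close> to
    \<open>a i * J\<close> and every other \<open>g m\<close> with \<open>m \<noteq> i\<close> to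
    \<open>0\<close>. The field \<open>J * X i\<close> sends \<open>h\<close> to
    \<open>a i * J\<close>.\<close>
  define Y where "Y l k x = (if l = i then J x * X i k x else a i x * X l k x - a l x * X i k x)" for l k x
  have J: "holo n J P" and g: "\<And>l. l < n \<Longrightarrow> holo n (g l) P" and X: "\<And>l k. l < n \<Longrightarrow> k < n \<Longrightarrow> holo n (X l k) P"
    and Xg: "\<And>x l m. x \<in> P \<Longrightarrow> l < n \<Longrightarrow> m < n \<Longrightarrow> lie n (X l) (g m) x = (if l = m then J x else 0)"
    and inv: "\<And>x j k. x \<in> P \<Longrightarrow> j < n \<Longrightarrow> k < n \<Longrightarrow> (\<Sum>l<n. X l k x * pd j (g l) x) = (if k = j then J x else 0)"
    using fr unfolding frame_def by blast+
  have a: "holo n (a l) P" if "l < n" for l unfolding a_def[abs_def] by (rule holo_lie[OF P X[OF that] h])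
  have Y: "holo n (Y l k) P" if "l < n" "k < n" for l k
    using that i by (cases "l = i") (auto simp: Y_def[abs_def] intro!: holo_mult holo_diff J X a)
  have lieY: "lie n (Y l) u x = (if l = i then J x * lie n (X i) u x else a i x * lie n (X l) u x - a l x * lie n (X i) u x)" for l u x
    by (auto simp: lie_def Y_def sum_distrib_left sum_subtractf algebra_simps)
  \<comment> \<open>The differential of \<open>h\<close>, multiplied by \<open>J\<close>, expanded
    in the differentials of the \<open>g l\<close>.\<close>
  have Jh: "J x * pd j h x = (\<Sum>l<n. a l x * pd j (g l) x)" if x: "x \<in> P" and j: "j < n" for x j
  proof -
    have "(\<Sum>l<n. a l x * pd j (g l) x) = (\<Sum>l<n. \<Sum>k<n. X l k x * pd k h x * pd j (g l) x)"
      by (simp add: a_def lie_def sum_distrib_right)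
    also have "\<dots> = (\<Sum>k<n. pd k h x * (\<Sum>l<n. X l k x * pd j (g l) x))"
      by (subst sum.swap) (simp add: sum_distrib_left mult_ac)
    also have "\<dots> = (\<Sum>k<n. if k = j then pd j h x * J x else 0)"
      using inv[OF x j] by (intro sum.cong) auto
    also have "\<dots> = J x * pd j h x" using j by simp
    finally show ?thesis by simp
  qed
  have "(\<Sum>l<n. Y l k x * pd j ((g(i := h)) l) x) = (if k = j then a i x * J x else 0)"
    if x: "x \<in> P" and j: "j < n" and k: "k < n" for x j k
  proof -
    have "Y l k x * pd j ((g(i := h)) l) x = a i x * (X l k x * pd j (g l) x) - X i k x * (a l x * pd j (g l) x)
        + (if l = i then X i k x * (J x * pd j h x) else 0)" for l
      by (auto simp: Y_def algebra_simps)
    then have "(\<Sum>l<n. Y l k x * pd j ((g(i := h)) l) x) = a i x * (\<Sum>l<n. X l k x * pd j (g l) x)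
        - X i k x * (\<Sum>l<n. a l x * pd j (g l) x) + X i k x * (J x * pd j h x)"
      using i by (simp add: sum.distrib sum_subtractf sum_distrib_left)
    then show ?thesis using inv[OF x j k] Jh[OF x j] by simp
  qed
  moreover have "lie n (Y l) ((g(i := h)) m) x = (if l = m then a i x * J x else 0)"
    if x: "x \<in> P" and l: "l < n" and m: "m < n" for x l m
    using Xg[OF x l m] Xg[OF x i m] by (auto simp: lieY a_def)
  ultimately have "frame n P (g(i := h)) Y (\<lambda>x. lie n (X i) h x * J x)"
    unfolding frame_def using J g h Y i a by (auto simp: a_def[symmetric] intro!: holo_mult)
  then show ?thesis by blast
qed

text \<open>\<open>V\<close> is only known to annihilate \<open>A\<close> at the single point
  \<open>p\<close>. Since \<open>A\<close> is stable under \<open>V\<close>, this applies to all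
  iterated derivatives, and these are the derivatives of \<open>h \<circ> \<gamma>\<close> at
  \<open>0\<close>.\<close>

lemma flow_invariant:
  assumes P: "Cn_open n P" and V: "\<And>k. k < n \<Longrightarrow> holo n (V k) P"
    and A: "\<And>h. h \<in> A \<Longrightarrow> holo n h P \<and> lie n V h \<in> A \<and> lie n V h p = 0"
    and \<gamma>: "\<And>s. s \<in> ball 0 \<delta> \<Longrightarrow> \<gamma> s \<in> P" "\<gamma> 0 = p"
    and der: "\<And>s k. s \<in> ball 0 \<delta> \<Longrightarrow> k < n \<Longrightarrow> ((\<lambda>t. \<gamma> t k) has_field_derivative V k (\<gamma> s)) (at (s::complex))"
    and h: "h \<in> A" and s: "s \<in> ball 0 \<delta>"
  shows "h (\<gamma> s) = h p"
proof -
  have "\<delta> > 0" using s by (auto intro: le_less_trans[OF norm_ge_zero])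
  have d: "((\<lambda>s. u (\<gamma> s)) has_field_derivative lie n V u (\<gamma> s)) (at s)" if "holo n u P" and s: "s \<in> ball 0 \<delta>" for u s
  proof -
    have "\<forall>\<^sub>F t in at s. t \<in> ball 0 \<delta>" using s by (intro eventually_at_in_open') auto
    then have "\<forall>\<^sub>F t in at s. \<gamma> t \<in> Cspace n" by eventually_elim (use \<gamma> Cn_open_subset[OF P] in blast)
    then show ?thesis using holo_chain_curve[OF P that(1) \<gamma>(1)[OF s] der[OF s]] by (simp add: lie_def mult.commute)
  qed
  have AA: "(lie n V ^^ m) h \<in> A" for m using h A by (induction m) auto
  have hd: "(deriv ^^ m) (\<lambda>s. h (\<gamma> s)) s = (lie n V ^^ m) h (\<gamma> s)" if "s \<in> ball 0 \<delta>" for m s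
    using that
  proof (induction m arbitrary: s)
    case (Suc m)
    have "((\<lambda>s. (lie n V ^^ m) h (\<gamma> s)) has_field_derivative lie n V ((lie n V ^^ m) h) (\<gamma> s)) (at s)"
      using d A AA Suc.prems by blast
    then have "((deriv ^^ m) (\<lambda>s. h (\<gamma> s)) has_field_derivative lie n V ((lie n V ^^ m) h) (\<gamma> s)) (at s)"
      by (rule has_field_derivative_transform_within_open[OF _ open_ball Suc.prems]) (use Suc.IH in auto)
    then show ?case by (simp add: DERIV_imp_deriv)
  qed auto
  have "(\<lambda>s. h (\<gamma> s)) s = (\<lambda>s. h (\<gamma> s)) 0"
  proof (rule holomorphic_fun_eq_const_on_connected[of "\<lambda>s. h (\<gamma> s)" "ball 0 \<delta>"])
    show "(\<lambda>s. h (\<gamma> s)) holomorphic_on ball 0 \<delta>"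
      unfolding holomorphic_on_def using d A h field_differentiable_def field_differentiable_at_within by blast
    show "(deriv ^^ m) (\<lambda>s. h (\<gamma> s)) 0 = 0" if "0 < m" for m
      using hd[of 0 m] A AA that \<gamma>(2) \<open>\<delta> > 0\<close> by (cases m) auto
  qed (use s \<open>\<delta> > 0\<close> in auto)
  then show ?thesis using \<gamma>(2) by simp
qed

theorem holomorphic_curve_of_separating:
  fixes c :: "complex \<Rightarrow> nat \<Rightarrow> complex"
  assumes P: "Cn_open n P" and cP: "\<And>t. t \<in> cball a r \<Longrightarrow> c t \<in> P"
    and cont: "\<And>k. k < n \<Longrightarrow> continuous_on (cball a r) (\<lambda>t. c t k)"
    and sep: "\<And>x y. x \<in> P \<Longrightarrow> y \<in> P \<Longrightarrow> x \<noteq> y \<Longrightarrow> \<exists>g\<in>G. g x \<noteq> g y"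
    and G: "\<And>g. g \<in> G \<Longrightarrow> holo n g P" "\<And>g. g \<in> G \<Longrightarrow> (\<lambda>t. g (c t)) holomorphic_on ball a r"
    and k: "k < n"
  shows "(\<lambda>t. c t k) holomorphic_on ball a r"
proof (cases "r > 0")
  case False
  then have empty: "ball a r = {}" by simp
  show ?thesis unfolding empty by (rule holomorphic_on_empty)
next
  case r: True
  define A where "A = {h. holo n h P \<and> (\<lambda>t. h (c t)) holomorphic_on ball a r}"
  have cC: "c t \<in> Cspace n" if "t \<in> cball a r" for t using cP[OF that] Cn_open_subset[OF P] by blast
  have cB: "c t \<in> P" if "t \<in> ball a r" for t using cP that by auto
  \<comment> \<open>This is how \<open>lie n V h\<close> will enter \<open>A\<close> without any
    derivative of \<open>c\<close>: its pullback is the constant \<open>0\<close>.\<close>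
  have zero_A: "h \<in> A" if "holo n h P" "\<And>t. t \<in> ball a r \<Longrightarrow> h (c t) = 0" for h
  proof -
    have "(\<lambda>_. 0) holomorphic_on ball a r" by simp
    then have "(\<lambda>t. h (c t)) holomorphic_on ball a r"
      by (rule holomorphic_transform) (use that in auto)
    then show ?thesis using that by (simp add: A_def)
  qed
  define Q where "Q g \<longleftrightarrow> (\<exists>X J. frame n P g X J \<and> (\<exists>t\<in>ball a r. J (c t) \<noteq> 0))" for g
  define N where "N g = card {l. l < n \<and> g l \<in> A}" for g :: "nat \<Rightarrow> (nat \<Rightarrow> complex) \<Rightarrow> complex"
  \<comment> \<open>The coordinate functions, with \<open>J = 1\<close>, show that admissible maps
    exist; since \<open>N\<close> never exceeds \<open>n\<close>, it attains a maximum on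
    them.\<close>
  have "Q (\<lambda>l z. z l)" unfolding Q_def using frame_coordinates[of n P] r by (intro exI conjI) (auto intro!: bexI[of _ a])
  moreover have "N g < Suc n" for g
    unfolding N_def using card_mono[of "{..<n}" "{l. l < n \<and> g l \<in> A}"] by (auto simp: less_Suc_eq_le)
  ultimately have "\<exists>g. Q g \<and> (\<forall>g'. Q g' \<longrightarrow> N g' \<le> N g)"
    by (intro ex_has_greatest_nat[of Q "\<lambda>l z. z l" N "Suc n"]) auto
  then obtain g where g: "Q g" and max: "\<And>g'. Q g' \<Longrightarrow> N g' \<le> N g" by metis
  obtain X J where fr: "frame n P g X J" and J0: "\<exists>t\<in>ball a r. J (c t) \<noteq> 0" using g unfolding Q_def by blast
  have J: "holo n J P" and gh: "\<And>l. l < n \<Longrightarrow> holo n (g l) P" and X: "\<And>l k. l < n \<Longrightarrow> k < n \<Longrightarrow> holo n (X l k) P"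
    and Xg: "\<And>x l m. x \<in> P \<Longrightarrow> l < n \<Longrightarrow> m < n \<Longrightarrow> lie n (X l) (g m) x = (if l = m then J x else 0)"
    and inv: "\<And>x j k. x \<in> P \<Longrightarrow> j < n \<Longrightarrow> k < n \<Longrightarrow> (\<Sum>l<n. X l k x * pd j (g l) x) = (if k = j then J x else 0)"
    using fr unfolding frame_def by blast+
  have gA: "g i \<in> A" if i: "i < n" for i
  proof (rule ccontr)
    assume notA: "g i \<notin> A"
    \<comment> \<open>The factor \<open>J\<close> makes \<open>lie n V h\<close> coincide with the
      denominator that \<open>frame_replace\<close> produces for \<open>g(i := h)\<close>. Along
      \<open>c\<close>, \<open>lie n V (g i)\<close> equals \<open>J^2\<close>, which is nonzero
      wherever \<open>J\<close> is.\<close>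
    define V where "V k x = J x * X i k x" for k x
    have V: "holo n (V k) P" if "k < n" for k unfolding V_def[abs_def] using J X i that by (intro holo_mult) auto
    have lieV: "lie n V h x = lie n (X i) h x * J x" for h x
      by (simp add: lie_def V_def sum_distrib_left mult_ac)
    have van: "lie n V h (c t) = 0" if h: "h \<in> A" and t: "t \<in> ball a r" for h t
    proof (rule ccontr)
      assume ne: "lie n V h (c t) \<noteq> 0"
      obtain Y where "frame n P (g(i := h)) Y (\<lambda>x. lie n (X i) h x * J x)"
        using frame_replace[OF P fr _ i] h unfolding A_def by blast
      then have "Q (g(i := h))" unfolding Q_def using ne[unfolded lieV] t by blast
      moreover have "{l. l < n \<and> (g(i := h)) l \<in> A} = insert i {l. l < n \<and> g l \<in> A}" using h i by auto
      then have "N (g(i := h)) = Suc (N g)" unfolding N_def using notA by simp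
      ultimately show False using max by fastforce
    qed
    have A_lie: "holo n h P \<and> lie n V h \<in> A \<and> lie n V h (c t) = 0" if "h \<in> A" "t \<in> ball a r" for h t
    proof -
      have h: "holo n h P" using that by (simp add: A_def)
      have "holo n (lie n V h) P" by (rule holo_lie[OF P _ h]) (rule V)
      then have "lie n V h \<in> A" by (rule zero_A) (rule van[OF that(1)])
      then show ?thesis using h van[OF that] by blast
    qed
    obtain t0 where t0: "t0 \<in> ball a r" "J (c t0) \<noteq> 0" using J0 by blast
    obtain \<delta> \<gamma> where \<delta>: "\<delta> > 0" and \<gamma>: "\<gamma> 0 = c t0" "\<And>s. s \<in> ball 0 \<delta> \<Longrightarrow> \<gamma> s \<in> P"
      "\<And>s k. s \<in> ball 0 \<delta> \<Longrightarrow> k < n \<Longrightarrow> ((\<lambda>t. \<gamma> t k) has_field_derivative V k (\<gamma> s)) (at s)"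
      using holomorphic_flow[where V = V, OF P V cB[OF t0(1)]] by blast
    have inv_h: "h (\<gamma> s) = h (c t0)" if "h \<in> A" "s \<in> ball 0 \<delta>" for h s
      using flow_invariant[where V = V and A = A and p = "c t0", OF P V A_lie[OF _ t0(1)] \<gamma>(2,1,3) that] by blast
    \<comment> \<open>All of \<open>G\<close> lies in \<open>A\<close> and \<open>G\<close>
      separates points, so the flow line cannot leave \<open>c t0\<close>. Then \<open>V\<close>
      vanishes there, although \<open>lie n V (g i)\<close> does not.\<close>
    have const: "\<gamma> s = c t0" if s: "s \<in> ball 0 \<delta>" for s
    proof (rule ccontr)
      assume "\<gamma> s \<noteq> c t0"
      then obtain g' where "g' \<in> G" "g' (\<gamma> s) \<noteq> g' (c t0)" using sep[OF \<gamma>(2)[OF s] cB[OF t0(1)]] by blast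
      moreover have "g' \<in> A" using G \<open>g' \<in> G\<close> by (simp add: A_def)
      ultimately show False using inv_h s by blast
    qed
    have "V k (c t0) = 0" if "k < n" for k
    proof -
      have "((\<lambda>t. c t0 k) has_field_derivative V k (\<gamma> 0)) (at 0)"
        by (rule has_field_derivative_transform_within_open[OF \<gamma>(3) open_ball[of 0 \<delta>]]) (use that \<delta> const in auto)
      then show ?thesis using \<gamma>(1) DERIV_unique DERIV_const by metis
    qed
    then have "lie n V (g i) (c t0) = 0" by (simp add: lie_def)
    then show False using lieV Xg[OF cB[OF t0(1)] i i] t0(2) by simp
  qed
  have "continuous_on (cball a r) (\<lambda>t. c t k)" for k
  proof (cases "k < n")
    case False
    then have "c t k = 0" if "t \<in> cball a r" for t using cC[OF that] by (simp add: Cspace_def)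
    then show ?thesis by (intro continuous_on_eq[OF continuous_on_const[of _ 0]]) simp
  qed (use cont in blast)
  then have cc: "continuous_on (cball a r) c" by (rule continuous_on_coordinatewise_then_product)
  have isC: "isCont (\<lambda>t. c t i) t" if "t \<in> ball a r" "i < n" for t i
    using cont[OF that(2)] that(1) continuous_on_interior by (metis interior_cball)
  have evC: "\<forall>\<^sub>F u in at t. c u \<in> Cspace n" if "t \<in> ball a r" for t
  proof -
    have "\<forall>\<^sub>F u in at t. u \<in> ball a r" using that by (intro eventually_at_in_open') auto
    then show ?thesis by eventually_elim (use cC in auto)
  qed
  have cdiff: "(\<lambda>t. c t k) field_differentiable at t" if t: "t \<in> ball a r" and nz: "J (c t) \<noteq> 0" and k: "k < n" for t k
  proof (rule curve_differentiable_of_frame[OF P gh cB[OF t] isC[OF t] evC[OF t] _ _ nz k])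
    show "(\<lambda>t. g l (c t)) field_differentiable at t" if "l < n" for l
      using gA[OF that] t unfolding A_def by (auto intro: holomorphic_on_imp_differentiable_at)
    show "(\<Sum>l<n. X l k (c t) * pd j (g l) (c t)) = (if k = j then J (c t) else 0)" if "j < n" "k < n" for j k
      using inv cB[OF t] that by blast
  qed
  \<comment> \<open>\<open>J \<circ> c\<close> is not yet known to be holomorphic on the disc. Where
    it does not vanish, \<open>c\<close> is differentiable and hence so is
    \<open>J \<circ> c\<close>; together with continuity and \<open>J0\<close> this makes it an
    admissible first function in Rado's theorem.\<close>
  show ?thesis
  proof (rule Rado[of a r "\<lambda>t. J (c t)"])
    show "continuous_on (cball a r) (\<lambda>t. J (c t))"
      by (rule continuous_on_compose2[OF holo_continuous[OF J] cc]) (use cP in auto)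
    show "(\<lambda>t. J (c t)) field_differentiable at t" if "t \<in> ball a r" "J (c t) \<noteq> 0" for t
    proof -
      have "((\<lambda>t. c t i) has_field_derivative deriv (\<lambda>t. c t i) t) (at t)" if "i < n" for i
        using cdiff[OF \<open>t \<in> ball a r\<close> \<open>J (c t) \<noteq> 0\<close> that] field_differentiable_derivI by blast
      from holo_chain_curve[OF P J cB[OF that(1)] this evC[OF that(1)]]
      show ?thesis unfolding field_differentiable_def by blast
    qed
  qed (use cont[OF k] cdiff k J0 in auto)
qed

section \<open>Maps in several variables\<close>

lemma Cn_open_nonzero:
  assumes P: "Cn_open n P" and h: "continuous_on P (h :: _ \<Rightarrow> complex)"
  shows "Cn_open n {z \<in> P. h z \<noteq> 0}"
proof -
  have "openin (top_of_set P) (P \<inter> h -` (- {0}))"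
    using h by (intro continuous_openin_preimage_gen) auto
  moreover have "P \<inter> h -` (- {0}) = {z \<in> P. h z \<noteq> 0}" by auto
  ultimately show ?thesis using P openin_trans by metis
qed

lemma continuous_on_slice:
  assumes "continuous_on W f" "\<And>t. t \<in> S \<Longrightarrow> z(i := t) \<in> W"
  shows "continuous_on S (\<lambda>t. f (z(i := t)))"
proof (rule continuous_on_compose2[OF assms(1)])
  have "continuous_on S (\<lambda>t. (z(i := t)) k)" for k
    by (cases "k = i") (auto intro!: continuous_intros)
  then show "continuous_on S (\<lambda>t. z(i := t))" by (rule continuous_on_coordinatewise_then_product)
qed (use assms(2) in auto)

lemma continuous_on_Cspace:
  assumes "\<And>z. z \<in> W \<Longrightarrow> c z \<in> Cspace n" "\<And>k. k < n \<Longrightarrow> continuous_on W (\<lambda>z. c z k)"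
  shows "continuous_on W c"
proof (rule continuous_on_coordinatewise_then_product)
  show "continuous_on W (\<lambda>z. c z k)" for k
  proof (cases "k < n")
    case False
    then have "c z k = 0" if "z \<in> W" for z using assms(1)[OF that] by (simp add: Cspace_def)
    then show ?thesis by (intro continuous_on_eq[OF continuous_on_const[of _ 0]]) simp
  qed (use assms(2) in blast)
qed

lemma holo_of_separating:
  assumes W: "Cn_open m W" and P: "Cn_open n P" and cP: "\<And>z. z \<in> W \<Longrightarrow> c z \<in> P"
    and cont: "\<And>k. k < n \<Longrightarrow> continuous_on W (\<lambda>z. c z k)"
    and sep: "\<And>x y. x \<in> P \<Longrightarrow> y \<in> P \<Longrightarrow> x \<noteq> y \<Longrightarrow> \<exists>g\<in>G. g x \<noteq> g y"
    and G: "\<And>g. g \<in> G \<Longrightarrow> holo n g P" "\<And>g. g \<in> G \<Longrightarrow> holo m (\<lambda>z. g (c z)) W"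
    and k: "k < n"
  shows "holo m (\<lambda>z. c z k) W"
  unfolding holo_def
proof (intro conjI ballI allI impI)
  show "continuous_on W (\<lambda>z. c z k)" using cont k by blast
  fix z i assume z: "z \<in> W" and i: "i < m"
  obtain s where s: "s > 0" "\<And>t. t \<in> cball (z i) s \<Longrightarrow> z(i := t) \<in> W"
    using slice_in_Cn_open[OF W z i] by blast
  have "(\<lambda>t. c (z(i := t)) k) holomorphic_on ball (z i) s"
  proof (rule holomorphic_curve_of_separating[OF P _ _ sep G(1) _ k])
    show "c (z(i := t)) \<in> P" if "t \<in> cball (z i) s" for t using s cP that by blast
    show "continuous_on (cball (z i) s) (\<lambda>t. c (z(i := t)) k)" if "k < n" for k
      using continuous_on_slice[OF cont[OF that] s(2)] .
    show "(\<lambda>t. g (c (z(i := t)))) holomorphic_on ball (z i) s" if "g \<in> G" for g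
      by (rule holo_slice[OF G(2)[OF that] i]) (use s(2) in auto)
  qed
  then show "(\<lambda>t. c (z(i := t)) k) field_differentiable at (z i)"
    using s(1) by (intro holomorphic_on_imp_differentiable_at) auto
qed

lemma holo_compose:
  assumes W: "Cn_open m W" and P: "Cn_open n P" and cP: "\<And>z. z \<in> W \<Longrightarrow> c z \<in> P"
    and c: "\<And>k. k < n \<Longrightarrow> holo m (\<lambda>z. c z k) W" and f: "holo n f P"
  shows "holo m (\<lambda>z. f (c z)) W"
  unfolding holo_def
proof (intro conjI ballI allI impI)
  have "continuous_on W c"
    using continuous_on_Cspace[of W c n] cP Cn_open_subset[OF P] c holo_continuous by blast
  then show "continuous_on W (\<lambda>z. f (c z))"
    by (rule continuous_on_compose2[OF holo_continuous[OF f]]) (use cP in auto)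
  fix z i assume z: "z \<in> W" and i: "i < m"
  obtain s where s: "s > 0" "\<And>t. t \<in> cball (z i) s \<Longrightarrow> z(i := t) \<in> W"
    using slice_in_Cn_open[OF W z i] by blast
  have "\<forall>\<^sub>F t in at (z i). t \<in> ball (z i) s" using s by (intro eventually_at_in_open') auto
  then have "\<forall>\<^sub>F t in at (z i). c (z(i := t)) \<in> Cspace n"
    by eventually_elim (use s cP Cn_open_subset[OF P] in auto)
  moreover have "((\<lambda>t. c (z(i := t)) k) has_field_derivative pd i (\<lambda>z. c z k) z) (at (z i))" if "k < n" for k
    using holo_DERIV[OF c[OF that] i, of z "z i"] z by simp
  ultimately show "(\<lambda>t. f (c (z(i := t)))) field_differentiable at (z i)"
    using holo_chain_curve[OF P f, of "\<lambda>t. c (z(i := t))" "z i" "\<lambda>k. pd i (\<lambda>z. c z k) z"] cP[OF z]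
    unfolding field_differentiable_def by (intro exI) auto
qed

text \<open>Rado's theorem removes the zeros of \<open>w\<close> from a coordinate disc on which
  \<open>w\<close> is not identically zero. A disc may however lie inside the zero set; there
  \<open>f\<close> is the uniform limit of its restrictions to parallel discs through points with
  \<open>w \<noteq> 0\<close>, which \<open>dense\<close> provides.\<close>

lemma holo_removable:
  assumes W: "Cn_open m W" and w: "holo m w W" and f: "continuous_on W f"
    and dense: "\<And>z r. z \<in> W \<Longrightarrow> r > 0 \<Longrightarrow> \<exists>z'\<in>polydisc m z r. w z' \<noteq> 0"
    and loc: "\<And>z. z \<in> W \<Longrightarrow> w z \<noteq> 0 \<Longrightarrow> \<exists>Q. Cn_open m Q \<and> z \<in> Q \<and> holo m f Q"
  shows "holo m f W"
  unfolding holo_def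
proof (intro conjI ballI allI impI)
  show "continuous_on W f" by (rule f)
  fix z i assume z: "z \<in> W" and i: "i < m"
  obtain r0 where r0: "r0 > 0" "polydisc m z r0 \<subseteq> W" using polydisc_base[OF W z] by blast
  define r where "r = r0 / 2"
  have r: "r > 0" using r0 by (simp add: r_def)
  have zC: "z \<in> Cspace m" using Cn_open_subset[OF W z] .
  have in_W: "v(i := t) \<in> W" if "v \<in> polydisc m z r" "t \<in> cball (z i) r" for v t
    using polydisc_upd[of v m z r0 i t] polydisc_mono[of r r0 m z] that i r0 by (auto simp: r_def dist_commute)
  have slice_fd: "(\<lambda>t. u (v(i := t))) field_differentiable at t" if "holo m u Q" "v(i := t) \<in> Q" for u Q v t
    using holo_DERIV[OF that(1) i that(2)] field_differentiable_def by blast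
  have hol: "(\<lambda>t. f (v(i := t))) holomorphic_on ball (z i) r" if v: "v \<in> polydisc m z r" "w v \<noteq> 0" for v
  proof (rule Rado[of "z i" r "\<lambda>t. w (v(i := t))"])
    show "continuous_on (cball (z i) r) (\<lambda>t. w (v(i := t)))"
      by (rule continuous_on_slice[OF holo_continuous[OF w] in_W[OF v(1)]])
    show "continuous_on (cball (z i) r) (\<lambda>t. f (v(i := t)))"
      by (rule continuous_on_slice[OF f in_W[OF v(1)]])
    show "(\<lambda>t. w (v(i := t))) field_differentiable at t" if "t \<in> ball (z i) r" for t
      by (rule slice_fd[OF w in_W[OF v(1)]]) (use that in auto)
    show "(\<lambda>t. f (v(i := t))) field_differentiable at t" if "t \<in> ball (z i) r" "w (v(i := t)) \<noteq> 0" for t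
      using loc[OF in_W[OF v(1)] that(2)] slice_fd that(1) by auto
    show "\<exists>t\<in>ball (z i) r. w (v(i := t)) \<noteq> 0"
      using v i by (intro bexI[of _ "v i"]) (auto simp: polydisc_def dist_commute)
  qed
  \<comment> \<open>Uniform continuity near a compact disc: finitely many of the neighbourhoods
    supplied by continuity cover it, and the smallest radius serves all \<open>t\<close> at
    once.\<close>
  have close: "\<exists>d>0. \<forall>v\<in>polydisc m z d. \<forall>t\<in>cball (z i) r. dist (f (v(i := t))) (f (z(i := t))) < e" if e: "e > 0" for e
  proof -
    have "\<exists>d>0. \<forall>v\<in>polydisc m (z(i := t)) d. dist (f v) (f (z(i := t))) < e / 2" if "t \<in> cball (z i) r" for t
    proof -
      have "z(i := t) \<in> W" using in_W[OF polydisc_center[OF zC r] that] .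
      from continuous_on_polydiscD[OF W f this, of "e / 2"] e show ?thesis by (metis half_gt_zero)
    qed
    then obtain \<rho> where \<rho>: "\<And>t. t \<in> cball (z i) r \<Longrightarrow> \<rho> t > 0"
      "\<And>t v. t \<in> cball (z i) r \<Longrightarrow> v \<in> polydisc m (z(i := t)) (\<rho> t) \<Longrightarrow> dist (f v) (f (z(i := t))) < e / 2" by metis
    obtain T where T: "T \<subseteq> cball (z i) r" "finite T" "cball (z i) r \<subseteq> (\<Union>t\<in>T. ball t (\<rho> t))"
      by (rule compactE_image[of "cball (z i) r" "cball (z i) r" "\<lambda>t. ball t (\<rho> t)"])
        (use \<rho>(1) in \<open>auto intro!: bexI simp del: mem_cball\<close>)
    define d where "d = Min (insert 1 (\<rho> ` T))"
    have d: "d > 0" unfolding d_def using T \<rho>(1) by (subst Min_gr_iff) auto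
    have d_le: "d \<le> \<rho> t" if "t \<in> T" for t unfolding d_def using that T by (intro Min_le) auto
    have "dist (f (v(i := t))) (f (z(i := t))) < e" if v: "v \<in> polydisc m z d" and t: "t \<in> cball (z i) r" for v t
    proof -
      obtain s where s: "s \<in> T" "dist s t < \<rho> s" using T(3) t by auto
      have "v(i := t) \<in> polydisc m (z(i := s)) (\<rho> s)"
        using v s d_le[OF s(1)] i by (auto simp: polydisc_def Cspace_upd dist_commute less_le_trans)
      moreover have "z(i := t) \<in> polydisc m (z(i := s)) (\<rho> s)"
        using zC s \<rho>(1) T i by (auto simp: polydisc_def Cspace_upd dist_commute)
      ultimately show ?thesis using \<rho>(2)[of s] s(1) T(1) dist_triangle_half_l[of "f (v(i := t))" "f (z(i := s))" e "f (z(i := t))"]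
        by blast
    qed
    then show ?thesis using d by blast
  qed
  have "\<exists>v. v \<in> polydisc m z r \<and> w v \<noteq> 0 \<and> (\<forall>t\<in>cball (z i) r. dist (f (v(i := t))) (f (z(i := t))) < inverse (Suc N))" for N
  proof -
    obtain d where d: "d > 0" "\<forall>v\<in>polydisc m z d. \<forall>t\<in>cball (z i) r. dist (f (v(i := t))) (f (z(i := t))) < inverse (Suc N)"
      using close[of "inverse (Suc N)"] by auto
    obtain v where "v \<in> polydisc m z (min d r)" "w v \<noteq> 0" using dense[OF z, of "min d r"] d r by auto
    then show ?thesis using d(2) polydisc_mono[of "min d r" d m z] polydisc_mono[of "min d r" r m z]
      by (intro exI[of _ v]) (auto simp del: mem_cball)
  qed
  then obtain v where v: "\<And>N. v N \<in> polydisc m z r" "\<And>N. w (v N) \<noteq> 0"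
    "\<And>N t. t \<in> cball (z i) r \<Longrightarrow> dist (f ((v N)(i := t))) (f (z(i := t))) < inverse (Suc N)" by metis
  have "uniform_limit (cball (z i) r) (\<lambda>N t. f ((v N)(i := t))) (\<lambda>t. f (z(i := t))) sequentially"
  proof (rule uniform_limitI)
    fix e :: real assume e: "e > 0"
    have "\<forall>\<^sub>F N in sequentially. inverse (real (Suc N)) < e"
      using order_tendstoD(2)[OF LIMSEQ_inverse_real_of_nat e] .
    then show "\<forall>\<^sub>F N in sequentially. \<forall>t\<in>cball (z i) r. dist (f ((v N)(i := t))) (f (z(i := t))) < e"
      by eventually_elim (use v(3) in \<open>blast intro: less_trans\<close>)
  qed
  moreover have "\<forall>\<^sub>F N in sequentially. continuous_on (cball (z i) r) (\<lambda>t. f ((v N)(i := t))) \<and>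
      (\<lambda>t. f ((v N)(i := t))) holomorphic_on ball (z i) r"
    using hol[OF v(1,2)] continuous_on_slice[OF f in_W[OF v(1)]] by (intro always_eventually allI conjI) blast+
  ultimately have "(\<lambda>t. f (z(i := t))) holomorphic_on ball (z i) r"
    using holomorphic_uniform_limit[of "z i" r "\<lambda>N t. f ((v N)(i := t))" sequentially] by auto
  then show "(\<lambda>t. f (z(i := t))) field_differentiable at (z i)"
    using r by (intro holomorphic_on_imp_differentiable_at) auto
qed

section \<open>Manifolds\<close>

lemma is_chartD:
  assumes "is_chart n (U, \<phi>)"
  shows "open U" "Cn_open n (\<phi> ` U)" "continuous_on U \<phi>" "continuous_on (\<phi> ` U) (inv_into U \<phi>)"
    "\<And>x. x \<in> U \<Longrightarrow> inv_into U \<phi> (\<phi> x) = x"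
    "\<And>z. z \<in> \<phi> ` U \<Longrightarrow> inv_into U \<phi> z \<in> U \<and> \<phi> (inv_into U \<phi> z) = z"
  using assms unfolding is_chart_def homeomorphism_def
  by (auto simp: f_inv_into_f inv_into_into)

lemma chart_image_open:
  assumes ch: "is_chart n (U, \<phi>)" and S: "open S"
  shows "Cn_open n (\<phi> ` (U \<inter> S))"
proof -
  have "openin (top_of_set (\<phi> ` U)) (\<phi> ` U \<inter> inv_into U \<phi> -` S)"
    using is_chartD(4)[OF ch] S by (rule continuous_openin_preimage_gen)
  moreover have "\<phi> ` U \<inter> inv_into U \<phi> -` S = \<phi> ` (U \<inter> S)" using is_chartD(5,6)[OF ch] by force
  ultimately show ?thesis using is_chartD(2)[OF ch] openin_trans by metis
qed

lemma chart_preimage_open: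
  assumes ch: "is_chart n (U, \<phi>)" and Q: "Cn_open n Q" "Q \<subseteq> \<phi> ` U"
  shows "open (inv_into U \<phi> ` Q)"
proof -
  obtain T where T: "open T" "Q = Cspace n \<inter> T" using Q(1) by (auto simp: openin_open)
  have "inv_into U \<phi> ` Q = U \<inter> \<phi> -` T"
  proof
    show "inv_into U \<phi> ` Q \<subseteq> U \<inter> \<phi> -` T" using is_chartD(6)[OF ch] Q(2) T(2) by force
    show "U \<inter> \<phi> -` T \<subseteq> inv_into U \<phi> ` Q"
    proof
      fix x assume x: "x \<in> U \<inter> \<phi> -` T"
      then have "\<phi> x \<in> Q" using T(2) Cn_open_subset[OF is_chartD(2)[OF ch]] by auto
      then show "x \<in> inv_into U \<phi> ` Q" using is_chartD(5)[OF ch, of x] x by force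
    qed
  qed
  moreover have "open (U \<inter> \<phi> -` T)"
    using is_chartD(1,3)[OF ch] T(1) by (metis continuous_open_preimage)
  ultimately show ?thesis by simp
qed

section \<open>Maps between manifolds read in charts\<close>

lemma chart_pair:
  fixes \<Phi> :: "'b::topological_space \<Rightarrow> 'a::topological_space"
  assumes V: "is_chart m (V, \<psi>)" and U: "is_chart n (U, \<phi>)" and \<Phi>: "continuous_on UNIV \<Phi>"
  defines "W \<equiv> \<psi> ` (V \<inter> \<Phi> -` U)" and "c \<equiv> \<lambda>z. \<phi> (\<Phi> (inv_into V \<psi> z))"
  shows "Cn_open m W" "W \<subseteq> \<psi> ` V" "\<And>z. z \<in> W \<Longrightarrow> c z \<in> \<phi> ` U"
    "\<And>z. z \<in> W \<Longrightarrow> inv_into U \<phi> (c z) = \<Phi> (inv_into V \<psi> z)" "\<And>k. continuous_on W (\<lambda>z. c z k)"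
proof -
  have "open (\<Phi> -` U)" using \<Phi> is_chartD(1)[OF U] by (simp add: continuous_on_open_vimage)
  then show "Cn_open m W" unfolding W_def by (rule chart_image_open[OF V])
  show WV: "W \<subseteq> \<psi> ` V" by (auto simp: W_def)
  have WU: "\<Phi> (inv_into V \<psi> z) \<in> U" if "z \<in> W" for z using that is_chartD(5)[OF V] by (auto simp: W_def)
  show "c z \<in> \<phi> ` U" "inv_into U \<phi> (c z) = \<Phi> (inv_into V \<psi> z)" if "z \<in> W" for z
    using WU[OF that] is_chartD(5)[OF U] by (auto simp: c_def)
  have "continuous_on W (inv_into V \<psi>)" using is_chartD(4)[OF V] WV continuous_on_subset by blast
  then have "continuous_on W (\<lambda>z. \<Phi> (inv_into V \<psi> z))" by (rule continuous_on_compose2[OF \<Phi>]) simp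
  then have "continuous_on W c" unfolding c_def
    by (rule continuous_on_compose2[OF is_chartD(3)[OF U]]) (use WU in auto)
  then show "continuous_on W (\<lambda>z. c z k)" for k by (rule continuous_on_product_then_coordinatewise)
qed

lemma composition_holomorphic_in_charts:
  fixes \<Phi> :: "'b::topological_space \<Rightarrow> 'a::topological_space"
  assumes V: "is_chart m (V, \<psi>)" and U: "is_chart n (U, \<phi>)" and \<Phi>: "continuous_on UNIV \<Phi>"
    and F: "\<And>f. f \<in> F \<Longrightarrow> holo n (\<lambda>z. f (inv_into U \<phi> z)) (\<phi> ` U)"
      "\<And>f. f \<in> F \<Longrightarrow> holo m (\<lambda>z. f (\<Phi> (inv_into V \<psi> z))) (\<psi> ` V)"
    and sep: "separates_points F" and k: "k < n"
  shows "holo m (\<lambda>z. \<phi> (\<Phi> (inv_into V \<psi> z)) k) (\<psi> ` (V \<inter> \<Phi> -` U))"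
proof -
  note cp = chart_pair[OF V U \<Phi>]
  show ?thesis
  proof (rule holo_of_separating[OF cp(1) is_chartD(2)[OF U] cp(3) cp(5) _ _ _ k, where G = "(\<lambda>f z. f (inv_into U \<phi> z)) ` F"])
    fix x y assume xy: "x \<in> \<phi> ` U" "y \<in> \<phi> ` U" "x \<noteq> y"
    then have "inv_into U \<phi> x \<noteq> inv_into U \<phi> y" using is_chartD(6)[OF U] by metis
    then obtain f where "f \<in> F" "f (inv_into U \<phi> x) \<noteq> f (inv_into U \<phi> y)"
      using sep unfolding separates_points_def by blast
    then show "\<exists>g\<in>(\<lambda>f z. f (inv_into U \<phi> z)) ` F. g x \<noteq> g y" by (intro bexI[of _ "\<lambda>z. f (inv_into U \<phi> z)"]) auto
  next
    fix g assume "g \<in> (\<lambda>f z. f (inv_into U \<phi> z)) ` F"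
    then obtain f where f: "f \<in> F" "g = (\<lambda>z. f (inv_into U \<phi> z))" by blast
    show "holo n g (\<phi> ` U)" using F(1) f by simp
    show "holo m (\<lambda>z. g (\<phi> (\<Phi> (inv_into V \<psi> z)))) (\<psi> ` (V \<inter> \<Phi> -` U))"
      by (rule holo_cong[OF cp(1) holo_subset[OF F(2)[OF f(1)] cp(2)]]) (simp add: f(2) cp(4))
  qed
qed

text \<open>Near a point where \<open>\<omega>\<close> does not vanish, quotients of functions in \<open>F\<close> separate points and
  their pullbacks do not involve \<open>\<omega>\<close>.\<close>

lemma weighted_composition_holomorphic_in_charts:
  fixes \<Phi> :: "'b::topological_space \<Rightarrow> 'a::topological_space"
  assumes V: "is_chart m (V, \<psi>)" and U: "is_chart n (U, \<phi>)" and \<Phi>: "continuous_on UNIV \<Phi>"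
    and F: "\<And>f. f \<in> F \<Longrightarrow> holo n (\<lambda>z. f (inv_into U \<phi> z)) (\<phi> ` U)"
      "\<And>f. f \<in> F \<Longrightarrow> holo m (\<lambda>z. \<omega> (inv_into V \<psi> z) * f (\<Phi> (inv_into V \<psi> z))) (\<psi> ` V)"
    and ind: "two_independent F" and f0: "f0 \<in> F"
    and z0: "z0 \<in> \<psi> ` (V \<inter> \<Phi> -` U)" "\<omega> (inv_into V \<psi> z0) * f0 (\<Phi> (inv_into V \<psi> z0)) \<noteq> 0"
  shows "\<exists>Q. Cn_open m Q \<and> z0 \<in> Q \<and> (\<forall>k<n. holo m (\<lambda>z. \<phi> (\<Phi> (inv_into V \<psi> z)) k) Q) \<and>
    holo m (\<lambda>z. \<omega> (inv_into V \<psi> z)) Q"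
proof -
  note cp = chart_pair[OF V U \<Phi>]
  let ?W = "\<psi> ` (V \<inter> \<Phi> -` U)" and ?c = "\<lambda>z. \<phi> (\<Phi> (inv_into V \<psi> z))"
  define h where "h f z = \<omega> (inv_into V \<psi> z) * f (\<Phi> (inv_into V \<psi> z))" for f z
  define e where "e f x = f (inv_into U \<phi> x)" for f :: "'a \<Rightarrow> complex" and x
  have h: "holo m (h f) ?W" if "f \<in> F" for f
    using holo_subset[OF F(2)[OF that] cp(2)] by (simp add: h_def[abs_def])
  have e: "holo n (e f) (\<phi> ` U)" if "f \<in> F" for f using F(1)[OF that] by (simp add: e_def[abs_def])
  define Q where "Q = {z \<in> ?W. h f0 z \<noteq> 0}"
  define P where "P = {x \<in> \<phi> ` U. e f0 x \<noteq> 0}"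
  have Q: "Cn_open m Q" unfolding Q_def by (rule Cn_open_nonzero[OF cp(1) holo_continuous[OF h[OF f0]]])
  have P: "Cn_open n P" unfolding P_def by (rule Cn_open_nonzero[OF is_chartD(2)[OF U] holo_continuous[OF e[OF f0]]])
  have ec: "e f (?c z) = f (\<Phi> (inv_into V \<psi> z))" if "z \<in> ?W" for f z using cp(4)[OF that] by (simp add: e_def)
  have cP: "?c z \<in> P" if "z \<in> Q" for z using that cp(3)[of z] ec[of z] by (auto simp: P_def Q_def h_def)
  have Q_sub: "Q \<subseteq> ?W" and P_sub: "P \<subseteq> \<phi> ` U" by (auto simp: Q_def P_def)
  have c: "holo m (\<lambda>z. ?c z k) Q" if k: "k < n" for k
  proof (rule holo_of_separating[OF Q P cP _ _ _ _ k, where G = "(\<lambda>f x. e f x / e f0 x) ` F"])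
    show "continuous_on Q (\<lambda>z. ?c z k)" for k using cp(5) Q_sub continuous_on_subset by blast
    fix x y assume xy: "x \<in> P" "y \<in> P" "x \<noteq> y"
    then have ne: "inv_into U \<phi> x \<noteq> inv_into U \<phi> y" using is_chartD(6)[OF U] P_sub by (metis subsetD)
    have nz: "e f0 x \<noteq> 0" "e f0 y \<noteq> 0" using xy by (auto simp: P_def)
    show "\<exists>g\<in>(\<lambda>f x. e f x / e f0 x) ` F. g x \<noteq> g y"
    proof (rule ccontr)
      assume "\<not> ?thesis"
      \<comment> \<open>Equal quotients at \<open>x\<close> and \<open>y\<close> for every
        \<open>f\<close> would make the two point evaluations proportional, a linear relation with
        nonzero coefficients.\<close>
      then have "\<forall>f\<in>F. e f0 y * f (inv_into U \<phi> x) + (- e f0 x) * f (inv_into U \<phi> y) = 0"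
        using nz by (auto simp: e_def field_simps)
      then have "e f0 y = 0" using ind ne unfolding two_independent_def by blast
      then show False using nz by simp
    qed
  next
    fix g assume "g \<in> (\<lambda>f x. e f x / e f0 x) ` F"
    then obtain f where f: "f \<in> F" "g = (\<lambda>x. e f x / e f0 x)" by blast
    show "holo n g P" unfolding f(2)
      by (intro holo_divide holo_subset[OF e P_sub] f f0) (auto simp: P_def)
    have "holo m (\<lambda>z. h f z / h f0 z) Q"
      by (intro holo_divide holo_subset[OF h Q_sub] f f0) (auto simp: Q_def)
    then show "holo m (\<lambda>z. g (?c z)) Q"
      by (rule holo_cong[OF Q]) (use ec in \<open>auto simp: f(2) h_def Q_def\<close>)
  qed
  \<comment> \<open>Now that \<open>\<Phi>\<close> is holomorphic on \<open>Q\<close>, the weight is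
    recovered by dividing the image of \<open>f0\<close> under the operator by
    \<open>f0 \<circ> \<Phi>\<close>.\<close>
  have "holo m (\<lambda>z. e f0 (?c z)) Q" by (rule holo_compose[OF Q P cP c holo_subset[OF e[OF f0] P_sub]])
  then have "holo m (\<lambda>z. h f0 z / e f0 (?c z)) Q"
    by (intro holo_divide holo_subset[OF h[OF f0] Q_sub]) (use cP in \<open>auto simp: P_def\<close>)
  then have "holo m (\<lambda>z. \<omega> (inv_into V \<psi> z)) Q"
    by (rule holo_cong[OF Q]) (use ec in \<open>auto simp: h_def Q_def\<close>)
  moreover have "z0 \<in> Q" using z0 by (simp add: Q_def h_def)
  ultimately show ?thesis using Q c by blast
qed

text \<open>On each coordinate disc \<open>w\<close> either vanishes identically or falls under
  Rado's theorem in its classical form.\<close>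

lemma holo_of_holo_off_zeros:
  assumes W: "Cn_open m W" and w: "continuous_on W w"
    and loc: "\<And>z. z \<in> W \<Longrightarrow> w z \<noteq> 0 \<Longrightarrow> \<exists>Q. Cn_open m Q \<and> z \<in> Q \<and> holo m w Q"
  shows "holo m w W"
  unfolding holo_def
proof (intro conjI ballI allI impI)
  show "continuous_on W w" by (rule w)
  fix z i assume z: "z \<in> W" and i: "i < m"
  obtain s where s: "s > 0" "\<And>t. t \<in> cball (z i) s \<Longrightarrow> z(i := t) \<in> W"
    using slice_in_Cn_open[OF W z i] by blast
  have cont: "continuous_on (cball (z i) s) (\<lambda>t. w (z(i := t)))"
    by (rule continuous_on_slice[OF w s(2)])
  have fd: "(\<lambda>t. w (z(i := t))) field_differentiable at t" if t: "t \<in> ball (z i) s" "w (z(i := t)) \<noteq> 0" for t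
  proof -
    obtain Q where "Cn_open m Q" "z(i := t) \<in> Q" "holo m w Q" using loc[OF s(2) t(2)] t(1) by auto
    then show ?thesis using holo_DERIV[of m w Q i z t] i field_differentiable_def by blast
  qed
  have "(\<lambda>t. w (z(i := t))) holomorphic_on ball (z i) s"
  proof (cases "\<exists>t\<in>ball (z i) s. w (z(i := t)) \<noteq> 0")
    case True
    then show ?thesis using Rado[OF cont fd cont fd] by blast
  next
    case False
    have "(\<lambda>_. 0) holomorphic_on ball (z i) s" by simp
    then show ?thesis by (rule holomorphic_transform) (use False in auto)
  qed
  then show "(\<lambda>t. w (z(i := t))) field_differentiable at (z i)"
    using s(1) by (intro holomorphic_on_imp_differentiable_at) auto
qed

text \<open>The interior \<open>Z\<close> of the zero set is closed: a coordinate polydisc around a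
  point of its closure meets \<open>Z\<close> in a nonempty open set, so the local identity theorem
  makes \<open>\<omega>\<close> vanish on the polydisc and the point is interior. Connectedness does
  the rest.\<close>

lemma identity_theorem_manifold:
  fixes \<omega> :: "'b::t2_space \<Rightarrow> complex"
  assumes B: "connected_complex_manifold m B"
    and \<omega>: "\<And>V \<psi>. (V, \<psi>) \<in> B \<Longrightarrow> holo m (\<lambda>z. \<omega> (inv_into V \<psi> z)) (\<psi> ` V)"
    and S: "open S" "S \<noteq> {}" "\<And>y. y \<in> S \<Longrightarrow> \<omega> y = 0"
  shows "\<omega> y = 0"
proof -
  define Z where "Z = interior {y. \<omega> y = 0}"
  have Z0: "\<omega> y = 0" if "y \<in> Z" for y using that interior_subset unfolding Z_def by blast
  have "closed Z"
    unfolding closure_subset_eq[symmetric]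
  proof
    fix y assume y: "y \<in> closure Z"
    obtain V \<psi> where V: "(V, \<psi>) \<in> B" "y \<in> V"
      using B unfolding connected_complex_manifold_def complex_atlas_def by blast
    have ch: "is_chart m (V, \<psi>)"
      using B V(1) unfolding connected_complex_manifold_def complex_atlas_def by blast
    obtain r where r: "r > 0" "polydisc m (\<psi> y) r \<subseteq> \<psi> ` V"
      using polydisc_base[OF is_chartD(2)[OF ch], of "\<psi> y"] V(2) by blast
    define T where "T = inv_into V \<psi> ` polydisc m (\<psi> y) r"
    have T: "open T" unfolding T_def by (rule chart_preimage_open[OF ch Cn_open_polydisc r(2)])
    have "\<psi> y \<in> polydisc m (\<psi> y) r"
      using polydisc_center[OF Cn_open_subset[OF is_chartD(2)[OF ch]] r(1)] V(2) by blast
    then have yT: "y \<in> T" using is_chartD(5)[OF ch V(2)] unfolding T_def by (metis imageI)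
    have "T \<inter> Z \<noteq> {}" using y yT T open_Int_closure_eq_empty by blast
    have TV: "T \<subseteq> V" using is_chartD(6)[OF ch] r(2) by (auto simp: T_def)
    have "\<omega> (inv_into V \<psi> x) = 0" if x: "x \<in> polydisc m (\<psi> y) r" for x
    proof (rule holo_identity_polydisc[OF holo_subset[OF \<omega>[OF V(1)] r(2)] _ _ _ _ x])
      show "Cn_open m (\<psi> ` (V \<inter> (T \<inter> Z)))" using T by (intro chart_image_open[OF ch]) (auto simp: Z_def)
      show "\<psi> ` (V \<inter> (T \<inter> Z)) \<noteq> {}" using \<open>T \<inter> Z \<noteq> {}\<close> TV by blast
      show "\<psi> ` (V \<inter> (T \<inter> Z)) \<subseteq> polydisc m (\<psi> y) r" using is_chartD(6)[OF ch] r(2) by (force simp: T_def)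
      show "\<omega> (inv_into V \<psi> w) = 0" if "w \<in> \<psi> ` (V \<inter> (T \<inter> Z))" for w
        using that is_chartD(5)[OF ch] Z0 by auto
    qed
    then have "T \<subseteq> {y. \<omega> y = 0}" by (auto simp: T_def)
    then show "y \<in> Z" using T yT interior_maximal unfolding Z_def by blast
  qed
  moreover have "open Z" by (simp add: Z_def)
  moreover have "connected (UNIV :: 'b set)" using B unfolding connected_complex_manifold_def by blast
  moreover have "Z \<noteq> {}" using S interior_maximal[of S "{y. \<omega> y = 0}"] unfolding Z_def by blast
  ultimately have "Z = UNIV" using connected_clopen[of "UNIV :: 'b set"] by auto
  then show ?thesis using Z0 by blast
qed

section \<open>Holomorphic functions and maps on manifolds\<close>

lemma holomorphic_funD:
  assumes A: "complex_atlas n A" and f: "holomorphic_fun n A f" and U: "(U, \<phi>) \<in> A"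
  shows "holo n (\<lambda>z. f (inv_into U \<phi> z)) (\<phi> ` U)"
proof (rule holomorphic_Cn_imp_holo)
  have "is_chart n (U, \<phi>)" using A U unfolding complex_atlas_def by blast
  then show "Cn_open n (\<phi> ` U)" by (rule is_chartD(2))
  show "holomorphic_Cn n (\<lambda>z. f (inv_into U \<phi> z)) (\<phi> ` U)" using f U unfolding holomorphic_fun_def by blast
qed

lemma holomorphic_mapI:
  assumes A: "complex_atlas n A" and B: "complex_atlas m B" and \<Phi>: "continuous_on UNIV \<Phi>"
    and *: "\<And>V \<psi> U \<phi> k. (V, \<psi>) \<in> B \<Longrightarrow> (U, \<phi>) \<in> A \<Longrightarrow> k < n \<Longrightarrow>
      holo m (\<lambda>z. \<phi> (\<Phi> (inv_into V \<psi> z)) k) (\<psi> ` (V \<inter> \<Phi> -` U))"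
  shows "holomorphic_map m B n A \<Phi>"
  unfolding holomorphic_map_def
proof (intro conjI \<Phi> ballI allI impI, clarify)
  fix V \<psi> U \<phi> k assume VU: "(V, \<psi>) \<in> B" "(U, \<phi>) \<in> A" and k: "k < n"
  have "is_chart m (V, \<psi>)" "is_chart n (U, \<phi>)" using A B VU unfolding complex_atlas_def by blast+
  then show "holomorphic_Cn m (\<lambda>z. \<phi> (\<Phi> (inv_into V \<psi> z)) k) (\<psi> ` (V \<inter> \<Phi> -` U))"
    by (intro holo_imp_holomorphic_Cn chart_pair(1)[OF _ _ \<Phi>] *[OF VU k])
qed

lemma holomorphic_funI:
  assumes B: "complex_atlas m B"
    and *: "\<And>V \<psi>. (V, \<psi>) \<in> B \<Longrightarrow> holo m (\<lambda>z. \<omega> (inv_into V \<psi> z)) (\<psi> ` V)"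
  shows "holomorphic_fun m B \<omega>"
  unfolding holomorphic_fun_def
proof (intro ballI, clarify)
  fix V \<psi> assume V: "(V, \<psi>) \<in> B"
  have "is_chart m (V, \<psi>)" using B V unfolding complex_atlas_def by blast
  then show "holomorphic_Cn m (\<lambda>z. \<omega> (inv_into V \<psi> z)) (\<psi> ` V)"
    by (intro holo_imp_holomorphic_Cn is_chartD(2) *[OF V])
qed

theorem composition_operator_holomorphic:
  fixes \<Phi> :: "'b::topological_space \<Rightarrow> 'a::topological_space"
  assumes A: "complex_atlas n A" and B: "complex_atlas m B" and \<Phi>: "continuous_on UNIV \<Phi>"
    and F: "\<And>f. f \<in> F \<Longrightarrow> holomorphic_fun n A f" "\<And>f. f \<in> F \<Longrightarrow> holomorphic_fun m B (comp_op \<Phi> f)"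
    and sep: "separates_points F"
  shows "holomorphic_map m B n A \<Phi>"
proof (rule holomorphic_mapI[OF A B \<Phi>])
  fix V \<psi> U \<phi> k assume VU: "(V, \<psi>) \<in> B" "(U, \<phi>) \<in> A" and k: "k < n"
  have ch: "is_chart m (V, \<psi>)" "is_chart n (U, \<phi>)" using A B VU unfolding complex_atlas_def by blast+
  show "holo m (\<lambda>z. \<phi> (\<Phi> (inv_into V \<psi> z)) k) (\<psi> ` (V \<inter> \<Phi> -` U))"
  proof (rule composition_holomorphic_in_charts[OF ch \<Phi> _ _ sep k])
    show "holo n (\<lambda>z. f (inv_into U \<phi> z)) (\<phi> ` U)" if "f \<in> F" for f
      using holomorphic_funD[OF A F(1)[OF that] VU(2)] .
    show "holo m (\<lambda>z. f (\<Phi> (inv_into V \<psi> z))) (\<psi> ` V)" if "f \<in> F" for f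
      using holomorphic_funD[OF B F(2)[OF that] VU(1)] by (simp add: comp_op_def weighted_comp_def)
  qed
qed

text \<open>If \<open>\<omega>\<close> were zero everywhere, nothing could be said about
  \<open>\<Phi>\<close>. A single \<open>y0\<close> with \<open>\<omega> y0 \<noteq> 0\<close>
  suffices, because the identity theorem then makes such points dense.\<close>

theorem weighted_composition_operator_holomorphic:
  fixes \<Phi> :: "'b::t2_space \<Rightarrow> 'a::t2_space"
  assumes A: "complex_atlas n A" and B: "connected_complex_manifold m B" and \<Phi>: "continuous_on UNIV \<Phi>"
    and \<omega>: "continuous_on UNIV \<omega>" "\<omega> y0 \<noteq> 0"
    and F: "\<And>f. f \<in> F \<Longrightarrow> holomorphic_fun n A f" "\<And>f. f \<in> F \<Longrightarrow> holomorphic_fun m B (weighted_comp \<Phi> \<omega> f)"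
    and ind: "two_independent F" and two: "\<And>x :: 'a. \<exists>x'. x' \<noteq> x"
  shows "holomorphic_map m B n A \<Phi> \<and> holomorphic_fun m B \<omega>"
proof -
  have B': "complex_atlas m B" using B unfolding connected_complex_manifold_def by blast
  \<comment> \<open>Independence of the evaluations at \<open>x\<close> and at a second point
    \<open>x'\<close> is used with the coefficients \<open>1\<close> and \<open>0\<close>:
    evaluation at \<open>x\<close> is not the zero functional.\<close>
  have nz: "\<exists>f\<in>F. f x \<noteq> 0" for x
  proof (rule ccontr)
    assume "\<not> ?thesis"
    then have "\<forall>f\<in>F. 1 * f x + 0 * f x' = 0" for x' by simp
    moreover obtain x' where "x \<noteq> x'" using two[of x] by metis
    ultimately show False using ind unfolding two_independent_def by (metis one_neq_zero)
  qed
  have loc: "\<exists>Q. Cn_open m Q \<and> z \<in> Q \<and> (\<forall>k<n. holo m (\<lambda>z. \<phi> (\<Phi> (inv_into V \<psi> z)) k) Q) \<and>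
      holo m (\<lambda>z. \<omega> (inv_into V \<psi> z)) Q"
    if VU: "(V, \<psi>) \<in> B" "(U, \<phi>) \<in> A" and z: "z \<in> \<psi> ` (V \<inter> \<Phi> -` U)" "\<omega> (inv_into V \<psi> z) \<noteq> 0" for V \<psi> U \<phi> z
  proof -
    have ch: "is_chart m (V, \<psi>)" "is_chart n (U, \<phi>)" using A B' VU unfolding complex_atlas_def by blast+
    obtain f0 where f0: "f0 \<in> F" "f0 (\<Phi> (inv_into V \<psi> z)) \<noteq> 0" using nz by blast
    show ?thesis
    proof (rule weighted_composition_holomorphic_in_charts[OF ch \<Phi> _ _ ind f0(1) z(1)])
      show "holo n (\<lambda>z. f (inv_into U \<phi> z)) (\<phi> ` U)" if "f \<in> F" for f
        using holomorphic_funD[OF A F(1)[OF that] VU(2)] .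
      show "holo m (\<lambda>z. \<omega> (inv_into V \<psi> z) * f (\<Phi> (inv_into V \<psi> z))) (\<psi> ` V)" if "f \<in> F" for f
        using holomorphic_funD[OF B' F(2)[OF that] VU(1)] by (simp add: weighted_comp_def)
    qed (use z f0 in auto)
  qed
  \<comment> \<open>The weight has to be settled before \<open>\<Phi>\<close>: its zero set is
    removable for \<open>\<Phi>\<close> because \<open>\<omega>\<close> is holomorphic and therefore
    subject to the identity theorem.\<close>
  have hol_\<omega>: "holo m (\<lambda>z. \<omega> (inv_into V \<psi> z)) (\<psi> ` V)" if V: "(V, \<psi>) \<in> B" for V \<psi>
  proof (rule holo_of_holo_off_zeros)
    have ch: "is_chart m (V, \<psi>)" using B' V unfolding complex_atlas_def by blast
    show "Cn_open m (\<psi> ` V)" by (rule is_chartD(2)[OF ch])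
    show "continuous_on (\<psi> ` V) (\<lambda>z. \<omega> (inv_into V \<psi> z))"
      by (rule continuous_on_compose2[OF \<omega>(1) is_chartD(4)[OF ch]]) simp
    fix z assume z: "z \<in> \<psi> ` V" "\<omega> (inv_into V \<psi> z) \<noteq> 0"
    obtain U \<phi> where U: "(U, \<phi>) \<in> A" "\<Phi> (inv_into V \<psi> z) \<in> U"
      using A unfolding complex_atlas_def by blast
    have "z \<in> \<psi> ` (V \<inter> \<Phi> -` U)"
      using is_chartD(6)[OF ch z(1)] U(2) by (intro image_eqI[of _ _ "inv_into V \<psi> z"]) auto
    from loc[OF V U(1) this z(2)]
    show "\<exists>Q. Cn_open m Q \<and> z \<in> Q \<and> holo m (\<lambda>z. \<omega> (inv_into V \<psi> z)) Q" by blast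
  qed
  have "holomorphic_map m B n A \<Phi>"
  proof (rule holomorphic_mapI[OF A B' \<Phi>])
    fix V \<psi> U \<phi> k assume VU: "(V, \<psi>) \<in> B" "(U, \<phi>) \<in> A" and k: "k < n"
    have ch: "is_chart m (V, \<psi>)" "is_chart n (U, \<phi>)" using A B' VU unfolding complex_atlas_def by blast+
    note cp = chart_pair[OF ch \<Phi>]
    show "holo m (\<lambda>z. \<phi> (\<Phi> (inv_into V \<psi> z)) k) (\<psi> ` (V \<inter> \<Phi> -` U))"
    proof (rule holo_removable[OF cp(1) holo_subset[OF hol_\<omega>[OF VU(1)] cp(2)] cp(5)])
      fix z :: "nat \<Rightarrow> complex" and r :: real assume z: "z \<in> \<psi> ` (V \<inter> \<Phi> -` U)" and r: "r > 0"
      define S where "S = inv_into V \<psi> ` (polydisc m z r \<inter> \<psi> ` V)"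
      have "open S" unfolding S_def
        by (rule chart_preimage_open[OF ch(1)]) (use Cn_open_polydisc is_chartD(2)[OF ch(1)] in auto)
      moreover have "z \<in> polydisc m z r \<inter> \<psi> ` V"
        using z cp(2) polydisc_center[OF Cn_open_subset[OF cp(1) z] r] by blast
      then have "S \<noteq> {}" unfolding S_def by blast
      \<comment> \<open>If \<open>\<omega>\<close> vanished on the nonempty open set
        \<open>S\<close>, it would vanish on all of the connected manifold, hence at
        \<open>y0\<close>.\<close>
      ultimately obtain y where "y \<in> S" "\<omega> y \<noteq> 0" using identity_theorem_manifold[OF B hol_\<omega>] \<omega>(2) by metis
      then show "\<exists>z'\<in>polydisc m z r. \<omega> (inv_into V \<psi> z') \<noteq> 0" unfolding S_def by blast
    next
      fix z assume "z \<in> \<psi> ` (V \<inter> \<Phi> -` U)" "\<omega> (inv_into V \<psi> z) \<noteq> 0"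
      then show "\<exists>Q. Cn_open m Q \<and> z \<in> Q \<and> holo m (\<lambda>z. \<phi> (\<Phi> (inv_into V \<psi> z)) k) Q"
        using loc[OF VU] k by blast
    qed
  qed
  then show ?thesis using holomorphic_funI[OF B' hol_\<omega>] by blast
qed

theorem theorem4p4:
  fixes A :: "'a::t2_space chart set" and B :: "'b::t2_space chart set"
    and F :: "('a \<Rightarrow> complex) set" and E :: "('b \<Rightarrow> complex) set"
    and normF :: "('a \<Rightarrow> complex) \<Rightarrow> real" and normE :: "('b \<Rightarrow> complex) \<Rightarrow> real"
    and n m :: nat
  assumes "connected_complex_manifold n A"
    and "connected_complex_manifold m B"
    and "\<not> compact (UNIV :: 'a set)"
    and "NSHF n A F normF"
    and "NSHF m B E normE"
  shows "(separates_points F \<longrightarrow>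
            (\<forall>\<Phi> :: 'b \<Rightarrow> 'a.
               continuous_on UNIV \<Phi> \<and> comp_op \<Phi> ` F \<subseteq> E \<longrightarrow> holomorphic_map m B n A \<Phi>)) \<and>
         (two_independent F \<longrightarrow>
            (\<forall>(\<Phi> :: 'b \<Rightarrow> 'a) (\<omega> :: 'b \<Rightarrow> complex).
               continuous_on UNIV \<Phi> \<and> continuous_on UNIV \<omega> \<and> weighted_comp \<Phi> \<omega> ` F \<subseteq> E \<longrightarrow>
               (\<exists>(\<Phi>' :: 'b \<Rightarrow> 'a) (\<omega>' :: 'b \<Rightarrow> complex).
                  holomorphic_map m B n A \<Phi>' \<and> holomorphic_fun m B \<omega>' \<and>
                  (\<forall>f\<in>F. weighted_comp \<Phi> \<omega> f = weighted_comp \<Phi>' \<omega>' f))))"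
proof -
  have A: "complex_atlas n A" and B: "complex_atlas m B"
    using assms(1,2) unfolding connected_complex_manifold_def by blast+
  have F: "holomorphic_fun n A f" if "f \<in> F" for f using assms(4) that unfolding NSHF_def by blast
  have E: "holomorphic_fun m B f" if "f \<in> E" for f using assms(5) that unfolding NSHF_def by blast
  have two: "\<exists>x'. x' \<noteq> x" for x :: 'a
  proof (rule ccontr)
    assume "\<not> ?thesis"
    then have "UNIV = {x}" by auto
    then show False using assms(3) by (metis finite.emptyI finite_imp_compact finite_insert)
  qed
  show ?thesis
  proof (intro conjI impI allI; elim conjE)
    fix \<Phi> :: "'b \<Rightarrow> 'a"
    assume "separates_points F" "continuous_on UNIV \<Phi>" "comp_op \<Phi> ` F \<subseteq> E"
    then show "holomorphic_map m B n A \<Phi>"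
      using F E by (intro composition_operator_holomorphic[OF A B, where F = F]) auto
  next
    fix \<Phi> :: "'b \<Rightarrow> 'a" and \<omega> :: "'b \<Rightarrow> complex"
    assume ind: "two_independent F" and cont: "continuous_on UNIV \<Phi>" "continuous_on UNIV \<omega>"
      and sub: "weighted_comp \<Phi> \<omega> ` F \<subseteq> E"
    show "\<exists>(\<Phi>' :: 'b \<Rightarrow> 'a) (\<omega>' :: 'b \<Rightarrow> complex).
      holomorphic_map m B n A \<Phi>' \<and> holomorphic_fun m B \<omega>' \<and>
      (\<forall>f\<in>F. weighted_comp \<Phi> \<omega> f = weighted_comp \<Phi>' \<omega>' f)"
    proof (cases "\<exists>y0. \<omega> y0 \<noteq> 0")
      case True
      then obtain y0 where "\<omega> y0 \<noteq> 0" by blast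
      then have "holomorphic_map m B n A \<Phi> \<and> holomorphic_fun m B \<omega>"
        using sub F E by (intro weighted_composition_operator_holomorphic[OF A assms(2) cont _ _ _ ind two]) auto
      then show ?thesis by blast
    next
      case False
      \<comment> \<open>For \<open>\<omega> = 0\<close> the given \<open>\<Phi>\<close> may fail to
        be holomorphic, but the operator is zero and is induced by any constant map with weight
        \<open>0\<close>; \<open>undefined\<close> is merely some point of \<open>X\<close>.\<close>
      have "holomorphic_map m B n A (\<lambda>_. undefined)"
        by (rule holomorphic_mapI[OF A B]) (simp_all add: holo_const)
      moreover have "holomorphic_fun m B (\<lambda>_. 0)"
        by (rule holomorphic_funI[OF B]) (simp add: holo_const)
      ultimately show ?thesis using False
        by (intro exI[of _ "\<lambda>_. undefined"] exI[of _ "\<lambda>_. 0"]) (simp add: weighted_comp_def)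
    qed
  qed
qed

end
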